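(* Assume that $g\in C^1(\mathbb R)$, $g(0)=0$; that there exists $\lambda\ge 0$ such that $g'(r)\ge-\lambda$ for all $r\in\mathbb R$; and that $\liminf_{|r|\to\infty}\big(g(r)r+(\lambda_1-\kappa)r^2\big)>0$ for some $\kappa>0$. Set $\beta(r):=g(r)+\lambda r$ and let $\widehat\beta$ be a primitive of $\beta$. Let $u_0\in\mathcal X_{\sigma0}$ with $\widehat\beta(u_0)\in L^1(\Omega)$, and let $(u,w)$ be the unique weak solution of the fractional Cahn-Hilliard system on $(0,\infty)$ with initial datum $u_0$. Then, for any sequence $t_n\to\infty$, there exist a (not relabeled) subsequence of $(t_n)$ and $\phi\in\mathcal X_{\sigma0}$ such that $$u(t_n)\to\phi\ \text{ strongly in }\mathcal X_{\sigma0}\quad\text{and}\quad\mathbb E_\sigma(u(t_n))\to\mathbb E_\sigma(\phi),$$ and moreover $\phi$ solves the stationary problem $$g(\phi)\in L^2(\Omega)\quad\text{and}\quad\mathfrak A_\sigma\phi+g(\phi)=0\ \text{ in }\mathcal X_{\sigma0}'.$$ In particular, the $\omega$-limit set of $u$ is nonempty and is contained in the set of all solutions $\phi \in \mathcal X_{\sigma0}$ of this stationary problem.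
   Context: $\Omega\subset\mathbb R^N$ is a bounded domain with smooth boundary and $s,\sigma\in(0,1)$. Functions in $L^p(\Omega)$ are identified with their extensions by zero to $\mathbb R^N$. For $a\in(0,1)$, $C_a>0$ denotes the normalization constant (depending only on $N$ and $a$) in the singular-integral definition $(-\Delta)^a u(x)=C_a\,\mathrm{p.v.}\int_{\mathbb R^N}\frac{u(x)-u(y)}{|x-y|^{N+2a}}dy$, and $$\mathcal X_{a0}:=\{v\in H^a(\mathbb R^N): v=0\text{ a.e. in }\mathbb R^N\setminus\Omega\},\qquad \|v\|_{\mathcal X_{a0}}^2:=\frac{C_a}{2}\iint_{\mathbb R^{2N}}\frac{|v(x)-v(y)|^2}{|x-y|^{N+2a}}\,dx\,dy,$$ a Hilbert space with dual $\mathcal X_{a0}'$; $\mathcal X_{a0}\hookrightarrow L^2(\Omega)\simeq L^2(\Omega)'\hookrightarrow\mathcal X_{a0}'$. The operator $\mathfrak A_a:\mathcal X_{a0}\to\mathcal X_{a0}'$ is defined by $$\langle\mathfrak A_a u,v\rangle_{\mathcal X_{a0}}=\frac{C_a}{2}\iint_{\mathbb R^{2N}}\frac{(u(x)-u(y))(v(x)-v(y))}{|x-y|^{N+2a}}\,dx\,dy .$$ $\lambda_1=\inf_{v\in\mathcal X_{\sigma0}\setminus\{0\}}\|v\|_{\mathcal X_{\sigma0}}^2/\|v\|_{L^2(\Omega)}^2>0$ is the first eigenvalue of the fractional Dirichlet Laplacian of order $\sigma$. Energy: with $\widehat g$ a fixed primitive of $g$, $\mathbb E_\sigma(v):=\frac12\|v\|_{\mathcal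 X_{\sigma0}}^2+\int_\Omega\widehat g(v(x))\,dx$ for $v\in\mathcal X_{\sigma0}$ with $\widehat g(v)^-\in L^1(\Omega)$ ($(\cdot)^-$ is the negative part). The fractional Cahn-Hilliard system is $u_t+(-\Delta)^s w=0$, $w=(-\Delta)^\sigma u+g(u)$ in $\Omega\times(0,\infty)$, $u|_{t=0}=u_0$ in $\Omega$, $u=w=0$ in $\mathbb R^N\setminus\Omega$. Weak solution: for $0\le S<T\le\infty$, $(u,w)$ is a weak solution on $(S,T)$ if $u\in C_w([S,T);\mathcal X_{\sigma0})$ (weakly continuous), $u_t\in L^2(S,T;\mathcal X_{s0}')$, $w\in L^2(S,T;\mathcal X_{s0})$, $g(u)\in L^2_{\rm loc}(S,T;L^2(\Omega))$, and for a.e. $t\in(S,T)$: $u_t(t)+\mathfrak A_s w(t)=0$ in $\mathcal X_{s0}'$ and $w(t)=\mathfrak A_\sigma u(t)+g(u(t))$ in $\mathcal X_{\sigma0}'$; if $S=0$, having initial datum $u_0$ means $u(0)=u_0$. Here $L^p_{\rm loc}(S,T;X)$ means $L^p(S,T;X)$ if $T<\infty$ and $L^p_{\rm loc}([S,\infty);X)$ if $T=\infty$. Under the hypotheses of the claim, a weak solution on $(0,\infty)$ exists and is unique. The $\omega$-limit set of $u$ is the set of all $\phi\in\mathcal X_{\sigma0}$ such that $u(t_n)\to\phi$ strongly in $\mathcal X_{\sigma0}$ for some sequence $t_n\to\infty$. *)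

theory Defs
  imports "HOL-Analysis.Analysis"
begin

text \<open>
  Conventions.  Elements of spaces of functions of \<open>x\<close> are represented by Borel functions on the whole
  space (every class of Lebesgue measurable functions has a Borel representative); equality of
  elements is equality almost everywhere.  Functions of time may be merely Lebesgue measurable.
\<close>

section \<open>Smooth bounded domains\<close>

primrec Ck_on :: "nat \<Rightarrow> ('a::real_normed_vector \<Rightarrow> real) \<Rightarrow> 'a set \<Rightarrow> bool" where
  "Ck_on 0 f U = continuous_on U f"
| "Ck_on (Suc k) f U =
     ((\<forall>x\<in>U. f differentiable at x) \<and> (\<forall>h. Ck_on k (\<lambda>x. frechet_derivative f (at x) h) U))"

text \<open>Intended for open \<open>U\<close> only.\<close>

definition smooth_fun_on :: "('a::real_normed_vector \<Rightarrow> real) \<Rightarrow> 'a set \<Rightarrow> bool" where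
  "smooth_fun_on f U \<longleftrightarrow> (\<forall>k. Ck_on k f U)"

definition smooth_boundary :: "(real ^ 'n) set \<Rightarrow> bool" where
  "smooth_boundary \<Omega> \<longleftrightarrow>
     (\<forall>p\<in>frontier \<Omega>. \<exists>U \<psi>. open U \<and> p \<in> U \<and> smooth_fun_on \<psi> U \<and>
        (\<forall>x\<in>U. frechet_derivative \<psi> (at x) \<noteq> (\<lambda>_. 0)) \<and>
        \<Omega> \<inter> U = {x\<in>U. \<psi> x < 0} \<and> frontier \<Omega> \<inter> U = {x\<in>U. \<psi> x = 0})"

definition smooth_bounded_domain :: "(real ^ 'n) set \<Rightarrow> bool" where
  "smooth_bounded_domain \<Omega> \<longleftrightarrow>
     open \<Omega> \<and> connected \<Omega> \<and> \<Omega> \<noteq> {} \<and> bounded \<Omega> \<and> smooth_boundary \<Omega>"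

section \<open>Fractional Sobolev spaces\<close>

text \<open>
  The constant for which the singular integral operator of order \<open>a\<close> has Fourier symbol
  \<open>|\<xi>| powr (2 * a)\<close>; here \<open>Gamma (1 - a) / a = |Gamma (- a)|\<close>.
\<close>

definition frac_const :: "nat \<Rightarrow> real \<Rightarrow> real" where
  "frac_const N a = 4 powr a * a * Gamma (real N / 2 + a) / (pi powr (real N / 2) * Gamma (1 - a))"

definition frac_kernel :: "real \<Rightarrow> real ^ 'n \<Rightarrow> real ^ 'n \<Rightarrow> real" where
  "frac_kernel a x y = 1 / norm (x - y) powr (real CARD('n) + 2 * a)"

definition H_space :: "real \<Rightarrow> (real ^ 'n \<Rightarrow> real) set" where
  "H_space a = {v. v \<in> borel_measurable lborel \<and> integrable lborel (\<lambda>x. (v x)\<^sup>2) \<and>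
     integrable (lborel \<Otimes>\<^sub>M lborel) (\<lambda>(x, y). (v x - v y)\<^sup>2 * frac_kernel a x y)}"

definition X_space :: "real \<Rightarrow> (real ^ 'n) set \<Rightarrow> (real ^ 'n \<Rightarrow> real) set" where
  "X_space a \<Omega> = {v \<in> H_space a. AE x in lborel. x \<notin> \<Omega> \<longrightarrow> v x = 0}"

text \<open>\<open>frac_form a u v\<close> is the pairing of \<open>\<AA>\<^sub>a u\<close> with \<open>v\<close>.\<close>

definition frac_form :: "real \<Rightarrow> (real ^ 'n \<Rightarrow> real) \<Rightarrow> (real ^ 'n \<Rightarrow> real) \<Rightarrow> real" where
  "frac_form a u v = frac_const CARD('n) a / 2 *
     (\<integral>(x, y). (u x - u y) * (v x - v y) * frac_kernel a x y \<partial>(lborel \<Otimes>\<^sub>M lborel))"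

definition X_norm :: "real \<Rightarrow> (real ^ 'n \<Rightarrow> real) \<Rightarrow> real" where
  "X_norm a v = sqrt (frac_const CARD('n) a / 2 *
     (\<integral>(x, y). (v x - v y)\<^sup>2 * frac_kernel a x y \<partial>(lborel \<Otimes>\<^sub>M lborel)))"

definition L2_space :: "(real ^ 'n) set \<Rightarrow> (real ^ 'n \<Rightarrow> real) set" where
  "L2_space \<Omega> = {f. set_borel_measurable lborel \<Omega> f \<and> set_integrable lborel \<Omega> (\<lambda>x. (f x)\<^sup>2)}"

definition L2_norm_on :: "(real ^ 'n) set \<Rightarrow> (real ^ 'n \<Rightarrow> real) \<Rightarrow> real" where
  "L2_norm_on \<Omega> f = sqrt (LINT x:\<Omega>|lborel. (f x)\<^sup>2)"

text \<open>
  The dual space.  A bounded linear functional automatically respects equality almost everywhere,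
  since \<open>X_norm\<close> vanishes on differences of almost everywhere equal functions.  Functionals matter
  only through their values on \<open>X_space a \<Omega>\<close>.
\<close>

definition X_dual :: "real \<Rightarrow> (real ^ 'n) set \<Rightarrow> ((real ^ 'n \<Rightarrow> real) \<Rightarrow> real) set" where
  "X_dual a \<Omega> = {F.
     (\<forall>u\<in>X_space a \<Omega>. \<forall>v\<in>X_space a \<Omega>. F (\<lambda>x. u x + v x) = F u + F v) \<and>
     (\<forall>c. \<forall>v\<in>X_space a \<Omega>. F (\<lambda>x. c * v x) = c * F v) \<and>
     (\<exists>K. \<forall>v\<in>X_space a \<Omega>. \<bar>F v\<bar> \<le> K * X_norm a v)}"

definition X_dual_norm :: "real \<Rightarrow> (real ^ 'n) set \<Rightarrow> ((real ^ 'n \<Rightarrow> real) \<Rightarrow> real) \<Rightarrow> real" where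
  "X_dual_norm a \<Omega> F = (SUP v\<in>{v \<in> X_space a \<Omega>. X_norm a v \<le> 1}. \<bar>F v\<bar>)"

text \<open>The embedding of \<open>L\<^sup>2(\<Omega>)\<close> into the dual spaces.\<close>

definition L2_functional :: "(real ^ 'n) set \<Rightarrow> (real ^ 'n \<Rightarrow> real) \<Rightarrow> (real ^ 'n \<Rightarrow> real) \<Rightarrow> real" where
  "L2_functional \<Omega> f v = (LINT x:\<Omega>|lborel. f x * v x)"

definition lambda1 :: "real \<Rightarrow> (real ^ 'n) set \<Rightarrow> real" where
  "lambda1 \<sigma> \<Omega> = (INF v\<in>{v \<in> X_space \<sigma> \<Omega>. \<not> (AE x in lborel. v x = 0)}.
     (X_norm \<sigma> v)\<^sup>2 / (L2_norm_on \<Omega> v)\<^sup>2)"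

section \<open>Vector-valued functions of time\<close>

definition time_interval :: "real \<Rightarrow> ereal \<Rightarrow> real set" where
  "time_interval S T = {t. S < t \<and> ereal t < T}"

text \<open>
  Bochner spaces with values in a set \<open>V\<close> of vectors with (semi)norm \<open>nrm\<close>; differences are
  pointwise when the vectors are functions or functionals.
\<close>

definition strongly_measurable_on ::
    "real set \<Rightarrow> 'v::minus set \<Rightarrow> ('v \<Rightarrow> real) \<Rightarrow> (real \<Rightarrow> 'v) \<Rightarrow> bool" where
  "strongly_measurable_on I V nrm f \<longleftrightarrow>
     (\<exists>s. (\<forall>n. simple_function (lebesgue_on I) (s n) \<and> s n ` I \<subseteq> V) \<and>
        (AE t in lebesgue_on I. (\<lambda>n. nrm (s n t - f t)) \<longlonglongrightarrow> 0))"

definition L2_time ::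
    "real set \<Rightarrow> 'v::minus set \<Rightarrow> ('v \<Rightarrow> real) \<Rightarrow> (real \<Rightarrow> 'v) \<Rightarrow> bool" where
  "L2_time I V nrm f \<longleftrightarrow>
     (AE t in lebesgue_on I. f t \<in> V) \<and> strongly_measurable_on I V nrm f \<and>
     integrable (lebesgue_on I) (\<lambda>t. (nrm (f t))\<^sup>2)"

definition L2_loc_time ::
    "real \<Rightarrow> ereal \<Rightarrow> 'v::minus set \<Rightarrow> ('v \<Rightarrow> real) \<Rightarrow> (real \<Rightarrow> 'v) \<Rightarrow> bool" where
  "L2_loc_time S T V nrm f \<longleftrightarrow>
     (if T = \<infinity> then \<forall>b>S. L2_time {S<..<b} V nrm f else L2_time (time_interval S T) V nrm f)"

definition weakly_continuous_X ::
    "real \<Rightarrow> (real ^ 'n) set \<Rightarrow> real \<Rightarrow> ereal \<Rightarrow> (real \<Rightarrow> real ^ 'n \<Rightarrow> real) \<Rightarrow> bool" where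
  "weakly_continuous_X a \<Omega> S T u \<longleftrightarrow>
     (\<forall>t. S \<le> t \<and> ereal t < T \<longrightarrow> u t \<in> X_space a \<Omega>) \<and>
     (\<forall>F\<in>X_dual a \<Omega>. continuous_on {t. S \<le> t \<and> ereal t < T} (\<lambda>t. F (u t)))"

definition test_function :: "real \<Rightarrow> ereal \<Rightarrow> (real \<Rightarrow> real) \<Rightarrow> bool" where
  "test_function S T \<eta> \<longleftrightarrow> smooth_fun_on \<eta> UNIV \<and>
     (\<exists>a b. S < a \<and> a \<le> b \<and> ereal b < T \<and> (\<forall>t. t \<notin> {a..b} \<longrightarrow> \<eta> t = 0))"

text \<open>
  \<open>U'\<close> is the derivative of \<open>U\<close> in the sense of distributions with values in the dual of
  \<open>X_space a \<Omega>\<close>; the identity of the two Bochner integrals is evaluated on each vector.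
\<close>

definition distributional_derivative ::
    "real \<Rightarrow> (real ^ 'n) set \<Rightarrow> real \<Rightarrow> ereal \<Rightarrow> (real \<Rightarrow> (real ^ 'n \<Rightarrow> real) \<Rightarrow> real) \<Rightarrow>
     (real \<Rightarrow> (real ^ 'n \<Rightarrow> real) \<Rightarrow> real) \<Rightarrow> bool" where
  "distributional_derivative a \<Omega> S T U U' \<longleftrightarrow>
     (\<forall>\<eta>. test_function S T \<eta> \<longrightarrow> (\<forall>v\<in>X_space a \<Omega>.
        (\<integral>t. \<eta> t * U' t v \<partial>lebesgue_on (time_interval S T)) =
        - (\<integral>t. deriv \<eta> t * U t v \<partial>lebesgue_on (time_interval S T))))"

section \<open>The fractional Cahn-Hilliard system\<close>

definition weak_solution ::
    "(real ^ 'n) set \<Rightarrow> real \<Rightarrow> real \<Rightarrow> (real \<Rightarrow> real) \<Rightarrow> real \<Rightarrow> ereal \<Rightarrow>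
     (real \<Rightarrow> real ^ 'n \<Rightarrow> real) \<Rightarrow> (real \<Rightarrow> real ^ 'n \<Rightarrow> real) \<Rightarrow> bool" where
  "weak_solution \<Omega> s \<sigma> g S T u w \<longleftrightarrow>
     weakly_continuous_X \<sigma> \<Omega> S T u \<and>
     L2_time (time_interval S T) (X_space s \<Omega>) (X_norm s) w \<and>
     L2_loc_time S T (L2_space \<Omega>) (L2_norm_on \<Omega>) (\<lambda>t x. g (u t x)) \<and>
     (\<exists>u'. L2_time (time_interval S T) (X_dual s \<Omega>) (X_dual_norm s \<Omega>) u' \<and>
        distributional_derivative s \<Omega> S T (\<lambda>t. L2_functional \<Omega> (u t)) u' \<and>
        (AE t in lebesgue_on (time_interval S T). \<forall>v\<in>X_space s \<Omega>.
           u' t v + frac_form s (w t) v = 0)) \<and>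
     (AE t in lebesgue_on (time_interval S T). \<forall>v\<in>X_space \<sigma> \<Omega>.
        L2_functional \<Omega> (w t) v =
        frac_form \<sigma> (u t) v + L2_functional \<Omega> (\<lambda>x. g (u t x)) v)"

text \<open>
  The energy takes values in \<open>(-\<infinity>, \<infinity>]\<close> on its domain: only the negative part of \<open>G \<circ> v\<close> is required
  to be integrable.
\<close>

definition energy_domain :: "real \<Rightarrow> (real ^ 'n) set \<Rightarrow> (real \<Rightarrow> real) \<Rightarrow> (real ^ 'n \<Rightarrow> real) set" where
  "energy_domain \<sigma> \<Omega> G =
     {v \<in> X_space \<sigma> \<Omega>. set_integrable lborel \<Omega> (\<lambda>x. max 0 (- G (v x)))}"

definition energy :: "real \<Rightarrow> (real ^ 'n) set \<Rightarrow> (real \<Rightarrow> real) \<Rightarrow> (real ^ 'n \<Rightarrow> real) \<Rightarrow> ereal" where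
  "energy \<sigma> \<Omega> G v = ereal ((X_norm \<sigma> v)\<^sup>2 / 2) +
     (enn2ereal (\<integral>\<^sup>+x\<in>\<Omega>. ennreal (G (v x)) \<partial>lborel) -
      enn2ereal (\<integral>\<^sup>+x\<in>\<Omega>. ennreal (- G (v x)) \<partial>lborel))"

definition stationary_solution ::
    "real \<Rightarrow> (real ^ 'n) set \<Rightarrow> (real \<Rightarrow> real) \<Rightarrow> (real ^ 'n \<Rightarrow> real) \<Rightarrow> bool" where
  "stationary_solution \<sigma> \<Omega> g \<phi> \<longleftrightarrow>
     \<phi> \<in> X_space \<sigma> \<Omega> \<and> (\<lambda>x. g (\<phi> x)) \<in> L2_space \<Omega> \<and>
     (\<forall>v\<in>X_space \<sigma> \<Omega>. frac_form \<sigma> \<phi> v + L2_functional \<Omega> (\<lambda>x. g (\<phi> x)) v = 0)"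

definition omega_limit ::
    "real \<Rightarrow> (real ^ 'n) set \<Rightarrow> (real \<Rightarrow> real ^ 'n \<Rightarrow> real) \<Rightarrow> (real ^ 'n \<Rightarrow> real) set" where
  "omega_limit \<sigma> \<Omega> u = {\<phi> \<in> X_space \<sigma> \<Omega>.
     \<exists>t::nat \<Rightarrow> real. filterlim t at_top sequentially \<and> (\<lambda>n. X_norm \<sigma> (u (t n) - \<phi>)) \<longlonglongrightarrow> 0}"

end

theory Submission
  imports Defs "HOL-Library.Diagonal_Subsequence"
begin

text \<open>
  For almost every time \<open>u t\<close> solves the elliptic equation \<open>\<AA>\<^sub>\<sigma> u + g(u) = w\<close>, and \<open>\<parallel>w\<parallel>\<close> is square
  integrable over \<open>(0, \<infinity>)\<close>.  Solutions of the elliptic equation whose right-hand sides tend to \<open>0\<close> are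
  bounded by coercivity, hence precompact in \<open>L\<^sup>2\<close>, and the semimonotonicity of \<open>g\<close> makes them precompact
  in the energy space, with stationary limits.  To pass from good times \<open>\<tau>\<close> to an arbitrary time \<open>t\<close>, the
  energy is compared at dyadic times accumulating at \<open>t\<close>: it is convex up to a multiple of the \<open>L\<^sup>2\<close> norm,
  which an Ehrling inequality bounds by a small multiple of the energy norm and finitely many functionals
  \<open>(u, \<psi>)\<close> with \<open>\<psi>\<close> in the space of \<open>w\<close>, whose time derivatives are controlled by \<open>\<parallel>w\<parallel>\<close>.  Hence \<open>u t - u \<tau>\<close>
  tends to \<open>0\<close> in the energy space when \<open>t\<close> tends to infinity and \<open>\<tau>\<close> is a suitable time in \<open>[t - 1, t]\<close>.
\<close>

section \<open>Square integrable functions\<close>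

text \<open>No chain rule for the energy along the trajectory is used: \<open>u\<close> is only
  weakly continuous, and at an exceptional time neither the equation nor finiteness of the energy is
  known beforehand. The substitute is one inequality, valid at any time \<open>a\<close> at which
  the elliptic equation holds: the energy at \<open>b\<close> minus the energy at \<open>a\<close>
  is at least the pairing of \<open>w a\<close> with \<open>u b - u a\<close>, plus half the squared
  norm of \<open>u b - u a\<close>, minus an L2 defect. It is used in both directions of time. With
  \<open>a\<close> later than \<open>b\<close> it bounds the growth of the energy from one good time
  to the next, and lower semicontinuity carries this bound to the limit time \<open>t\<close>. With
  \<open>a\<close> earlier than \<open>b\<close> its quadratic term turns the absence of growth into
  closeness in the energy norm. The obstacle is that \<open>W\<close>, the norm of \<open>w\<close>,
  is only square integrable in time: a good time within a short window may have a large
  \<open>W\<close>, so the errors must be balanced against the increments of \<open>u\<close> over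
  windows of the same size.\<close>

definition sq_integrable :: "'a measure \<Rightarrow> ('a \<Rightarrow> real) \<Rightarrow> bool" where
  "sq_integrable M f \<longleftrightarrow> f \<in> borel_measurable M \<and> integrable M (\<lambda>x. (f x)\<^sup>2)"

lemma sq_integrable_measurable [measurable_dest]: "sq_integrable M f \<Longrightarrow> f \<in> borel_measurable M"
  by (simp add: sq_integrable_def)

lemma sq_integrable_mult_integrable:
  assumes "sq_integrable M f" "sq_integrable M h"
  shows "integrable M (\<lambda>x. f x * h x)"
proof (rule Bochner_Integration.integrable_bound)
  show "integrable M (\<lambda>x. (f x)\<^sup>2 + (h x)\<^sup>2)"
    using assms by (simp add: sq_integrable_def)
  show "(\<lambda>x. f x * h x) \<in> borel_measurable M"
    using assms by (auto simp: sq_integrable_def)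
  have "\<bar>a * b\<bar> \<le> a\<^sup>2 + b\<^sup>2" for a b :: real
  proof -
    have "2 * \<bar>a * b\<bar> \<le> a\<^sup>2 + b\<^sup>2"
      using sum_squares_bound[of "\<bar>a\<bar>" "\<bar>b\<bar>"] by (simp add: abs_mult)
    then show ?thesis by simp
  qed
  then show "AE x in M. norm (f x * h x) \<le> norm ((f x)\<^sup>2 + (h x)\<^sup>2)"
    by (simp add: abs_of_nonneg)
qed

lemma sq_integrable_cmult: "sq_integrable M f \<Longrightarrow> sq_integrable M (\<lambda>x. c * f x)"
  by (auto simp: sq_integrable_def power_mult_distrib)

lemma sq_integrable_add:
  assumes "sq_integrable M f" "sq_integrable M h"
  shows "sq_integrable M (\<lambda>x. f x + h x)"
  using assms sq_integrable_mult_integrable[OF assms]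
  by (auto simp: sq_integrable_def power2_sum mult.assoc)

lemma sq_integrable_diff:
  assumes "sq_integrable M f" "sq_integrable M h"
  shows "sq_integrable M (\<lambda>x. f x - h x)"
  using sq_integrable_add[OF assms(1) sq_integrable_cmult[OF assms(2), of "-1"]] by simp

lemma sq_integrable_bound:
  assumes "sq_integrable M f" "h \<in> borel_measurable M" "AE x in M. \<bar>h x\<bar> \<le> \<bar>f x\<bar>"
  shows "sq_integrable M h"
  unfolding sq_integrable_def
proof
  show "integrable M (\<lambda>x. (h x)\<^sup>2)"
  proof (rule Bochner_Integration.integrable_bound)
    show "integrable M (\<lambda>x. (f x)\<^sup>2)" using assms by (simp add: sq_integrable_def)
    show "(\<lambda>x. (h x)\<^sup>2) \<in> borel_measurable M" using assms(2) by simp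
    show "AE x in M. norm ((h x)\<^sup>2) \<le> norm ((f x)\<^sup>2)"
      using assms(3) by (auto elim!: eventually_mono simp: abs_le_square_iff)
  qed
qed (fact assms(2))

section \<open>The Cauchy-Schwarz inequality\<close>

lemma quadratic_nonneg_imp_discriminant:
  fixes A B C :: real
  assumes "\<And>c. 0 \<le> A + 2 * c * B + c\<^sup>2 * C" "0 \<le> A" "0 \<le> C"
  shows "B\<^sup>2 \<le> A * C"
proof (cases "C = 0")
  case True
  have "B = 0"
  proof (rule ccontr)
    assume "B \<noteq> 0"
    \<comment> \<open>With \<open>C = 0\<close> the expression is affine in \<open>c\<close>, and
      this \<open>c\<close> makes it negative.\<close>
    then have "A + 2 * (- (A + 1) / (2 * B)) * B = -1" by (simp add: field_simps)
    then show False using assms(1)[of "- (A + 1) / (2 * B)"] True by simp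
  qed
  then show ?thesis using True by simp
next
  case False
  then have "C > 0" using assms by simp
  \<comment> \<open>The minimiser \<open>c = - B / C\<close> is inserted.\<close>
  have "A + 2 * (- B / C) * B + (- B / C)\<^sup>2 * C = A - B\<^sup>2 / C"
    using False by (simp add: power2_eq_square field_simps)
  then have "B\<^sup>2 / C \<le> A" using assms(1)[of "- B / C"] by simp
  then show ?thesis using \<open>C > 0\<close> by (simp add: field_simps)
qed

lemma sq_integrable_Cauchy_Schwarz:
  assumes "sq_integrable M f" "sq_integrable M h"
  shows "(\<integral>x. f x * h x \<partial>M)\<^sup>2 \<le> (\<integral>x. (f x)\<^sup>2 \<partial>M) * (\<integral>x. (h x)\<^sup>2 \<partial>M)"
proof (rule quadratic_nonneg_imp_discriminant)
  fix c :: real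
  note i = sq_integrable_mult_integrable[OF assms]
  have "0 \<le> (\<integral>x. (f x + c * h x)\<^sup>2 \<partial>M)" by simp
  also have "\<dots> = (\<integral>x. (f x)\<^sup>2 + 2 * c * (f x * h x) + c\<^sup>2 * (h x)\<^sup>2 \<partial>M)"
    by (rule Bochner_Integration.integral_cong) (auto simp: power2_eq_square algebra_simps)
  also have "\<dots> = (\<integral>x. (f x)\<^sup>2 \<partial>M) + 2 * c * (\<integral>x. f x * h x \<partial>M) + c\<^sup>2 * (\<integral>x. (h x)\<^sup>2 \<partial>M)"
    using assms i by (simp add: sq_integrable_def)
  finally show "0 \<le> (\<integral>x. (f x)\<^sup>2 \<partial>M) + 2 * c * (\<integral>x. f x * h x \<partial>M) + c\<^sup>2 * (\<integral>x. (h x)\<^sup>2 \<partial>M)" .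
qed simp_all

lemma sq_integrable_Cauchy_Schwarz_abs:
  assumes "sq_integrable M f" "sq_integrable M h"
  shows "\<bar>\<integral>x. f x * h x \<partial>M\<bar> \<le> sqrt (\<integral>x. (f x)\<^sup>2 \<partial>M) * sqrt (\<integral>x. (h x)\<^sup>2 \<partial>M)"
  using real_sqrt_le_mono[OF sq_integrable_Cauchy_Schwarz[OF assms]]
  by (simp add: real_sqrt_mult)

lemma integral_square_add_le:
  assumes "sq_integrable M f" "sq_integrable M h"
  shows "(\<integral>x. (f x + h x)\<^sup>2 \<partial>M) \<le> 2 * (\<integral>x. (f x)\<^sup>2 \<partial>M) + 2 * (\<integral>x. (h x)\<^sup>2 \<partial>M)"
proof -
  have "(\<integral>x. (f x + h x)\<^sup>2 \<partial>M) \<le> (\<integral>x. 2 * (f x)\<^sup>2 + 2 * (h x)\<^sup>2 \<partial>M)"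
  proof (rule integral_mono)
    show "integrable M (\<lambda>x. (f x + h x)\<^sup>2)"
      using sq_integrable_add[OF assms] by (simp add: sq_integrable_def)
    show "integrable M (\<lambda>x. 2 * (f x)\<^sup>2 + 2 * (h x)\<^sup>2)"
      using assms by (simp add: sq_integrable_def)
    fix x
    show "(f x + h x)\<^sup>2 \<le> 2 * (f x)\<^sup>2 + 2 * (h x)\<^sup>2"
      using zero_le_power2[of "f x - h x"] by (simp add: power2_eq_square algebra_simps)
  qed
  then show ?thesis using assms by (simp add: sq_integrable_def)
qed

section \<open>Fatou's lemma and weak limits\<close>

lemma integrable_Fatou:
  fixes f :: "nat \<Rightarrow> 'a \<Rightarrow> real"
  assumes "\<And>n. integrable M (f n)" "\<And>n. AE x in M. 0 \<le> f n x" "h \<in> borel_measurable M"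
    and "AE x in M. (\<lambda>n. f n x) \<longlonglongrightarrow> h x" "\<And>n. (\<integral>x. f n x \<partial>M) \<le> B"
  shows "integrable M h" "(\<integral>x. h x \<partial>M) \<le> B"
proof -
  \<comment> \<open>\<open>ennreal\<close> sends negative numbers to 0, so the final comparison in
    the reals needs \<open>0 \<le> B\<close>.\<close>
  have B: "0 \<le> B" using integral_nonneg_AE[OF assms(2)] assms(5) order_trans by blast
  have [measurable]: "f n \<in> borel_measurable M" for n using assms(1) by auto
  have nn: "AE x in M. 0 \<le> h x"
  proof -
    have "AE x in M. \<forall>n. 0 \<le> f n x" using assms(2) by (simp add: AE_all_countable)
    with assms(4) show ?thesis by eventually_elim (blast intro: LIMSEQ_le_const)
  qed
  have "(\<integral>\<^sup>+x. ennreal (h x) \<partial>M) = (\<integral>\<^sup>+x. liminf (\<lambda>n. ennreal (f n x)) \<partial>M)"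
  proof (rule nn_integral_cong_AE)
    show "AE x in M. ennreal (h x) = liminf (\<lambda>n. ennreal (f n x))"
      using assms(4)
      by eventually_elim (metis lim_imp_Liminf tendsto_ennrealI trivial_limit_sequentially)
  qed
  also have "\<dots> \<le> liminf (\<lambda>n. \<integral>\<^sup>+x. ennreal (f n x) \<partial>M)"
    by (rule nn_integral_liminf) simp
  also have "\<dots> = liminf (\<lambda>n. ennreal (\<integral>x. f n x \<partial>M))"
    using assms(1,2) by (simp add: nn_integral_eq_integral)
  also have "\<dots> \<le> liminf (\<lambda>n::nat. ennreal B)"
    by (rule Liminf_mono) (simp add: assms(5) ennreal_leI)
  finally have *: "(\<integral>\<^sup>+x. ennreal (h x) \<partial>M) \<le> ennreal B"
    by (simp add: Liminf_const)
  have "(\<integral>\<^sup>+x. ennreal (norm (h x)) \<partial>M) = (\<integral>\<^sup>+x. ennreal (h x) \<partial>M)"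
    using nn by (intro nn_integral_cong_AE) auto
  also have "\<dots> < \<infinity>" using * by (simp add: le_less_trans)
  finally show i: "integrable M h" using assms(3) by (simp add: integrable_iff_bounded)
  show "(\<integral>x. h x \<partial>M) \<le> B"
    using * nn_integral_eq_integral[OF i nn] B by simp
qed

lemma sq_integrable_Fatou:
  fixes f :: "nat \<Rightarrow> 'a \<Rightarrow> real"
  assumes "\<And>n. sq_integrable M (f n)" "h \<in> borel_measurable M"
    and "AE x in M. (\<lambda>n. f n x) \<longlonglongrightarrow> h x" "\<And>n. (\<integral>x. (f n x)\<^sup>2 \<partial>M) \<le> B"
  shows "sq_integrable M h" "(\<integral>x. (h x)\<^sup>2 \<partial>M) \<le> B"
proof -
  have a: "AE x in M. (\<lambda>n. (f n x)\<^sup>2) \<longlonglongrightarrow> (h x)\<^sup>2"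
    using assms(3) by eventually_elim (rule tendsto_power)
  have b: "integrable M (\<lambda>x. (f n x)\<^sup>2)" for n using assms(1) by (simp add: sq_integrable_def)
  note * = integrable_Fatou[OF b _ _ a assms(4)]
  show "sq_integrable M h" "(\<integral>x. (h x)\<^sup>2 \<partial>M) \<le> B"
    using * assms(2) by (auto simp: sq_integrable_def)
qed

text \<open>Almost everywhere convergence together with a bound in L2 gives weak convergence. The
  product of the difference \<open>d n\<close> with \<open>v\<close> is compared with
  \<open>K * v^2\<close>: the truncated part converges by domination, and the rest is at most
  \<open>(d n)^2 / K\<close>, which is small uniformly in \<open>n\<close>.\<close>

lemma sq_integrable_weak_limit:
  fixes f :: "nat \<Rightarrow> 'a \<Rightarrow> real"
  assumes f: "\<And>n. sq_integrable M (f n)" and h: "h \<in> borel_measurable M"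
    and lim: "AE x in M. (\<lambda>n. f n x) \<longlonglongrightarrow> h x" and B: "\<And>n. (\<integral>x. (f n x)\<^sup>2 \<partial>M) \<le> B"
    and v: "sq_integrable M v"
  shows "(\<lambda>n. \<integral>x. f n x * v x \<partial>M) \<longlonglongrightarrow> (\<integral>x. h x * v x \<partial>M)"
proof -
  note hi = sq_integrable_Fatou[OF f h lim B]
  define d where "d n x = f n x - h x" for n x
  have d: "sq_integrable M (d n)" for n
    unfolding d_def by (rule sq_integrable_diff[OF f hi(1)])
  have dB: "(\<integral>x. (d n x)\<^sup>2 \<partial>M) \<le> 4 * B" for n
  proof -
    have "(\<integral>x. (d n x)\<^sup>2 \<partial>M) = (\<integral>x. (f n x + (-1) * h x)\<^sup>2 \<partial>M)" by (simp add: d_def)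
    also have "\<dots> \<le> 2 * (\<integral>x. (f n x)\<^sup>2 \<partial>M) + 2 * (\<integral>x. ((-1) * h x)\<^sup>2 \<partial>M)"
      by (rule integral_square_add_le[OF f sq_integrable_cmult[OF hi(1)]])
    finally show ?thesis using B[of n] hi(2) by simp
  qed
  have "0 \<le> (\<integral>x. (f 0 x)\<^sup>2 \<partial>M)" by simp
  then have B0: "0 \<le> B" using B[of 0] by linarith
  note [measurable] = d[THEN sq_integrable_measurable] v[THEN sq_integrable_measurable]
  have iv: "integrable M (\<lambda>x. (v x)\<^sup>2)" and id: "integrable M (\<lambda>x. (d n x)\<^sup>2)" for n
    using v d by (auto simp: sq_integrable_def)
  have "(\<lambda>n. \<integral>x. d n x * v x \<partial>M) \<longlonglongrightarrow> 0"
  proof (rule LIMSEQ_I)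
    fix e :: real assume e: "e > 0"
    \<comment> \<open>Makes the uniform remainder \<open>4 * B / K\<close> smaller than
      \<open>e / 2\<close>; the summand 1 keeps \<open>K\<close> positive when
      \<open>B = 0\<close>.\<close>
    define K where "K = (8 * B + 1) / e"
    have K: "K > 0" using e B0 by (simp add: K_def)
    have KB: "4 * B / K < e / 2" using e B0 by (simp add: K_def field_simps)
    have "(\<lambda>n. \<integral>x. min \<bar>d n x * v x\<bar> (K * (v x)\<^sup>2) \<partial>M) \<longlonglongrightarrow> (\<integral>x. 0 \<partial>M)"
    proof (rule integral_dominated_convergence)
      show "integrable M (\<lambda>x. K * (v x)\<^sup>2)" using iv by simp
      show "AE x in M. (\<lambda>n. min \<bar>d n x * v x\<bar> (K * (v x)\<^sup>2)) \<longlonglongrightarrow> 0"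
        using lim
      proof eventually_elim
        case (elim x)
        have "(\<lambda>n. min \<bar>(f n x - h x) * v x\<bar> (K * (v x)\<^sup>2)) \<longlonglongrightarrow> min \<bar>(h x - h x) * v x\<bar> (K * (v x)\<^sup>2)"
          by (intro tendsto_intros elim)
        then show ?case using K by (simp add: d_def)
      qed
      show "AE x in M. norm (min \<bar>d n x * v x\<bar> (K * (v x)\<^sup>2)) \<le> K * (v x)\<^sup>2" for n
        using K by auto
    qed auto
    then have "(\<lambda>n. \<integral>x. min \<bar>d n x * v x\<bar> (K * (v x)\<^sup>2) \<partial>M) \<longlonglongrightarrow> 0" by simp
    from LIMSEQ_D[OF this, of "e / 2"] e obtain N where
      N: "\<And>n. n \<ge> N \<Longrightarrow> \<bar>\<integral>x. min \<bar>d n x * v x\<bar> (K * (v x)\<^sup>2) \<partial>M\<bar> < e / 2" by auto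
    have mi: "integrable M (\<lambda>x. min \<bar>d n x * v x\<bar> (K * (v x)\<^sup>2))" for n
      using K by (intro Bochner_Integration.integrable_bound[OF integrable_mult_right[OF iv, of K]]) auto
    show "\<exists>no. \<forall>n\<ge>no. norm ((\<integral>x. d n x * v x \<partial>M) - 0) < e"
    proof (intro exI[of _ N] allI impI)
      fix n assume n: "N \<le> n"
      \<comment> \<open>Where the minimum truncates,
        \<open>K * \<bar>v x\<bar> \<le> \<bar>d n x\<bar>\<close>, so the factor \<open>v x\<close>
        can be traded for \<open>d n x / K\<close>.\<close>
      have pw: "\<bar>d n x * v x\<bar> \<le> min \<bar>d n x * v x\<bar> (K * (v x)\<^sup>2) + (d n x)\<^sup>2 / K" for x
      proof (cases "\<bar>d n x * v x\<bar> \<le> K * (v x)\<^sup>2")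
        case True then show ?thesis using K by simp
      next
        case False
        have v0: "v x \<noteq> 0" using False by auto
        have "K * \<bar>v x\<bar> * \<bar>v x\<bar> < \<bar>d n x\<bar> * \<bar>v x\<bar>"
          using False unfolding abs_mult power2_eq_square by (simp add: mult.assoc)
        then have "K * \<bar>v x\<bar> \<le> \<bar>d n x\<bar>" using v0 by simp
        then have "\<bar>d n x\<bar> * (K * \<bar>v x\<bar>) \<le> \<bar>d n x\<bar> * \<bar>d n x\<bar>" by (intro mult_left_mono) auto
        then have "K * \<bar>d n x * v x\<bar> \<le> (d n x)\<^sup>2"
          unfolding abs_mult power2_eq_square by (simp add: mult_ac)
        then have "\<bar>d n x * v x\<bar> \<le> (d n x)\<^sup>2 / K"
          using K by (simp add: field_simps)
        moreover have "0 \<le> K * (v x)\<^sup>2" using K by simp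
        ultimately show ?thesis by linarith
      qed
      have "\<bar>\<integral>x. d n x * v x \<partial>M\<bar> \<le> (\<integral>x. \<bar>d n x * v x\<bar> \<partial>M)" by (rule integral_abs_bound)
      also have "\<dots> \<le> (\<integral>x. min \<bar>d n x * v x\<bar> (K * (v x)\<^sup>2) + (d n x)\<^sup>2 / K \<partial>M)"
        using sq_integrable_mult_integrable[OF d v, of n] mi id
        by (intro integral_mono pw Bochner_Integration.integrable_add integrable_abs integrable_divide) auto
      also have "\<dots> = (\<integral>x. min \<bar>d n x * v x\<bar> (K * (v x)\<^sup>2) \<partial>M) + (\<integral>x. (d n x)\<^sup>2 \<partial>M) / K"
        using mi id by simp
      also have "\<dots> \<le> (\<integral>x. min \<bar>d n x * v x\<bar> (K * (v x)\<^sup>2) \<partial>M) + 4 * B / K"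
        using K dB[of n] by (intro add_left_mono divide_right_mono) auto
      also have "\<dots> < e" using N[OF n] KB by linarith
      finally show "norm ((\<integral>x. d n x * v x \<partial>M) - 0) < e" by simp
    qed
  qed
  then have "(\<lambda>n. (\<integral>x. d n x * v x \<partial>M) + (\<integral>x. h x * v x \<partial>M)) \<longlonglongrightarrow> 0 + (\<integral>x. h x * v x \<partial>M)"
    by (intro tendsto_add tendsto_const)
  moreover have "(\<integral>x. d n x * v x \<partial>M) + (\<integral>x. h x * v x \<partial>M) = (\<integral>x. f n x * v x \<partial>M)" for n
    using sq_integrable_mult_integrable[OF d v] sq_integrable_mult_integrable[OF hi(1) v]
    by (subst Bochner_Integration.integral_add[symmetric]) (auto simp: d_def algebra_simps)
  ultimately show ?thesis by simp
qed

lemma sq_integrable_indicator: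
  assumes "A \<in> sets M" "emeasure M A < \<infinity>"
  shows "sq_integrable M (indicator A)"
  using assms by (auto simp: sq_integrable_def power2_eq_square indicator_inter_arith[symmetric]
      integrable_real_indicator)

text \<open>On a set of finite measure, Cauchy-Schwarz against the indicator turns an L2 Cauchy
  sequence into an L1 Cauchy sequence, and these have almost everywhere Cauchy subsequences.\<close>

lemma L2_Cauchy_AE_subseq:
  fixes f :: "nat \<Rightarrow> 'a \<Rightarrow> real"
  assumes A: "A \<in> sets M" "emeasure M A < \<infinity>"
    and f: "\<And>n. sq_integrable M (f n)" and z: "\<And>n. AE x in M. x \<notin> A \<longrightarrow> f n x = 0"
    and C: "\<And>e. e > 0 \<Longrightarrow> \<exists>N. \<forall>i\<ge>N. \<forall>j\<ge>N. (\<integral>x. (f i x - f j x)\<^sup>2 \<partial>M) < e"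
  obtains r where "strict_mono r" "AE x in M. Cauchy (\<lambda>i. f (r i) x)"
proof -
  note I = sq_integrable_indicator[OF A]
  have eq: "AE x in M. f n x = f n x * indicator A x" for n
    using z[of n] by eventually_elim (auto simp: indicator_def)
  note fm = f[THEN sq_integrable_measurable]
  note IA = I[THEN sq_integrable_measurable]
  have int: "integrable M (f n)" for n
    using sq_integrable_mult_integrable[OF f I, of n] eq[of n] fm IA
    by (subst integrable_cong_AE[of _ _ "\<lambda>x. f n x * indicator A x"]) auto
  define m where "m = measure M A"
  have "\<exists>N. \<forall>i\<ge>N. \<forall>j\<ge>N. (\<integral>x. norm (f i x - f j x) \<partial>M) < e" if e: "e > 0" for e
  proof -
    \<comment> \<open>\<open>m + 1\<close> instead of \<open>m\<close> covers a null set
      \<open>A\<close> and makes the estimate below strict.\<close>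
    have "e\<^sup>2 / (m + 1) > 0" using e by (simp add: m_def add_nonneg_pos)
    from C[OF this] obtain N where
      N: "\<And>i j. i \<ge> N \<Longrightarrow> j \<ge> N \<Longrightarrow> (\<integral>x. (f i x - f j x)\<^sup>2 \<partial>M) < e\<^sup>2 / (m + 1)" by auto
    have "(\<integral>x. norm (f i x - f j x) \<partial>M) < e" if ij: "i \<ge> N" "j \<ge> N" for i j
    proof -
      have d: "sq_integrable M (\<lambda>x. \<bar>f i x - f j x\<bar>)"
        using sq_integrable_diff[OF f f, of i j] by (auto simp: sq_integrable_def)
      have "(\<integral>x. norm (f i x - f j x) \<partial>M) = (\<integral>x. \<bar>f i x - f j x\<bar> * indicator A x \<partial>M)"
      proof (rule integral_cong_AE)
        show "AE x in M. norm (f i x - f j x) = \<bar>f i x - f j x\<bar> * indicator A x"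
          using z[of i] z[of j] by eventually_elim (auto simp: indicator_def)
      qed (use fm IA in auto)
      then have "(\<integral>x. norm (f i x - f j x) \<partial>M)\<^sup>2
          \<le> (\<integral>x. \<bar>f i x - f j x\<bar>\<^sup>2 \<partial>M) * (\<integral>x. (indicator A x)\<^sup>2 \<partial>M)"
        using sq_integrable_Cauchy_Schwarz[OF d I] by simp
      also have "(\<integral>x. (indicator A x)\<^sup>2 \<partial>M) = m"
        using A by (simp add: m_def power2_eq_square indicator_inter_arith[symmetric])
      also have "(\<integral>x. \<bar>f i x - f j x\<bar>\<^sup>2 \<partial>M) * m \<le> e\<^sup>2 / (m + 1) * m"
        using N[OF ij] by (intro mult_right_mono) (auto simp: m_def)
      also have "\<dots> < e\<^sup>2"
      proof -
        have "e\<^sup>2 * m < e\<^sup>2 * (m + 1)" using e by simp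
        moreover have "0 < m + 1" by (simp add: m_def add_nonneg_pos)
        ultimately show ?thesis by (simp add: pos_divide_less_eq)
      qed
      finally show ?thesis using e by (simp add: power_less_imp_less_base)
    qed
    then show ?thesis by blast
  qed
  from cauchy_L1_AE_cauchy_subseq[OF int this] that show ?thesis by metis
qed

section \<open>The fractional spaces\<close>

abbreviation lborel2 :: "((real ^ 'n) \<times> (real ^ 'n)) measure" where
  "lborel2 \<equiv> lborel \<Otimes>\<^sub>M lborel"

text \<open>The square root of the kernel turns the Gagliardo seminorm into an L2 norm over pairs of
  points and \<open>frac_form\<close> into an inner product, so that the facts on
  \<open>sq_integrable\<close> apply to both. On the diagonal the value is 0.\<close>

definition gagliardo :: "real \<Rightarrow> (real ^ 'n \<Rightarrow> real) \<Rightarrow> (real ^ 'n) \<times> (real ^ 'n) \<Rightarrow> real" where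
  "gagliardo a v = (\<lambda>(x, y). (v x - v y) * sqrt (frac_kernel a x y))"

lemma frac_kernel_nonneg: "0 \<le> frac_kernel a x y"
  by (simp add: frac_kernel_def)

lemma frac_const_pos: "0 < a \<Longrightarrow> a < 1 \<Longrightarrow> 0 < frac_const N a"
  unfolding frac_const_def
  by (intro divide_pos_pos mult_pos_pos Gamma_real_pos add_nonneg_pos) auto

lemma measurable_frac_kernel [measurable]:
  "(\<lambda>p. frac_kernel a (fst p) (snd p)) \<in> borel_measurable lborel2"
  unfolding frac_kernel_def by measurable

lemma measurable_gagliardo [measurable]:
  assumes [measurable]: "v \<in> borel_measurable lborel"
  shows "gagliardo a v \<in> borel_measurable lborel2"
  unfolding gagliardo_def case_prod_beta by measurable

lemma gagliardo_square: "(gagliardo a v p)\<^sup>2 = (case p of (x, y) \<Rightarrow> (v x - v y)\<^sup>2 * frac_kernel a x y)"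
  by (cases p) (simp add: gagliardo_def power_mult_distrib frac_kernel_nonneg)

lemma gagliardo_mult: "gagliardo a u p * gagliardo a v p =
    (case p of (x, y) \<Rightarrow> (u x - u y) * (v x - v y) * frac_kernel a x y)"
proof (cases p)
  case (Pair x y)
  have "sqrt (frac_kernel a x y) * sqrt (frac_kernel a x y) = frac_kernel a x y"
    by (simp add: frac_kernel_nonneg)
  then have "(u x - u y) * (v x - v y) * (sqrt (frac_kernel a x y) * sqrt (frac_kernel a x y)) =
    (u x - u y) * (v x - v y) * frac_kernel a x y" by metis
  then show ?thesis using Pair by (simp add: gagliardo_def mult_ac)
qed

lemma X_space_iff:
  "v \<in> X_space a \<Omega> \<longleftrightarrow> sq_integrable lborel v \<and> sq_integrable lborel2 (gagliardo a v) \<and>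
     (AE x in lborel. x \<notin> \<Omega> \<longrightarrow> v x = 0)"
  unfolding X_space_def H_space_def sq_integrable_def gagliardo_square
  using measurable_gagliardo[of v a] by auto

lemma frac_form_eq: "frac_form a (u :: real ^ 'n \<Rightarrow> real) v =
    frac_const CARD('n) a / 2 * (\<integral>p. gagliardo a u p * gagliardo a v p \<partial>lborel2)"
  by (simp add: frac_form_def gagliardo_mult)

lemma X_norm_eq: "X_norm a (v :: real ^ 'n \<Rightarrow> real) =
    sqrt (frac_const CARD('n) a / 2 * (\<integral>p. (gagliardo a v p)\<^sup>2 \<partial>lborel2))"
  by (simp add: X_norm_def gagliardo_square)

lemma gagliardo_add: "gagliardo a (\<lambda>x. u x + v x) = (\<lambda>p. gagliardo a u p + gagliardo a v p)"
  by (auto simp: gagliardo_def fun_eq_iff algebra_simps)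

lemma gagliardo_diff: "gagliardo a (\<lambda>x. u x - v x) = (\<lambda>p. gagliardo a u p - gagliardo a v p)"
  by (auto simp: gagliardo_def fun_eq_iff algebra_simps)

lemma gagliardo_cmult: "gagliardo a (\<lambda>x. c * v x) = (\<lambda>p. c * gagliardo a v p)"
  by (auto simp: gagliardo_def fun_eq_iff algebra_simps)

lemma X_space_zero: "(\<lambda>x. 0) \<in> X_space a \<Omega>"
  by (simp add: X_space_iff sq_integrable_def gagliardo_def case_prod_beta)

lemma X_space_add: "u \<in> X_space a \<Omega> \<Longrightarrow> v \<in> X_space a \<Omega> \<Longrightarrow> (\<lambda>x. u x + v x) \<in> X_space a \<Omega>"
  by (auto simp: X_space_iff gagliardo_add intro: sq_integrable_add)

lemma X_space_diff: "u \<in> X_space a \<Omega> \<Longrightarrow> v \<in> X_space a \<Omega> \<Longrightarrow> (\<lambda>x. u x - v x) \<in> X_space a \<Omega>"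
  by (auto simp: X_space_iff gagliardo_diff intro: sq_integrable_diff)

lemma X_space_cmult: "v \<in> X_space a \<Omega> \<Longrightarrow> (\<lambda>x. c * v x) \<in> X_space a \<Omega>"
  by (auto simp: X_space_iff gagliardo_cmult intro: sq_integrable_cmult)

lemma X_space_sq_integrable: "v \<in> X_space a \<Omega> \<Longrightarrow> sq_integrable lborel v"
  by (simp add: X_space_iff)

lemma X_space_gagliardo: "v \<in> X_space a \<Omega> \<Longrightarrow> sq_integrable lborel2 (gagliardo a v)"
  by (simp add: X_space_iff)

lemma X_space_AE_zero: "v \<in> X_space a \<Omega> \<Longrightarrow> AE x in lborel. x \<notin> \<Omega> \<longrightarrow> v x = 0"
  by (simp add: X_space_iff)

lemma X_space_measurable: "v \<in> X_space a \<Omega> \<Longrightarrow> v \<in> borel_measurable borel"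
  using sq_integrable_measurable[OF X_space_sq_integrable] by simp

lemma frac_form_commute: "frac_form a u v = frac_form a v u"
  unfolding frac_form_eq by (simp add: mult.commute)

lemma frac_form_add_left:
  assumes "u \<in> X_space a \<Omega>" "v \<in> X_space a \<Omega>" "z \<in> X_space a \<Omega>"
  shows "frac_form a (\<lambda>x. u x + v x) z = frac_form a u z + frac_form a v z"
  unfolding frac_form_eq gagliardo_add
  using sq_integrable_mult_integrable[OF X_space_gagliardo[OF assms(1)] X_space_gagliardo[OF assms(3)]]
    sq_integrable_mult_integrable[OF X_space_gagliardo[OF assms(2)] X_space_gagliardo[OF assms(3)]]
  by (simp add: distrib_right left_diff_distrib distrib_left right_diff_distrib)

lemma frac_form_diff_left:
  assumes "u \<in> X_space a \<Omega>" "v \<in> X_space a \<Omega>" "z \<in> X_space a \<Omega>"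
  shows "frac_form a (\<lambda>x. u x - v x) z = frac_form a u z - frac_form a v z"
  unfolding frac_form_eq gagliardo_diff
  using sq_integrable_mult_integrable[OF X_space_gagliardo[OF assms(1)] X_space_gagliardo[OF assms(3)]]
    sq_integrable_mult_integrable[OF X_space_gagliardo[OF assms(2)] X_space_gagliardo[OF assms(3)]]
  by (simp add: distrib_right left_diff_distrib distrib_left right_diff_distrib)

text \<open>Difference quotients involve two points: an exceptional null set of points gives only a
  null set of pairs.\<close>

lemma AE_lborel_pair:
  assumes "AE x in lborel. P (x :: real ^ 'n)"
  shows "AE p in lborel2. P (fst p) \<and> P (snd p)"
proof -
  obtain N where N: "N \<in> null_sets lborel" "{x. \<not> P x} \<subseteq> N"
    using assms by (auto simp: eventually_ae_filter)
  have [measurable]: "N \<in> sets borel" using N(1) by auto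
  have ae: "AE x in lborel. x \<notin> N" by (rule AE_not_in[OF N(1)])
  have "AE p in lborel2. fst p \<notin> N \<and> snd p \<notin> N"
  proof (rule lborel_pair.AE_pair_measure)
    show "{p \<in> space lborel2. fst p \<notin> N \<and> snd p \<notin> N} \<in> sets lborel2"
      by measurable
    show "AE x in lborel. AE y in lborel. fst (x, y) \<notin> N \<and> snd (x, y) \<notin> N"
      using ae by eventually_elim (use ae in simp)
  qed
  then show ?thesis by (rule eventually_mono) (use N(2) in blast)
qed

section \<open>Norm and bilinear form of order \<open>a\<close>\<close>

context
  fixes a :: real
  assumes a: "0 < a" "a < 1"
begin

lemma X_norm_nonneg: "0 \<le> X_norm a v"
  unfolding X_norm_eq
  by (intro real_sqrt_ge_zero mult_nonneg_nonneg divide_nonneg_nonneg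
      frac_const_pos[OF a, THEN less_imp_le]) auto

lemma X_norm_square: "(X_norm a v)\<^sup>2 = frac_form a v v"
  unfolding X_norm_eq frac_form_eq power2_eq_square[symmetric]
  by (intro real_sqrt_pow2 mult_nonneg_nonneg divide_nonneg_nonneg
      frac_const_pos[OF a, THEN less_imp_le]) auto

lemma frac_form_bound:
  fixes u v :: "real ^ 'n \<Rightarrow> real"
  assumes "u \<in> X_space a \<Omega>" "v \<in> X_space a \<Omega>"
  shows "\<bar>frac_form a u v\<bar> \<le> X_norm a u * X_norm a v"
proof -
  define c where "c = frac_const CARD('n) a / 2"
  have c: "c > 0" using frac_const_pos[OF a] by (simp add: c_def)
  have "\<bar>frac_form a u v\<bar> = c * \<bar>\<integral>p. gagliardo a u p * gagliardo a v p \<partial>lborel2\<bar>"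
    unfolding frac_form_eq c_def[symmetric] abs_mult using c by simp
  also have "\<dots> \<le> c * (sqrt (\<integral>p. (gagliardo a u p)\<^sup>2 \<partial>lborel2) *
       sqrt (\<integral>p. (gagliardo a v p)\<^sup>2 \<partial>lborel2))"
    using c by (intro mult_left_mono sq_integrable_Cauchy_Schwarz_abs X_space_gagliardo[OF assms(1)]
        X_space_gagliardo[OF assms(2)]) auto
  also have "\<dots> = X_norm a u * X_norm a v"
    unfolding X_norm_eq c_def[symmetric] real_sqrt_mult using c by simp
  finally show ?thesis .
qed

lemma X_norm_square_add:
  assumes "u \<in> X_space a \<Omega>" "v \<in> X_space a \<Omega>"
  shows "(X_norm a (\<lambda>x. u x + v x))\<^sup>2 = (X_norm a u)\<^sup>2 + 2 * frac_form a u v + (X_norm a v)\<^sup>2"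
  using frac_form_add_left[OF assms X_space_add[OF assms]]
    frac_form_add_left[OF assms assms(1)] frac_form_add_left[OF assms assms(2)]
  by (simp add: X_norm_square frac_form_commute)

lemma X_norm_square_diff:
  assumes "u \<in> X_space a \<Omega>" "v \<in> X_space a \<Omega>"
  shows "(X_norm a (\<lambda>x. u x - v x))\<^sup>2 = (X_norm a u)\<^sup>2 - 2 * frac_form a u v + (X_norm a v)\<^sup>2"
  using frac_form_diff_left[OF assms X_space_diff[OF assms]]
    frac_form_diff_left[OF assms assms(1)] frac_form_diff_left[OF assms assms(2)]
  by (simp add: X_norm_square frac_form_commute)

lemma X_norm_cmult: "X_norm a (\<lambda>x. c * v x) = \<bar>c\<bar> * X_norm a v"
  unfolding X_norm_eq gagliardo_cmult power_mult_distrib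
  by (simp add: real_sqrt_mult mult.left_commute[of _ "c\<^sup>2"] del: times_divide_eq_left)

lemma X_norm_triangle:
  assumes "u \<in> X_space a \<Omega>" "v \<in> X_space a \<Omega>"
  shows "X_norm a (\<lambda>x. u x + v x) \<le> X_norm a u + X_norm a v"
proof (rule power2_le_imp_le)
  show "(X_norm a (\<lambda>x. u x + v x))\<^sup>2 \<le> (X_norm a u + X_norm a v)\<^sup>2"
    using X_norm_square_add[OF assms] frac_form_bound[OF assms] by (simp add: power2_sum)
qed (simp add: X_norm_nonneg)

lemma X_norm_commute: "X_norm a (\<lambda>x. u x - v x) = X_norm a (\<lambda>x. v x - u x)"
  using X_norm_cmult[of "-1" "\<lambda>x. u x - v x"] by simp

lemma X_norm_triangle_diff:
  assumes "u \<in> X_space a \<Omega>" "v \<in> X_space a \<Omega>" "z \<in> X_space a \<Omega>"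
  shows "X_norm a (\<lambda>x. u x - z x) \<le> X_norm a (\<lambda>x. u x - v x) + X_norm a (\<lambda>x. v x - z x)"
  using X_norm_triangle[OF X_space_diff[OF assms(1,2)] X_space_diff[OF assms(2,3)]] by simp

lemma gagliardo_integral_bound:
  fixes v :: "real ^ 'n \<Rightarrow> real"
  assumes "X_norm a v \<le> K"
  shows "(\<integral>p. (gagliardo a v p)\<^sup>2 \<partial>lborel2) \<le> K\<^sup>2 / (frac_const CARD('n) a / 2)"
proof -
  have "(X_norm a v)\<^sup>2 = frac_const CARD('n) a / 2 * (\<integral>p. (gagliardo a v p)\<^sup>2 \<partial>lborel2)"
    unfolding X_norm_square frac_form_eq by (simp add: power2_eq_square)
  moreover have "(X_norm a v)\<^sup>2 \<le> K\<^sup>2" by (intro power_mono assms X_norm_nonneg)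
  ultimately show ?thesis using frac_const_pos[OF a, of "CARD('n)"] by (simp add: field_simps)
qed

lemma AE_gagliardo_tendsto:
  assumes "AE x in lborel. (\<lambda>n. v n x) \<longlonglongrightarrow> z x"
  shows "AE p in lborel2. (\<lambda>n. gagliardo a (v n) p) \<longlonglongrightarrow> gagliardo a z p"
  using AE_lborel_pair[OF assms] unfolding gagliardo_def case_prod_beta
  by eventually_elim (intro tendsto_intros; simp)

text \<open>Fatou twice, for the functions over the space and for their difference quotients over
  pairs, gives membership of the limit and lower semicontinuity of the norm at once.\<close>

lemma X_space_Fatou:
  fixes v :: "nat \<Rightarrow> real ^ 'n \<Rightarrow> real"
  assumes v: "\<And>n. v n \<in> X_space a \<Omega>" and z: "z \<in> borel_measurable borel"
    and lim: "AE x in lborel. (\<lambda>n. v n x) \<longlonglongrightarrow> z x"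
    and B: "\<And>n. (LBINT x. (v n x)\<^sup>2) \<le> B" and K: "\<And>n. X_norm a (v n) \<le> K"
  shows "z \<in> X_space a \<Omega>" "X_norm a z \<le> K"
proof -
  define c where "c = frac_const CARD('n) a / 2"
  have c: "c > 0" using frac_const_pos[OF a] by (simp add: c_def)
  have K0: "0 \<le> K" using X_norm_nonneg[of "v 0"] K[of 0] by linarith
  have z': "z \<in> borel_measurable lborel" using z by simp
  note g = sq_integrable_Fatou[OF X_space_gagliardo[OF v] measurable_gagliardo[OF z']
      AE_gagliardo_tendsto[OF lim] gagliardo_integral_bound[OF K], folded c_def]
  have "AE x in lborel. \<forall>n. x \<notin> \<Omega> \<longrightarrow> v n x = 0"
    unfolding AE_all_countable using X_space_AE_zero[OF v] by blast
  then have "AE x in lborel. x \<notin> \<Omega> \<longrightarrow> z x = 0"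
    using lim by eventually_elim (auto simp: LIMSEQ_const_iff)
  then show "z \<in> X_space a \<Omega>"
    using sq_integrable_Fatou(1)[OF X_space_sq_integrable[OF v] z' lim B] g(1)
    by (simp add: X_space_iff)
  have "(X_norm a z)\<^sup>2 = c * (\<integral>p. (gagliardo a z p)\<^sup>2 \<partial>lborel2)"
    unfolding X_norm_square frac_form_eq c_def[symmetric] by (simp add: power2_eq_square)
  also have "\<dots> \<le> K\<^sup>2" using g(2) c by (simp add: field_simps)
  finally show "X_norm a z \<le> K" using K0 power2_le_imp_le by blast
qed

text \<open>A Lipschitz function enlarges difference quotients by at most the factor
  \<open>L\<close>, and \<open>h 0 = 0\<close> preserves the zero values outside \<Omega>.
  Truncations of the nonlinearity become admissible test functions in this way.\<close>

lemma X_space_Lipschitz: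
  fixes v :: "real ^ 'n \<Rightarrow> real"
  assumes v: "v \<in> X_space a \<Omega>" and h: "h \<in> borel_measurable borel" "h 0 = 0"
    and L: "\<And>p q. \<bar>h p - h q\<bar> \<le> L * \<bar>p - q\<bar>"
  shows "(\<lambda>x. h (v x)) \<in> X_space a \<Omega>"
proof -
  have L0: "0 \<le> L" using L[of 1 0] by simp
  have [measurable]: "v \<in> borel_measurable lborel" "h \<in> borel_measurable borel"
    using X_space_measurable[OF v] h by auto
  have hv: "(\<lambda>x. h (v x)) \<in> borel_measurable lborel" by measurable
  have "\<bar>h p\<bar> \<le> \<bar>L * p\<bar>" for p using L[of p 0] h(2) L0 by (simp add: abs_mult)
  then have 1: "sq_integrable lborel (\<lambda>x. h (v x))"
    using hv by (intro sq_integrable_bound[OF sq_integrable_cmult[OF X_space_sq_integrable[OF v], of L]]) auto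
  have "\<bar>gagliardo a (\<lambda>x. h (v x)) p\<bar> \<le> \<bar>L * gagliardo a v p\<bar>" for p
    using mult_right_mono[OF L[of "v (fst p)" "v (snd p)"], of "sqrt (frac_kernel a (fst p) (snd p))"] L0
    by (simp add: gagliardo_def case_prod_beta abs_mult mult.assoc frac_kernel_nonneg)
  then have 2: "sq_integrable lborel2 (gagliardo a (\<lambda>x. h (v x)))"
    using measurable_gagliardo[OF hv]
    by (intro sq_integrable_bound[OF sq_integrable_cmult[OF X_space_gagliardo[OF v], of L]]) auto
  have "AE x in lborel. x \<notin> \<Omega> \<longrightarrow> h (v x) = 0"
    using X_space_AE_zero[OF v] h(2) by auto
  then show ?thesis using 1 2 by (simp add: X_space_iff)
qed

text \<open>The integrand is pointwise nonnegative; if it is not integrable, the integral is 0, so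
  the sign holds for every \<open>v\<close>.\<close>

lemma frac_form_mono_nonneg:
  assumes "mono h"
  shows "0 \<le> frac_form a v (\<lambda>x. h (v x))"
proof -
  have "0 \<le> (p - q) * (h p - h q)" for p q :: real
    using monoD[OF assms, of p q] monoD[OF assms, of q p]
    by (cases "p \<le> q") (auto intro: mult_nonneg_nonneg mult_nonpos_nonpos)
  then show ?thesis unfolding frac_form_def using frac_const_pos[OF a]
    by (intro mult_nonneg_nonneg Bochner_Integration.integral_nonneg)
      (auto simp: frac_kernel_nonneg intro: less_imp_le)
qed

text \<open>Points of a ball disjoint from \<open>\<Omega>\<close> see the whole of \<open>\<Omega>\<close> at a bounded distance.\<close>

lemma X_space_Poincare:
  fixes \<Omega> :: "(real ^ 'n) set"
  assumes "bounded \<Omega>"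
  obtains P where "P > 0" "\<And>v. v \<in> X_space a \<Omega> \<Longrightarrow> (LBINT x. (v x)\<^sup>2) \<le> P * (X_norm a v)\<^sup>2"
proof -
  obtain R where R: "R > 0" "\<Omega> \<subseteq> ball 0 R"
    using bounded_subset_ballD[OF assms] by blast
  \<comment> \<open>The unit ball around \<open>c\<close> lies in the shell
    \<open>R + 1 < norm y < R + 3\<close>, hence misses \<Omega>, and none of its points is farther
    than \<open>2 * R + 3\<close> from a point of \<Omega>.\<close>
  obtain c :: "real ^ 'n" where c: "norm c = R + 2"
    using vector_choose_size[of "R + 2"] R by auto
  define A where "A = ball c 1"
  define D where "D = 2 * R + 3"
  define \<kappa> where "\<kappa> = 1 / D powr (real CARD('n) + 2 * a)"
  have D: "D > 0" using R by (simp add: D_def)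
  have \<kappa>: "\<kappa> > 0" using D by (simp add: \<kappa>_def)
  have kernel: "\<kappa> \<le> frac_kernel a x y" if "x \<in> \<Omega>" "y \<in> A" for x y
  proof -
    have x: "norm x < R" using that R by auto
    have y: "norm (c - y) < 1" using that by (simp add: A_def dist_norm)
    have "norm c \<le> norm (c - y) + norm y" using norm_triangle_sub[of c y] by simp
    then have y1: "norm y > R + 1" using c y by simp
    have "norm y \<le> norm (c - y) + norm c" using norm_triangle_sub[of y c] by (simp add: norm_minus_commute)
    then have y2: "norm y < R + 3" using c y by simp
    have "x \<noteq> y" using x y1 by auto
    moreover have "norm (x - y) \<le> D" using norm_triangle_ineq4[of x y] x y2 by (simp add: D_def)
    ultimately show ?thesis unfolding \<kappa>_def frac_kernel_def using a
      by (intro divide_left_mono powr_mono2 mult_pos_pos) auto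
  qed
  have disj: "y \<notin> \<Omega>" if "y \<in> A" for y
  proof
    assume "y \<in> \<Omega>"
    then have "norm y < R" using R by auto
    moreover have "norm (c - y) < 1" using that by (simp add: A_def dist_norm)
    ultimately show False using norm_triangle_sub[of c y] c by simp
  qed
  have [measurable]: "A \<in> sets borel" by (simp add: A_def)
  define m where "m = measure lborel A"
  have m: "m > 0" unfolding m_def A_def by (rule content_ball_pos) simp
  have em: "emeasure lborel A = ennreal m"
    unfolding m_def by (rule emeasure_eq_ennreal_measure) (use emeasure_lborel_ball_finite[of c 1] in \<open>simp add: A_def less_top\<close>)
  define C where "C = frac_const CARD('n) a / 2"
  have C: "C > 0" using frac_const_pos[OF a] by (simp add: C_def)
  have "(LBINT x. (v x)\<^sup>2) \<le> 1 / (\<kappa> * m * C) * (X_norm a v)\<^sup>2" if v: "v \<in> X_space a \<Omega>" for v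
  proof -
    define I where "I = (\<integral>p. (gagliardo a v p)\<^sup>2 \<partial>lborel2)"
    note [measurable] = X_space_measurable[OF v]
    note z = X_space_AE_zero[OF v]
    \<comment> \<open>Only \<open>y\<close> in \<open>A\<close> is kept in the inner integral; there
      \<open>v y = 0\<close> and the kernel is at least \<kappa>.\<close>
    have "(\<integral>\<^sup>+x. ennreal (\<kappa> * (v x)\<^sup>2) * ennreal m \<partial>lborel)
        \<le> (\<integral>\<^sup>+x. \<integral>\<^sup>+y. ennreal ((gagliardo a v (x, y))\<^sup>2) \<partial>lborel \<partial>lborel)"
    proof (rule nn_integral_mono_AE)
      show "AE x in lborel. ennreal (\<kappa> * (v x)\<^sup>2) * ennreal m \<le>
          (\<integral>\<^sup>+y. ennreal ((gagliardo a v (x, y))\<^sup>2) \<partial>lborel)"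
        using z
      proof eventually_elim
        case (elim x)
        show ?case
        proof (cases "x \<in> \<Omega>")
          case False then show ?thesis using elim by simp
        next
          case True
          have "ennreal (\<kappa> * (v x)\<^sup>2) * ennreal m = (\<integral>\<^sup>+y. ennreal (\<kappa> * (v x)\<^sup>2) * indicator A y \<partial>lborel)"
            by (simp add: em nn_integral_cmult_indicator)
          also have "\<dots> \<le> (\<integral>\<^sup>+y. ennreal ((gagliardo a v (x, y))\<^sup>2) \<partial>lborel)"
          proof (rule nn_integral_mono_AE)
            show "AE y in lborel. ennreal (\<kappa> * (v x)\<^sup>2) * indicator A y
                \<le> ennreal ((gagliardo a v (x, y))\<^sup>2)"
              using z
            proof eventually_elim
              case (elim y)
              show ?case
              proof (cases "y \<in> A")
                case y: True
                then have "v y = 0" using elim disj by auto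
                then have "\<kappa> * (v x)\<^sup>2 \<le> (gagliardo a v (x, y))\<^sup>2"
                  using mult_right_mono[OF kernel[OF True y], of "(v x)\<^sup>2"]
                  by (simp add: gagliardo_square mult.commute)
                then show ?thesis using y by (simp add: ennreal_leI)
              qed simp
            qed
          qed
          finally show ?thesis .
        qed
      qed
    qed
    also have "\<dots> = (\<integral>\<^sup>+p. ennreal ((gagliardo a v p)\<^sup>2) \<partial>lborel2)"
      by (rule lborel.nn_integral_fst) measurable
    also have "\<dots> = ennreal I"
      unfolding I_def using X_space_gagliardo[OF v]
      by (intro nn_integral_eq_integral) (auto simp: sq_integrable_def)
    also have "(\<integral>\<^sup>+x. ennreal (\<kappa> * (v x)\<^sup>2) * ennreal m \<partial>lborel) = (\<integral>\<^sup>+x. ennreal (\<kappa> * m * (v x)\<^sup>2) \<partial>lborel)"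
      using \<kappa> m by (intro nn_integral_cong) (simp add: ennreal_mult[symmetric] mult_ac)
    also have "\<dots> = ennreal (\<kappa> * m * (LBINT x. (v x)\<^sup>2))"
      using X_space_sq_integrable[OF v] \<kappa> m
      by (subst nn_integral_eq_integral) (auto simp: sq_integrable_def)
    finally have "\<kappa> * m * (LBINT x. (v x)\<^sup>2) \<le> I"
      by (simp add: I_def)
    moreover have "(X_norm a v)\<^sup>2 = C * I"
      unfolding X_norm_square frac_form_eq C_def I_def by (simp add: power2_eq_square)
    ultimately show ?thesis using \<kappa> m C by (simp add: field_simps)
  qed
  then show ?thesis using that[of "1 / (\<kappa> * m * C)"] \<kappa> m C by simp
qed

end

section \<open>Lipschitz bumps\<close>

text \<open>
  Dyadic shells: on \<open>2\<^sup>k \<le> |z| < 2\<^sup>k\<^sup>+\<^sup>1\<close> the integrand is comparable to a constant, and the resulting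
  geometric series converge for \<open>k \<rightarrow> -\<infinity>\<close> since \<open>a < 1\<close> and for \<open>k \<rightarrow> \<infinity>\<close> since \<open>0 < a\<close>.
\<close>

lemma truncated_kernel_integral_finite:
  fixes a :: real
  assumes a: "0 < a" "a < 1"
  shows "(\<integral>\<^sup>+z. ennreal (min ((norm (z :: real ^ 'n))\<^sup>2) 1 / norm z powr (real CARD('n) + 2 * a)) \<partial>lborel) < \<infinity>"
proof -
  define N where "N = real CARD('n)"
  define p where "p = N + 2 * a"
  define V where "V = unit_ball_vol (real CARD('n))"
  have V: "V \<ge> 0" by (simp add: V_def)
  have N: "N \<ge> 0" by (simp add: N_def)
  have p: "p > 0" using a N by (simp add: p_def)
  \<comment> \<open>\<open>c j\<close> bounds the integrand on the shell from
    \<open>2 powr (- j - 1)\<close> to \<open>2 powr (- j)\<close>, as the square of the outer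
    radius over the power \<open>p\<close> of the inner one; \<open>d j\<close> bounds it on the
    shell from \<open>2 powr j\<close> to \<open>2 powr (j + 1)\<close>. Each shell is enlarged to
    its outer ball, whose volume is explicit.\<close>
  define c d :: "nat \<Rightarrow> real" where "c j = 2 powr (- 2 * real j + (real j + 1) * p)"
    and "d j = 2 powr (- real j * p)" for j
  have vol: "emeasure lborel (ball (0 :: real ^ 'n) (2 powr r)) = ennreal (V * 2 powr (r * N))" for r
    by (simp add: emeasure_ball V_def N_def powr_powr flip: powr_realpow)
  have le_suminf: "f j \<le> (\<Sum>j. f j)" for f :: "nat \<Rightarrow> ennreal" and j
    using sum_le_suminf[of f "{j}"] by simp
  have pw: "ennreal (min ((norm z)\<^sup>2) 1 / norm z powr p) \<le>
      (\<Sum>j. ennreal (c j) * indicator (ball 0 (2 powr (- real j))) z) +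
      (\<Sum>j. ennreal (d j) * indicator (ball 0 (2 powr (real j + 1))) z)" for z :: "real ^ 'n"
  proof (cases "z = 0")
    case False
    define k where "k = \<lfloor>log 2 (norm z)\<rfloor>"
    have "real_of_int k \<le> log 2 (norm z)" "log 2 (norm z) < real_of_int k + 1"
      by (auto simp: k_def)
    then have k: "2 powr real_of_int k \<le> norm z" "norm z < 2 powr (real_of_int k + 1)"
      using False by (auto simp: le_log_iff log_less_iff)
    have inv: "1 / norm z powr p \<le> 2 powr (- real_of_int k * p)"
    proof -
      have "1 / norm z powr p \<le> 1 / (2 powr real_of_int k) powr p"
        using k(1) p False by (intro divide_left_mono powr_mono2 mult_pos_pos) auto
      then show ?thesis by (simp add: powr_powr powr_minus_divide)
    qed
    show ?thesis
    proof (cases "k \<ge> 0")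
      case True
      define j where "j = nat k"
      have kj: "real_of_int k = real j" using True by (simp add: j_def)
      have "min ((norm z)\<^sup>2) 1 / norm z powr p \<le> 1 / norm z powr p"
        by (intro divide_right_mono) auto
      also have "\<dots> \<le> d j" using inv by (simp add: d_def kj)
      finally have "ennreal (min ((norm z)\<^sup>2) 1 / norm z powr p) \<le> ennreal (d j) * indicator (ball 0 (2 powr (real j + 1))) z"
        using k(2) kj by (simp add: ennreal_leI)
      also have "\<dots> \<le> (\<Sum>j. ennreal (d j) * indicator (ball 0 (2 powr (real j + 1))) z)"
        by (rule le_suminf[of "\<lambda>j. ennreal (d j) * indicator (ball 0 (2 powr (real j + 1))) z"])
      finally show ?thesis by (simp add: add_increasing)
    next
      case False
      \<comment> \<open>The inner shells are numbered from \<open>k = -1\<close> downwards.\<close>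
      define j where "j = nat (- k - 1)"
      have kj: "real_of_int k = - real j - 1" using False by (simp add: j_def)
      have nz: "norm z < 2 powr (- real j)" using k(2) kj by simp
      have "min ((norm z)\<^sup>2) 1 / norm z powr p \<le> (norm z)\<^sup>2 * (1 / norm z powr p)"
        by (simp add: divide_right_mono)
      also have "\<dots> \<le> (2 powr (- real j))\<^sup>2 * 2 powr (- real_of_int k * p)"
        using nz inv by (intro mult_mono power_mono) auto
      also have "\<dots> = c j"
        by (simp add: c_def kj powr_add power2_eq_square flip: powr_add) (simp add: algebra_simps)
      finally have "ennreal (min ((norm z)\<^sup>2) 1 / norm z powr p) \<le> ennreal (c j) * indicator (ball 0 (2 powr (- real j))) z"
        using nz by (simp add: ennreal_leI)
      also have "\<dots> \<le> (\<Sum>j. ennreal (c j) * indicator (ball 0 (2 powr (- real j))) z)"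
        by (rule le_suminf[of "\<lambda>j. ennreal (c j) * indicator (ball 0 (2 powr (- real j))) z"])
      finally show ?thesis by (simp add: add_increasing2)
    qed
  qed simp
  have "(\<integral>\<^sup>+z. ennreal (min ((norm (z :: real ^ 'n))\<^sup>2) 1 / norm z powr p) \<partial>lborel) \<le>
     (\<integral>\<^sup>+z. ((\<Sum>j. ennreal (c j) * indicator (ball 0 (2 powr (- real j))) z) +
      (\<Sum>j. ennreal (d j) * indicator (ball 0 (2 powr (real j + 1))) (z :: real ^ 'n))) \<partial>lborel)"
    by (intro nn_integral_mono pw)
  also have "\<dots> = (\<Sum>j. ennreal (c j) * emeasure lborel (ball (0 :: real ^ 'n) (2 powr (- real j)))) +
      (\<Sum>j. ennreal (d j) * emeasure lborel (ball (0 :: real ^ 'n) (2 powr (real j + 1))))"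
  proof -
    have [measurable]: "ball (0 :: real ^ 'n) r \<in> sets borel" for r by simp
    have "(\<integral>\<^sup>+z. (\<Sum>j. ennreal (f j) * indicator (ball (0 :: real ^ 'n) (r j)) z) \<partial>lborel) =
        (\<Sum>j. ennreal (f j) * emeasure lborel (ball (0 :: real ^ 'n) (r j)))" for f r :: "nat \<Rightarrow> real"
      by (subst nn_integral_suminf) (auto simp: nn_integral_cmult_indicator)
    then show ?thesis by (subst nn_integral_add) simp_all
  qed
  also have "(\<Sum>j. ennreal (c j) * emeasure lborel (ball (0 :: real ^ 'n) (2 powr (- real j)))) =
      (\<Sum>j. ennreal (V * 2 powr p * (2 powr (2 * a - 2)) ^ j))"
  proof -
    \<comment> \<open>The powers coming from the dimension cancel since
      \<open>p = N + 2 * a\<close>, and a geometric sequence of ratio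
      \<open>2 powr (2 * a - 2)\<close> remains.\<close>
    have *: "c j * (V * 2 powr (- real j * N)) = V * 2 powr p * (2 powr (2 * a - 2)) ^ j" for j
    proof -
      have "c j * 2 powr (- real j * N) = 2 powr p * 2 powr (real j * (2 * a - 2))"
        by (simp add: c_def p_def algebra_simps flip: powr_add)
      also have "2 powr (real j * (2 * a - 2)) = (2 powr (2 * a - 2)) ^ j"
        by (simp add: powr_powr mult.commute flip: powr_realpow)
      finally show ?thesis by simp
    qed
    have "0 \<le> c j" for j by (simp add: c_def)
    then show ?thesis unfolding vol by (simp only: * flip: ennreal_mult')
  qed
  also have "(\<Sum>j. ennreal (d j) * emeasure lborel (ball (0 :: real ^ 'n) (2 powr (real j + 1)))) =
      (\<Sum>j. ennreal (V * 2 powr N * (2 powr (- 2 * a)) ^ j))"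
  proof -
    have *: "d j * (V * 2 powr ((real j + 1) * N)) = V * 2 powr N * (2 powr (- 2 * a)) ^ j" for j
    proof -
      have "d j * 2 powr ((real j + 1) * N) = 2 powr N * 2 powr (real j * (- 2 * a))"
        by (simp add: d_def p_def algebra_simps flip: powr_add)
      also have "2 powr (real j * (- 2 * a)) = (2 powr (- 2 * a)) ^ j"
        by (simp add: powr_powr mult.commute flip: powr_realpow)
      finally show ?thesis by simp
    qed
    have "0 \<le> d j" for j by (simp add: d_def)
    then show ?thesis unfolding vol by (simp only: * flip: ennreal_mult')
  qed
  also have "(\<Sum>j. ennreal (V * 2 powr p * (2 powr (2 * a - 2)) ^ j)) +
     (\<Sum>j. ennreal (V * 2 powr N * (2 powr (- 2 * a)) ^ j)) < \<infinity>"
  proof -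
    have "2 powr (2 * a - 2) < 2 powr 0" "2 powr (- 2 * a) < 2 powr 0"
      by (rule powr_less_mono; use a in simp)+
    then have "(\<Sum>j. ennreal (V * 2 powr p * (2 powr (2 * a - 2)) ^ j)) \<noteq> \<infinity>"
      "(\<Sum>j. ennreal (V * 2 powr N * (2 powr (- 2 * a)) ^ j)) \<noteq> \<infinity>"
      using V unfolding infinity_ennreal_def
      by (intro ennreal_suminf_neq_top summable_mult summable_geometric; simp)+
    then show ?thesis by (simp add: less_top)
  qed
  finally show ?thesis by (simp add: p_def N_def)
qed

lemma nn_integral_lborel_translate:
  fixes f :: "real ^ 'n \<Rightarrow> ennreal"
  assumes [measurable]: "f \<in> borel_measurable borel"
  shows "(\<integral>\<^sup>+y. f (y - x) \<partial>lborel) = (\<integral>\<^sup>+y. f y \<partial>lborel)"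
proof -
  have "(\<integral>\<^sup>+y. f y \<partial>lborel) = (\<integral>\<^sup>+y. f y \<partial>distr lborel borel ((+) (- x)))"
    by (simp add: lborel_distr_plus)
  also have "\<dots> = (\<integral>\<^sup>+y. f (- x + y) \<partial>lborel)" by (subst nn_integral_distr) auto
  finally show ?thesis by simp
qed

text \<open>The squared difference is at most a multiple of the smaller of 1 and the squared
  distance, and it vanishes unless one of the two points lies in \<open>U\<close>. Integrating first
  over the other point reduces the seminorm to the kernel integral above times the measure of
  \<open>U\<close>.\<close>

lemma X_space_Lipschitz_bump:
  fixes \<psi> :: "real ^ 'n \<Rightarrow> real"
  assumes a: "0 < a" "a < 1"
    and \<psi>: "\<psi> \<in> borel_measurable borel" "\<And>x. 0 \<le> \<psi> x" "\<And>x. \<psi> x \<le> 1"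
      "\<And>x y. \<bar>\<psi> x - \<psi> y\<bar> \<le> L * norm (x - y)"
    and U: "open U" "bounded U" "U \<subseteq> \<Omega>" "\<And>x. x \<notin> U \<Longrightarrow> \<psi> x = 0"
  shows "\<psi> \<in> X_space a \<Omega>"
proof -
  define p where "p = real CARD('n) + 2 * a"
  \<comment> \<open>Covers both bounds for the squared difference, the Lipschitz bound and the bound
    1.\<close>
  define C where "C = max 1 (L\<^sup>2)"
  define m where "m z = ennreal (min ((norm z)\<^sup>2) 1 / norm z powr p)" for z :: "real ^ 'n"
  have [measurable]: "U \<in> sets borel" "m \<in> borel_measurable borel" "\<psi> \<in> borel_measurable borel"
    using U(1) \<psi>(1) unfolding m_def by measurable
  have fin: "emeasure lborel U < \<infinity>" using U(2) by (rule emeasure_bounded_finite)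
  have pw: "ennreal ((gagliardo a \<psi> (x, y))\<^sup>2) \<le>
      indicator U x * (ennreal C * m (y - x)) + indicator U y * (ennreal C * m (x - y))" for x y
  proof (cases "x \<in> U \<or> y \<in> U")
    case False
    then show ?thesis using U(4) by (simp add: gagliardo_def)
  next
    case True
    have "\<bar>\<psi> x - \<psi> y\<bar> \<le> 1" using \<psi>(2,3)[of x] \<psi>(2,3)[of y] by linarith
    then have 1: "(\<psi> x - \<psi> y)\<^sup>2 \<le> 1" by (simp add: abs_square_le_1)
    have "(\<psi> x - \<psi> y)\<^sup>2 \<le> (L * norm (x - y))\<^sup>2"
      using power_mono[OF \<psi>(4)[of x y], of 2] by simp
    also have "\<dots> \<le> C * (norm (x - y))\<^sup>2" by (simp add: power_mult_distrib C_def mult_right_mono)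
    finally have "(\<psi> x - \<psi> y)\<^sup>2 \<le> C * min ((norm (x - y))\<^sup>2) 1"
      using 1 by (auto simp: min_def C_def)
    then have "(\<psi> x - \<psi> y)\<^sup>2 / norm (x - y) powr p \<le> C * (min ((norm (x - y))\<^sup>2) 1) / norm (x - y) powr p"
      by (intro divide_right_mono) auto
    then have "ennreal ((gagliardo a \<psi> (x, y))\<^sup>2) \<le> ennreal (C * (min ((norm (x - y))\<^sup>2) 1 / norm (x - y) powr p))"
      by (intro ennreal_leI) (simp add: gagliardo_square frac_kernel_def p_def)
    also have "\<dots> = ennreal C * m (x - y)" 
      unfolding m_def by (rule ennreal_mult) (auto simp: C_def)
    finally show ?thesis using True
      by (auto simp: m_def norm_minus_commute add_increasing add_increasing2 split: split_indicator)
  qed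
  have fin1: "(\<integral>\<^sup>+x. \<integral>\<^sup>+y. indicator U x * (ennreal C * m (y - x)) \<partial>lborel \<partial>lborel) < \<infinity>"
  proof -
    have "(\<integral>\<^sup>+x. \<integral>\<^sup>+y. indicator U x * (ennreal C * m (y - x)) \<partial>lborel \<partial>lborel)
        = (\<integral>\<^sup>+x. (ennreal C * (\<integral>\<^sup>+y. m y \<partial>lborel)) * indicator U x \<partial>lborel)"
      by (intro nn_integral_cong)
        (simp add: nn_integral_cmult nn_integral_lborel_translate mult.commute)
    also have "\<dots> = (ennreal C * (\<integral>\<^sup>+y. m y \<partial>lborel)) * emeasure lborel U"
      by (simp add: nn_integral_cmult_indicator)
    also have "\<dots> < \<infinity>"
      using fin truncated_kernel_integral_finite[OF a, where 'n = 'n]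
      by (simp add: m_def p_def ennreal_mult_less_top)
    finally show ?thesis .
  qed
  have "(\<integral>\<^sup>+q. ennreal ((gagliardo a \<psi> q)\<^sup>2) \<partial>lborel2) \<le>
      (\<integral>\<^sup>+q. indicator U (fst q) * (ennreal C * m (snd q - fst q)) + indicator U (snd q) * (ennreal C * m (fst q - snd q)) \<partial>lborel2)"
    by (intro nn_integral_mono) (use pw in \<open>auto simp: split_beta\<close>)
  also have "\<dots> = (\<integral>\<^sup>+q. indicator U (fst q) * (ennreal C * m (snd q - fst q)) \<partial>lborel2) +
      (\<integral>\<^sup>+q. indicator U (snd q) * (ennreal C * m (fst q - snd q)) \<partial>lborel2)"
    by (rule nn_integral_add) measurable
  also have "(\<integral>\<^sup>+q. indicator U (fst q) * (ennreal C * m (snd q - fst q)) \<partial>lborel2) =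
      (\<integral>\<^sup>+x. \<integral>\<^sup>+y. indicator U x * (ennreal C * m (y - x)) \<partial>lborel \<partial>lborel)"
    by (subst lborel.nn_integral_fst[symmetric]) simp_all
  also have "(\<integral>\<^sup>+q. indicator U (snd q) * (ennreal C * m (fst q - snd q)) \<partial>lborel2) =
      (\<integral>\<^sup>+x. \<integral>\<^sup>+y. indicator U x * (ennreal C * m (y - x)) \<partial>lborel \<partial>lborel)"
    by (subst lborel_pair.nn_integral_snd[symmetric]) simp_all
  finally have g: "(\<integral>\<^sup>+q. ennreal ((gagliardo a \<psi> q)\<^sup>2) \<partial>lborel2) < \<infinity>"
    using fin1 by (simp add: le_less_trans)
  have gm: "gagliardo a \<psi> \<in> borel_measurable lborel2" by (rule measurable_gagliardo) simp
  have "sq_integrable lborel2 (gagliardo a \<psi>)"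
    unfolding sq_integrable_def using gm g by (auto intro!: integrableI_bounded)
  moreover have "sq_integrable lborel \<psi>"
    using \<psi>(2,3) U(4) fin
    by (intro sq_integrable_bound[OF sq_integrable_indicator[of U lborel]]) (auto simp: indicator_def)
  ultimately show ?thesis using U(3,4) by (auto simp: X_space_iff)
qed

text \<open>An indicator itself need not lie in the space when \<open>a \<ge> 1 / 2\<close>.
  Multiples of the distance to the complement, cut off at 1, are Lipschitz bumps that reach the
  value 1 at every point of the open set.\<close>

lemma X_space_approx_indicator:
  fixes U :: "(real ^ 'n) set"
  assumes a: "0 < a" "a < 1" and U: "open U" "bounded U" "U \<subseteq> \<Omega>" and e: "e > 0"
  obtains \<psi> where "\<psi> \<in> X_space a \<Omega>" "(LBINT x. (indicator U x - \<psi> x)\<^sup>2) < e"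
proof -
  define \<psi> where "\<psi> k x = min 1 (real k * infdist x (- U))" for k :: nat and x
  have cont: "continuous_on UNIV (\<psi> k)" for k
    unfolding \<psi>_def by (intro continuous_intros)
  have [measurable]: "\<psi> k \<in> borel_measurable borel" for k
    by (rule borel_measurable_continuous_onI[OF cont])
  have [measurable]: "U \<in> sets borel" using U(1) by simp
  have fin: "emeasure lborel U < \<infinity>" using U(2) by (rule emeasure_bounded_finite)
  \<comment> \<open>The distance to the empty set is 0 by convention, so the complement must be
    inhabited for the bumps to reach 1.\<close>
  have nonempty: "- U \<noteq> {}" using U(2) not_bounded_UNIV by (metis Compl_empty_eq double_complement)
  have nn: "0 \<le> \<psi> k x" "\<psi> k x \<le> 1" for k x by (auto simp: \<psi>_def infdist_nonneg)
  have out: "\<psi> k x = 0" if "x \<notin> U" for k x using that by (simp add: \<psi>_def)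
  have X: "\<psi> k \<in> X_space a \<Omega>" for k
  proof (rule X_space_Lipschitz_bump[OF a, of _ "real k" U])
    fix x y
    have "\<bar>real k * infdist x (- U) - real k * infdist y (- U)\<bar> = real k * \<bar>infdist x (- U) - infdist y (- U)\<bar>"
      by (simp add: abs_mult flip: right_diff_distrib)
    also have "\<dots> \<le> real k * norm (x - y)"
      using infdist_triangle_abs[of x "- U" y] by (intro mult_left_mono) (auto simp: dist_norm)
    finally show "\<bar>\<psi> k x - \<psi> k y\<bar> \<le> real k * norm (x - y)" by (auto simp: \<psi>_def min_def)
  qed (use nn out U in auto)
  have lim: "(\<lambda>k. (indicator U x - \<psi> k x)\<^sup>2) \<longlonglongrightarrow> 0" for x
  proof (cases "x \<in> U")
    case False then show ?thesis by (simp add: out)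
  next
    case True
    have "infdist x (- U) \<noteq> 0"
      using in_closed_iff_infdist_zero[of "- U" x] U(1) nonempty True by auto
    then have i: "infdist x (- U) > 0" using infdist_nonneg[of x "- U"] by linarith
    obtain K :: nat where K: "1 / infdist x (- U) < real K" using reals_Archimedean2 by blast
    have "\<psi> k x = 1" if "k \<ge> K" for k
    proof -
      have "1 < real K * infdist x (- U)" using K i by (simp add: field_simps)
      also have "\<dots> \<le> real k * infdist x (- U)" using that i by (intro mult_right_mono) auto
      finally show ?thesis by (simp add: \<psi>_def)
    qed
    then have "\<forall>\<^sub>F k in sequentially. (indicator U x - \<psi> k x)\<^sup>2 = 0"
      using True by (auto simp: eventually_sequentially)
    then show ?thesis by (rule tendsto_eventually)
  qed
  have "(\<lambda>k. LBINT x. (indicator U x - \<psi> k x)\<^sup>2) \<longlonglongrightarrow> integral\<^sup>L lborel (\<lambda>x :: real ^ 'n. 0)"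
  proof (rule integral_dominated_convergence)
    show "integrable lborel (\<lambda>x. indicat_real U x)" using fin by simp
    show "AE x in lborel. norm ((indicator U x - \<psi> k x)\<^sup>2) \<le> indicat_real U x" for k
      using nn out by (auto simp: indicator_def abs_square_le_1)
  qed (use lim in auto)
  then have "\<forall>\<^sub>F k in sequentially. (LBINT x. (indicator U x - \<psi> k x)\<^sup>2) < e"
    using e by (intro order_tendstoD(2)) auto
  then obtain k where "(LBINT x. (indicator U x - \<psi> k x)\<^sup>2) < e"
    by (auto simp: eventually_sequentially)
  then show ?thesis using that X by blast
qed

section \<open>Compactness\<close>

text \<open>Replaces a weight \<open>f\<close> by an approximation \<open>h\<close>; the error is a
  small multiple of the squared L2 norm of \<open>v\<close>, which can be absorbed later.\<close>

lemma sq_integrable_integral_square_le: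
  assumes "sq_integrable M v" "sq_integrable M f" "sq_integrable M h" "(\<integral>x. (f x - h x)\<^sup>2 \<partial>M) \<le> \<eta>"
  shows "(\<integral>x. v x * f x \<partial>M)\<^sup>2 \<le> 2 * (\<integral>x. v x * h x \<partial>M)\<^sup>2 + 2 * (\<eta> * (\<integral>x. (v x)\<^sup>2 \<partial>M))"
proof -
  note d = sq_integrable_diff[OF assms(2,3)]
  have eq: "(\<integral>x. v x * f x \<partial>M) = (\<integral>x. v x * h x \<partial>M) + (\<integral>x. v x * (f x - h x) \<partial>M)"
    using sq_integrable_mult_integrable[OF assms(1) d] sq_integrable_mult_integrable[OF assms(1,3)]
    by (subst Bochner_Integration.integral_add[symmetric]) (auto simp: algebra_simps)
  have "(\<integral>x. v x * (f x - h x) \<partial>M)\<^sup>2 \<le> (\<integral>x. (v x)\<^sup>2 \<partial>M) * (\<integral>x. (f x - h x)\<^sup>2 \<partial>M)"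
    by (rule sq_integrable_Cauchy_Schwarz[OF assms(1) d])
  also have "\<dots> \<le> (\<integral>x. (v x)\<^sup>2 \<partial>M) * \<eta>" by (intro mult_left_mono assms) simp
  finally have 1: "(\<integral>x. v x * (f x - h x) \<partial>M)\<^sup>2 \<le> \<eta> * (\<integral>x. (v x)\<^sup>2 \<partial>M)" by (simp add: mult.commute)
  have "(p + q)\<^sup>2 \<le> 2 * p\<^sup>2 + 2 * q\<^sup>2" for p q :: real
    using zero_le_power2[of "p - q"] by (simp add: power2_eq_square algebra_simps)
  from this[of "\<integral>x. v x * h x \<partial>M" "\<integral>x. v x * (f x - h x) \<partial>M"] show ?thesis
    unfolding eq using 1 by linarith
qed

text \<open>By Jensen, here Cauchy-Schwarz against the indicator of the ball, the squared distance
  of \<open>v x\<close> to the average is at most the average of the squared differences. Two points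
  of the ball are at most \<open>2 * \<delta>\<close> apart, so the kernel there is bounded below
  and the difference quotients control this average. The inner integral may be infinite at some
  \<open>x\<close>, hence the extended values.\<close>

lemma ball_average_estimate:
  fixes v :: "real ^ 'n \<Rightarrow> real"
  assumes "0 < a" and v: "sq_integrable lborel v" and \<delta>: "\<delta> > 0" and x: "x \<in> ball c \<delta>"
  defines "b \<equiv> measure lborel (ball c \<delta>)"
  shows "ennreal ((v x)\<^sup>2) \<le> ennreal (2 * (2 * \<delta>) powr (real CARD('n) + 2 * a) / b) *
      (\<integral>\<^sup>+y. ennreal ((gagliardo a v (x, y))\<^sup>2) \<partial>lborel) +
      ennreal (2 * ((LBINT y. v y * indicator (ball c \<delta>) y) / b)\<^sup>2)"
proof -
  define B where "B = ball c \<delta>"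
  define p where "p = real CARD('n) + 2 * a"
  define A where "A = (LBINT y. v y * indicator B y) / b"
  have b: "b > 0" unfolding b_def using \<delta> by (intro content_ball_pos)
  have [measurable]: "B \<in> sets borel" "v \<in> borel_measurable borel"
    using sq_integrable_measurable[OF v] by (simp_all add: B_def)
  have fin: "emeasure lborel B < \<infinity>" unfolding B_def by (rule emeasure_lborel_ball_finite)
  have IB: "sq_integrable lborel (indicator B)" using fin by (intro sq_integrable_indicator) auto
  have meas: "(LBINT y. indicator B y) = b" using fin by (simp add: b_def B_def)
  have iI: "integrable lborel (indicat_real B)" using fin by simp
  have ivB: "integrable lborel (\<lambda>y. v y * indicator B y)" by (rule sq_integrable_mult_integrable[OF v IB])
  have iI2: "(indicat_real B y)\<^sup>2 = indicator B y" for y by (simp add: indicator_def)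
  have d: "sq_integrable lborel (\<lambda>y. (v x - v y) * indicator B y)"
  proof (rule sq_integrable_bound)
    show "sq_integrable lborel (\<lambda>y. v x * indicator B y - v y)"
      by (intro sq_integrable_diff sq_integrable_cmult IB v)
  qed (auto simp: indicator_def)
  have eq: "v x - A = (LBINT y. ((v x - v y) * indicator B y) * indicator B y) / b"
  proof -
    have "(LBINT y. ((v x - v y) * indicator B y) * indicator B y) =
        (\<integral>y. v x * indicator B y - v y * indicator B y \<partial>lborel)"
      by (intro Bochner_Integration.integral_cong) (auto simp: indicator_def)
    also have "\<dots> = v x * b - (LBINT y. v y * indicator B y)"
      using iI ivB meas by (subst Bochner_Integration.integral_diff) auto
    finally show ?thesis using b by (simp add: A_def field_simps)
  qed
  have J: "(v x - A)\<^sup>2 \<le> (LBINT y. ((v x - v y) * indicator B y)\<^sup>2) / b"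
  proof -
    have "(v x - A)\<^sup>2 = (LBINT y. ((v x - v y) * indicator B y) * indicator B y)\<^sup>2 / b\<^sup>2"
      unfolding eq by (simp add: power_divide)
    also have "\<dots> \<le> ((LBINT y. ((v x - v y) * indicator B y)\<^sup>2) * (LBINT y. (indicator B y)\<^sup>2)) / b\<^sup>2"
      by (intro divide_right_mono sq_integrable_Cauchy_Schwarz d IB) auto
    also have "\<dots> = (LBINT y. ((v x - v y) * indicator B y)\<^sup>2) / b"
      unfolding iI2 meas using b by (simp add: power2_eq_square)
    finally show ?thesis .
  qed
  have pw: "((v x - v y) * indicator B y)\<^sup>2 \<le> (2 * \<delta>) powr p * (gagliardo a v (x, y))\<^sup>2" for y
  proof (cases "y \<in> B \<and> x \<noteq> y")
    case False then show ?thesis by (auto simp: gagliardo_def)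
  next
    case True
    have "norm (x - y) \<le> dist c x + dist c y"
      by (metis dist_commute dist_norm dist_triangle)
    also have "\<dots> \<le> 2 * \<delta>" using True x by (simp add: B_def)
    finally have "norm (x - y) powr p \<le> (2 * \<delta>) powr p"
      using \<open>0 < a\<close> by (intro powr_mono2) (auto simp: p_def)
    then have "1 \<le> (2 * \<delta>) powr p * frac_kernel a x y"
      using True by (simp add: frac_kernel_def p_def)
    then have "(v x - v y)\<^sup>2 * 1 \<le> (v x - v y)\<^sup>2 * ((2 * \<delta>) powr p * frac_kernel a x y)"
      by (intro mult_left_mono) auto
    then show ?thesis using True by (simp add: gagliardo_square mult_ac)
  qed
  have "ennreal ((v x - A)\<^sup>2) \<le> ennreal (1 / b * (LBINT y. ((v x - v y) * indicator B y)\<^sup>2))"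
    using J by (intro ennreal_leI) simp
  also have "\<dots> = ennreal (1 / b) * (\<integral>\<^sup>+y. ennreal (((v x - v y) * indicator B y)\<^sup>2) \<partial>lborel)"
    using d b by (subst nn_integral_eq_integral) (auto simp: sq_integrable_def ennreal_mult'[of "1 / b", symmetric])
  also have "\<dots> \<le> ennreal (1 / b) * (\<integral>\<^sup>+y. ennreal ((2 * \<delta>) powr p) * ennreal ((gagliardo a v (x, y))\<^sup>2) \<partial>lborel)"
    using pw by (intro mult_left_mono nn_integral_mono) (auto simp flip: ennreal_mult')
  also have "\<dots> = ennreal (1 / b) * (ennreal ((2 * \<delta>) powr p) * (\<integral>\<^sup>+y. ennreal ((gagliardo a v (x, y))\<^sup>2) \<partial>lborel))"
  proof -
    have [measurable]: "gagliardo a v \<in> borel_measurable lborel2"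
      by (rule measurable_gagliardo) simp
    show ?thesis by (subst nn_integral_cmult) simp_all
  qed
  also have "\<dots> = ennreal ((2 * \<delta>) powr p / b) * (\<integral>\<^sup>+y. ennreal ((gagliardo a v (x, y))\<^sup>2) \<partial>lborel)"
    using b by (simp add: mult.assoc[symmetric] flip: ennreal_mult')
  finally have *: "ennreal ((v x - A)\<^sup>2) \<le> \<dots>" .
  have "(v x)\<^sup>2 \<le> 2 * (v x - A)\<^sup>2 + 2 * A\<^sup>2"
    using zero_le_power2[of "v x - 2 * A"] by (simp add: power2_eq_square algebra_simps)
  then have "ennreal ((v x)\<^sup>2) \<le> ennreal (2 * (v x - A)\<^sup>2 + 2 * A\<^sup>2)" by (rule ennreal_leI)
  also have "\<dots> = 2 * ennreal ((v x - A)\<^sup>2) + ennreal (2 * A\<^sup>2)"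
    by (simp add: ennreal_plus ennreal_mult')
  also have "\<dots> \<le> 2 * (ennreal ((2 * \<delta>) powr p / b) * (\<integral>\<^sup>+y. ennreal ((gagliardo a v (x, y))\<^sup>2) \<partial>lborel)) + ennreal (2 * A\<^sup>2)"
    using * by (intro add_right_mono mult_left_mono) auto
  also have "2 * (ennreal ((2 * \<delta>) powr p / b) * (\<integral>\<^sup>+y. ennreal ((gagliardo a v (x, y))\<^sup>2) \<partial>lborel)) =
     ennreal (2 * (2 * \<delta>) powr p / b) * (\<integral>\<^sup>+y. ennreal ((gagliardo a v (x, y))\<^sup>2) \<partial>lborel)"
    using ennreal_mult'[of 2 "(2 * \<delta>) powr p / b"] by (simp add: mult.assoc)
  finally show ?thesis by (simp add: p_def A_def B_def)
qed

text \<open>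
  Each value \<open>v x\<close> is compared with the averages of \<open>v\<close> over the balls of a finite cover; the
  averages are tested approximately by elements of \<open>X_space s \<Omega>\<close>.
\<close>

lemma X_space_Ehrling:
  fixes \<Omega> :: "(real ^ 'n) set"
  assumes s: "0 < s" "s < 1" and a: "0 < a" "a < 1" and \<Omega>: "open \<Omega>" "bounded \<Omega>" and e: "e > 0"
  obtains I :: "(real ^ 'n) set" and \<psi> K where "finite I" "\<And>i. i \<in> I \<Longrightarrow> \<psi> i \<in> X_space s \<Omega>" "K \<ge> 0"
    "\<And>v. v \<in> X_space a \<Omega> \<Longrightarrow> (LBINT x. (v x)\<^sup>2) \<le>
        e * (X_norm a v)\<^sup>2 + K * (\<Sum>i\<in>I. (LBINT x. v x * \<psi> i x)\<^sup>2)"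
proof -
  define N where "N = real CARD('n)"
  define p where "p = N + 2 * a"
  define V where "V = unit_ball_vol N"
  define c where "c = frac_const CARD('n) a / 2"
  have V: "V > 0" by (simp add: V_def N_def)
  have c: "c > 0" using frac_const_pos[OF a] by (simp add: c_def)
  \<comment> \<open>Solves \<open>4 * ((2 * \<delta>) powr p / b) / c = e\<close>: division by the
    ball volume \<open>b\<close> leaves only \<open>\<delta> powr (2 * a)\<close>. The factor 4 is
    the 2 of \<open>ball_average_estimate\<close>, doubled by the absorption at the end.\<close>
  define \<delta> where "\<delta> = (e * V * c / (4 * 2 powr p)) powr (1 / (2 * a))"
  have \<delta>: "\<delta> > 0" using e V c by (simp add: \<delta>_def)
  define b where "b = V * \<delta> powr N"
  have b: "b > 0" using V \<delta> by (simp add: b_def)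
  have ball: "measure lborel (ball x \<delta>) = b" for x :: "real ^ 'n"
    using \<delta> by (simp add: content_ball b_def V_def N_def powr_realpow)
  have De: "4 * ((2 * \<delta>) powr p / b) / c = e"
  proof -
    have "(2 * \<delta>) powr p / b = 2 powr p * \<delta> powr (2 * a) / V"
      using \<delta> V by (simp add: b_def p_def powr_mult powr_add)
    also have "\<delta> powr (2 * a) = e * V * c / (4 * 2 powr p)"
      using a e V c by (simp add: \<delta>_def powr_powr)
    finally show ?thesis using V c by (simp add: field_simps)
  qed
  have "compact (closure \<Omega>)" using \<Omega> by simp
  then obtain I where I: "finite I" "closure \<Omega> \<subseteq> (\<Union>x\<in>I. ball x \<delta>)"
    using \<delta> unfolding compact_eq_totally_bounded by blast
  have cover: "\<exists>i\<in>I. x \<in> ball i \<delta>" if "x \<in> \<Omega>" for x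
    using I(2) closure_subset[of \<Omega>] that by blast
  define m where "m = measure lborel \<Omega>"
  have mfin: "emeasure lborel \<Omega> < \<infinity>" using \<Omega>(2) by (rule emeasure_bounded_finite)
  have m: "emeasure lborel \<Omega> = ennreal m" "m \<ge> 0"
    using mfin by (auto simp: m_def emeasure_eq_ennreal_measure less_top)
  have [measurable]: "\<Omega> \<in> sets borel" using \<Omega> by simp
  \<comment> \<open>Small enough that replacing all ball indicators by test functions costs at most
    half of the squared L2 norm; the summand 1 keeps the denominator positive.\<close>
  define \<eta> where "\<eta> = 1 / (2 * (4 * m / b\<^sup>2 * real (card I) + 1))"
  have nn: "0 \<le> 4 * m / b\<^sup>2 * real (card I)" using m by simp
  then have \<eta>: "\<eta> > 0" by (simp add: \<eta>_def)
  have \<eta>': "4 * m / b\<^sup>2 * real (card I) * \<eta> \<le> 1 / 2"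
  proof -
    have "t * (1 / (2 * (t + 1))) \<le> 1 / 2" if "0 \<le> t" for t :: real
      using that by (simp add: divide_le_eq)
    from this[OF nn] show ?thesis unfolding \<eta>_def .
  qed
  have "\<exists>\<psi>. \<psi> \<in> X_space s \<Omega> \<and> (LBINT x. (indicator (ball i \<delta> \<inter> \<Omega>) x - \<psi> x)\<^sup>2) < \<eta>" for i
  proof -
    have U: "open (ball i \<delta> \<inter> \<Omega>)" "bounded (ball i \<delta> \<inter> \<Omega>)" "ball i \<delta> \<inter> \<Omega> \<subseteq> \<Omega>"
      using \<Omega> by auto
    show ?thesis by (rule X_space_approx_indicator[OF s U \<eta>]) blast
  qed
  then obtain \<psi> where \<psi>: "\<And>i. \<psi> i \<in> X_space s \<Omega>"
    "\<And>i. (LBINT x. (indicator (ball i \<delta> \<inter> \<Omega>) x - \<psi> i x)\<^sup>2) < \<eta>" by metis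
  \<comment> \<open>Twice the constant \<open>4 * m / b^2\<close> of the estimate below, because
    half of the left-hand side is absorbed.\<close>
  define K where "K = 8 * m / b\<^sup>2"
  have "(LBINT x. (v x)\<^sup>2) \<le> e * (X_norm a v)\<^sup>2 + K * (\<Sum>i\<in>I. (LBINT x. v x * \<psi> i x)\<^sup>2)"
    if v: "v \<in> X_space a \<Omega>" for v
  proof -
    note v2 = X_space_sq_integrable[OF v]
    note [measurable] = X_space_measurable[OF v]
    have gm [measurable]: "gagliardo a v \<in> borel_measurable lborel2" by (rule measurable_gagliardo) simp
    define J where "J = (\<integral>p. (gagliardo a v p)\<^sup>2 \<partial>lborel2)"
    have J0: "J \<ge> 0" by (simp add: J_def)
    have XJ: "(X_norm a v)\<^sup>2 = c * J"
      unfolding X_norm_square[OF a] frac_form_eq c_def J_def by (simp add: power2_eq_square)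
    define D where "D = (2 * \<delta>) powr p / b"
    have D: "D \<ge> 0" using b by (simp add: D_def)
    define A where "A i = (LBINT y. v y * indicator (ball i \<delta>) y) / b" for i
    have "(\<integral>\<^sup>+x. ennreal ((v x)\<^sup>2) \<partial>lborel) \<le>
        (\<integral>\<^sup>+x. ennreal (2 * D) * (\<integral>\<^sup>+y. ennreal ((gagliardo a v (x, y))\<^sup>2) \<partial>lborel) +
          ennreal (2 * (\<Sum>i\<in>I. (A i)\<^sup>2)) * indicator \<Omega> x \<partial>lborel)"
    proof (rule nn_integral_mono_AE)
      show "AE x in lborel. ennreal ((v x)\<^sup>2) \<le>
          ennreal (2 * D) * (\<integral>\<^sup>+y. ennreal ((gagliardo a v (x, y))\<^sup>2) \<partial>lborel) +
          ennreal (2 * (\<Sum>i\<in>I. (A i)\<^sup>2)) * indicator \<Omega> x"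
        using X_space_AE_zero[OF v]
      proof eventually_elim
        case (elim x)
        show ?case
        proof (cases "x \<in> \<Omega>")
          case True
          then obtain i where i: "i \<in> I" "x \<in> ball i \<delta>" using cover by blast
          have "ennreal ((v x)\<^sup>2) \<le> ennreal (2 * D) * (\<integral>\<^sup>+y. ennreal ((gagliardo a v (x, y))\<^sup>2) \<partial>lborel) +
              ennreal (2 * (A i)\<^sup>2)"
            using ball_average_estimate[OF a(1) v2 \<delta> i(2)] by (simp add: ball D_def p_def N_def A_def)
          also have "\<dots> \<le> ennreal (2 * D) * (\<integral>\<^sup>+y. ennreal ((gagliardo a v (x, y))\<^sup>2) \<partial>lborel) +
              ennreal (2 * (\<Sum>i\<in>I. (A i)\<^sup>2))"
            using member_le_sum[of i I "\<lambda>i. (A i)\<^sup>2"] i I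
            by (intro add_left_mono ennreal_leI mult_left_mono) auto
          finally show ?thesis using True by simp
        qed (use elim in simp)
      qed
    qed
    also have "\<dots> = ennreal (2 * D) * (\<integral>\<^sup>+x. \<integral>\<^sup>+y. ennreal ((gagliardo a v (x, y))\<^sup>2) \<partial>lborel \<partial>lborel) +
        ennreal (2 * (\<Sum>i\<in>I. (A i)\<^sup>2)) * ennreal m"
      by (subst nn_integral_add) (auto simp: nn_integral_cmult nn_integral_cmult_indicator m)
    also have "(\<integral>\<^sup>+x. \<integral>\<^sup>+y. ennreal ((gagliardo a v (x, y))\<^sup>2) \<partial>lborel \<partial>lborel) =
        (\<integral>\<^sup>+p. ennreal ((gagliardo a v p)\<^sup>2) \<partial>lborel2)"
      by (rule lborel.nn_integral_fst) measurable
    also have "\<dots> = ennreal J"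
      unfolding J_def using X_space_gagliardo[OF v]
      by (intro nn_integral_eq_integral) (auto simp: sq_integrable_def)
    also have "(\<integral>\<^sup>+x. ennreal ((v x)\<^sup>2) \<partial>lborel) = ennreal (LBINT x. (v x)\<^sup>2)"
      using v2 by (intro nn_integral_eq_integral) (auto simp: sq_integrable_def)
    also have "ennreal (2 * D) * ennreal J + ennreal (2 * (\<Sum>i\<in>I. (A i)\<^sup>2)) * ennreal m =
        ennreal (2 * D * J + 2 * (\<Sum>i\<in>I. (A i)\<^sup>2) * m)"
      using D J0 m by (simp add: sum_nonneg ennreal_plus flip: ennreal_mult)
    finally have 1: "(LBINT x. (v x)\<^sup>2) \<le> 2 * D * J + 2 * (\<Sum>i\<in>I. (A i)\<^sup>2) * m"
      using D J0 m by (subst (asm) ennreal_le_iff) (auto intro!: add_nonneg_nonneg mult_nonneg_nonneg sum_nonneg)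
    define Q where "Q = (LBINT x. (v x)\<^sup>2)"
    have Q: "Q \<ge> 0" by (simp add: Q_def)
    have "(A i)\<^sup>2 \<le> (2 * (LBINT x. v x * \<psi> i x)\<^sup>2 + 2 * (\<eta> * Q)) / b\<^sup>2" for i
    proof -
      define U where "U = ball i \<delta> \<inter> \<Omega>"
      have [measurable]: "U \<in> sets borel" by (simp add: U_def \<Omega>)
      have Ufin: "emeasure lborel U < \<infinity>" unfolding U_def using \<Omega>(2)
        by (intro emeasure_bounded_finite bounded_subset[OF \<Omega>(2)]) auto
      \<comment> \<open>\<open>v\<close> vanishes outside \<Omega>, so the ball may be cut down to
        its part in \<Omega>, whose indicator is the one approximated by
        \<open>\<psi> i\<close>.\<close>
      have "(LBINT y. v y * indicator (ball i \<delta>) y) = (LBINT y. v y * indicator U y)"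
        using X_space_AE_zero[OF v]
        by (intro integral_cong_AE) (auto simp: U_def indicator_def elim!: eventually_mono)
      moreover have "(LBINT y. v y * indicator U y)\<^sup>2 \<le>
          2 * (LBINT x. v x * \<psi> i x)\<^sup>2 + 2 * (\<eta> * Q)"
        unfolding Q_def
      proof (rule sq_integrable_integral_square_le[OF v2 _ X_space_sq_integrable[OF \<psi>(1)]])
        show "sq_integrable lborel (indicat_real U)" using Ufin by (intro sq_integrable_indicator) auto
        show "(LBINT x. (indicator U x - \<psi> i x)\<^sup>2) \<le> \<eta>" using \<psi>(2)[of i] by (simp add: U_def)
      qed
      ultimately show ?thesis by (simp add: A_def power_divide divide_right_mono)
    qed
    then have "(\<Sum>i\<in>I. (A i)\<^sup>2) \<le> (\<Sum>i\<in>I. (2 * (LBINT x. v x * \<psi> i x)\<^sup>2 + 2 * (\<eta> * Q)) / b\<^sup>2)"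
      by (intro sum_mono)
    also have "\<dots> = (2 * (\<Sum>i\<in>I. (LBINT x. v x * \<psi> i x)\<^sup>2) + 2 * (\<eta> * Q) * real (card I)) / b\<^sup>2"
      by (simp add: sum_divide_distrib[symmetric] sum.distrib sum_distrib_left)
    finally have "2 * (\<Sum>i\<in>I. (A i)\<^sup>2) * m \<le>
        2 * ((2 * (\<Sum>i\<in>I. (LBINT x. v x * \<psi> i x)\<^sup>2) + 2 * (\<eta> * Q) * real (card I)) / b\<^sup>2) * m"
      using m by (intro mult_right_mono mult_left_mono) auto
    also have "\<dots> = K / 2 * (\<Sum>i\<in>I. (LBINT x. v x * \<psi> i x)\<^sup>2) + (4 * m / b\<^sup>2 * real (card I) * \<eta>) * Q"
      by (simp add: K_def algebra_simps add_divide_distrib)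
    also have "\<dots> \<le> K / 2 * (\<Sum>i\<in>I. (LBINT x. v x * \<psi> i x)\<^sup>2) + 1 / 2 * Q"
      using Q \<eta>' by (intro add_left_mono mult_right_mono) auto
    finally have "Q \<le> 4 * D * J + K * (\<Sum>i\<in>I. (LBINT x. v x * \<psi> i x)\<^sup>2)"
      using 1 unfolding Q_def by linarith
    moreover have "4 * D = e * c"
      using De c unfolding D_def[symmetric] by (simp add: divide_eq_eq)
    then have "4 * D * J = e * (X_norm a v)\<^sup>2" by (simp add: XJ)
    ultimately show ?thesis by (simp add: Q_def)
  qed
  moreover have "K \<ge> 0" using m by (simp add: K_def)
  ultimately show ?thesis using that[of I \<psi> K] I(1) \<psi>(1) by blast
qed

section \<open>Rellich compactness from the Ehrling inequality\<close>

lemma finite_bounded_sequences_subseq: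
  fixes f :: "'i \<Rightarrow> nat \<Rightarrow> real"
  assumes "finite I" "\<And>i. i \<in> I \<Longrightarrow> bounded (range (f i))"
  shows "\<exists>r. strict_mono r \<and> (\<forall>i\<in>I. convergent (f i \<circ> r))"
  using assms
proof (induction I rule: finite_induct)
  case empty
  then show ?case by (intro exI[of _ id]) (auto simp: strict_mono_def)
next
  case (insert i I)
  then obtain r where r: "strict_mono r" "\<forall>i\<in>I. convergent (f i \<circ> r)"
    by (metis insertCI)
  have "bounded (range (f i \<circ> r))"
    using insert.prems[of i] by (auto intro: bounded_subset)
  then obtain l q where q: "strict_mono q" "((f i \<circ> r) \<circ> q) \<longlonglongrightarrow> l"
    using bounded_imp_convergent_subsequence by blast
  have "convergent (f j \<circ> (r \<circ> q))" if "j \<in> insert i I" for j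
    using that r(2) q convergent_subseq_convergent[OF _ q(1), of "f j \<circ> r"]
    by (auto simp: convergent_def o_assoc)
  then show ?case using strict_mono_o[OF r(1) q(1)] by blast
qed

text \<open>For each accuracy the Ehrling inequality leaves only finitely many bounded real
  sequences, which a subsequence makes convergent; a diagonal sequence then serves all
  accuracies.\<close>

lemma X_space_compact:
  fixes \<Omega> :: "(real ^ 'n) set" and v :: "nat \<Rightarrow> real ^ 'n \<Rightarrow> real"
  assumes a: "0 < a" "a < 1" and \<Omega>: "open \<Omega>" "bounded \<Omega>"
    and v: "\<And>n. v n \<in> X_space a \<Omega>" and B: "\<And>n. X_norm a (v n) \<le> B"
  obtains r :: "nat \<Rightarrow> nat" where "strict_mono r"
    "\<And>e. e > 0 \<Longrightarrow> \<exists>N. \<forall>i\<ge>N. \<forall>j\<ge>N. (LBINT x. (v (r i) x - v (r j) x)\<^sup>2) < e"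
proof -
  define \<epsilon> where "\<epsilon> k = 1 / (real k + 1)" for k
  have \<epsilon>: "\<epsilon> k > 0" for k by (simp add: \<epsilon>_def)
  have B0: "B \<ge> 0" using X_norm_nonneg[OF a, of "v 0"] B[of 0] by linarith
  \<comment> \<open>\<open>4 * B^2\<close> bounds the squared energy norm of a difference, one unit
    pays for the functionals, and one makes the inequality strict.\<close>
  define C where "C = 4 * B\<^sup>2 + 2"
  define P where "P k s \<longleftrightarrow> (\<exists>M. \<forall>i\<ge>M. \<forall>j\<ge>M. (LBINT x. (v (s i) x - v (s j) x)\<^sup>2) < C * \<epsilon> k)"
    for k and s :: "nat \<Rightarrow> nat"
  have dB: "(X_norm a (\<lambda>x. v i x - v j x))\<^sup>2 \<le> 4 * B\<^sup>2" for i j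
  proof -
    have "X_norm a (\<lambda>x. v i x - v j x) \<le> X_norm a (v i) + X_norm a (v j)"
      using X_norm_triangle[OF a v[of i] X_space_cmult[OF v[of j], of "-1"]] X_norm_cmult[OF a, of "-1" "v j"] by simp
    then have "X_norm a (\<lambda>x. v i x - v j x) \<le> 2 * B" using B[of i] B[of j] by simp
    then have "(X_norm a (\<lambda>x. v i x - v j x))\<^sup>2 \<le> (2 * B)\<^sup>2" by (intro power_mono X_norm_nonneg[OF a])
    then show ?thesis by simp
  qed
  obtain Pc where Pc: "Pc > 0" "\<And>v. v \<in> X_space a \<Omega> \<Longrightarrow> (LBINT x. (v x)\<^sup>2) \<le> Pc * (X_norm a v)\<^sup>2"
    by (rule X_space_Poincare[OF a \<Omega>(2)]) (rule that)
  have v2: "(LBINT x. (v n x)\<^sup>2) \<le> Pc * B\<^sup>2" for n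
  proof -
    have "Pc * (X_norm a (v n))\<^sup>2 \<le> Pc * B\<^sup>2"
      using Pc(1) by (intro mult_left_mono power_mono B X_norm_nonneg[OF a]) auto
    then show ?thesis using Pc(2)[OF v[of n]] by linarith
  qed
  interpret subseqs P
  proof
    fix k and s :: "nat \<Rightarrow> nat" assume s: "strict_mono s"
    obtain I :: "(real ^ 'n) set" and \<psi> K where E: "finite I" "\<And>i. i \<in> I \<Longrightarrow> \<psi> i \<in> X_space a \<Omega>" "K \<ge> 0"
      "\<And>v. v \<in> X_space a \<Omega> \<Longrightarrow> (LBINT x. (v x)\<^sup>2) \<le>
        \<epsilon> k * (X_norm a v)\<^sup>2 + K * (\<Sum>i\<in>I. (LBINT x. v x * \<psi> i x)\<^sup>2)"
      by (rule X_space_Ehrling[OF a a \<Omega> \<epsilon>[of k]]) (rule that)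
    define f where "f i n = (LBINT x. v (s n) x * \<psi> i x)" for i n
    have "bounded (range (f i))" if i: "i \<in> I" for i
    proof -
      have "\<bar>f i n\<bar> \<le> sqrt (Pc * B\<^sup>2) * sqrt (LBINT x. (\<psi> i x)\<^sup>2)" for n
      proof -
        have "\<bar>f i n\<bar> \<le> sqrt (LBINT x. (v (s n) x)\<^sup>2) * sqrt (LBINT x. (\<psi> i x)\<^sup>2)"
          unfolding f_def by (intro sq_integrable_Cauchy_Schwarz_abs X_space_sq_integrable[OF v]
            X_space_sq_integrable[OF E(2)[OF i]])
        also have "\<dots> \<le> sqrt (Pc * B\<^sup>2) * sqrt (LBINT x. (\<psi> i x)\<^sup>2)"
          by (intro mult_right_mono real_sqrt_le_mono v2) simp
        finally show ?thesis .
      qed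
      then show ?thesis by (auto simp: bounded_iff)
    qed
    from finite_bounded_sequences_subseq[of I f, OF E(1) this] obtain r where
      r: "strict_mono r" "\<And>i. i \<in> I \<Longrightarrow> convergent (f i \<circ> r)" by blast
    \<comment> \<open>Makes the functionals contribute at most \<open>\<epsilon> k\<close> in total;
      the added units keep the denominator positive.\<close>
    define \<eta> where "\<eta> = \<epsilon> k / ((K + 1) * (real (card I) + 1))"
    have \<eta>: "\<eta> > 0" using \<epsilon>[of k] E(3) by (simp add: \<eta>_def)
    have "\<exists>M. \<forall>m\<ge>M. \<forall>n\<ge>M. (f i (r m) - f i (r n))\<^sup>2 < \<eta>" if "i \<in> I" for i
    proof -
      have "Cauchy (f i \<circ> r)" using r(2)[OF that] by (rule convergent_Cauchy)
      from CauchyD[OF this, of "sqrt \<eta>"] \<eta> obtain M where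
        M: "\<And>m n. m \<ge> M \<Longrightarrow> n \<ge> M \<Longrightarrow> \<bar>f i (r m) - f i (r n)\<bar> < sqrt \<eta>" by auto
      have "(f i (r m) - f i (r n))\<^sup>2 < \<eta>" if "m \<ge> M" "n \<ge> M" for m n
        using power_strict_mono[OF M[OF that], of 2] \<eta> by simp
      then show ?thesis by blast
    qed
    then obtain M where M: "\<And>i m n. i \<in> I \<Longrightarrow> m \<ge> M i \<Longrightarrow> n \<ge> M i \<Longrightarrow> (f i (r m) - f i (r n))\<^sup>2 < \<eta>"
      by metis
    \<comment> \<open>The sum of the \<open>M i\<close> serves as a common bound, also for an empty
      index set.\<close>
    have "P k (s \<circ> r)"
      unfolding P_def
    proof (intro exI[of _ "\<Sum>i\<in>I. M i"] allI impI)
      fix m n assume mn: "(\<Sum>i\<in>I. M i) \<le> m" "(\<Sum>i\<in>I. M i) \<le> n"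
      define d where "d x = v (s (r m)) x - v (s (r n)) x" for x
      have d: "d \<in> X_space a \<Omega>" unfolding d_def by (intro X_space_diff v)
      have "(LBINT x. d x * \<psi> i x)\<^sup>2 \<le> \<eta>" if i: "i \<in> I" for i
      proof -
        have "M i \<le> (\<Sum>i\<in>I. M i)" using i E(1) by (intro member_le_sum) auto
        then have "(f i (r m) - f i (r n))\<^sup>2 < \<eta>" using M[OF i, of m n] mn by simp
        moreover have "(LBINT x. d x * \<psi> i x) = f i (r m) - f i (r n)"
          using sq_integrable_mult_integrable[OF X_space_sq_integrable[OF v] X_space_sq_integrable[OF E(2)[OF i]]]
          by (simp add: f_def d_def left_diff_distrib)
        ultimately show ?thesis by simp
      qed
      then have "(\<Sum>i\<in>I. (LBINT x. d x * \<psi> i x)\<^sup>2) \<le> real (card I) * \<eta>"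
        by (rule sum_bounded_above)
      then have "K * (\<Sum>i\<in>I. (LBINT x. d x * \<psi> i x)\<^sup>2) \<le> K * (real (card I) * \<eta>)"
        by (intro mult_left_mono E)
      also have "\<dots> \<le> (K + 1) * ((real (card I) + 1) * \<eta>)"
        using E(3) \<eta> by (intro mult_mono) auto
      also have "\<dots> = \<epsilon> k" using E(3) by (simp add: \<eta>_def)
      finally have *: "K * (\<Sum>i\<in>I. (LBINT x. d x * \<psi> i x)\<^sup>2) \<le> \<epsilon> k" .
      have "(LBINT x. (d x)\<^sup>2) \<le> \<epsilon> k * (4 * B\<^sup>2) + \<epsilon> k"
      proof -
        have "(X_norm a d)\<^sup>2 \<le> 4 * B\<^sup>2"
          using dB[of "s (r m)" "s (r n)"] by (simp add: d_def[abs_def])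
        then have "\<epsilon> k * (X_norm a d)\<^sup>2 \<le> \<epsilon> k * (4 * B\<^sup>2)"
          using \<epsilon>[of k] by (intro mult_left_mono) auto
        with * E(4)[OF d] show ?thesis by linarith
      qed
      also have "\<dots> < C * \<epsilon> k" using \<epsilon>[of k] by (simp add: C_def algebra_simps)
      finally show "(LBINT x. (v ((s \<circ> r) m) x - v ((s \<circ> r) n) x)\<^sup>2) < C * \<epsilon> k" by (simp add: d_def)
    qed
    then show "\<exists>r'. strict_mono r' \<and> P k (s \<circ> r')" using r(1) by blast
  qed
  \<comment> \<open>The property concerns tails only and so passes to subsequences; from index
    \<open>Suc k\<close> on, the diagonal sequence is a subsequence of the one selected for accuracy
    \<open>\<epsilon> k\<close>.\<close>
  have D: "P k (diagseq \<circ> (+) (Suc k))" for k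
  proof (rule diagseq_holds)
    fix r s :: "nat \<Rightarrow> nat" and n assume r: "strict_mono r" and "P n s"
    then obtain M where M: "\<And>i j. i \<ge> M \<Longrightarrow> j \<ge> M \<Longrightarrow> (LBINT x. (v (s i) x - v (s j) x)\<^sup>2) < C * \<epsilon> n"
      unfolding P_def by blast
    have "r i \<ge> M" if "i \<ge> M" for i using seq_suble[OF r, of i] that by simp
    then show "P n (s \<circ> r)" unfolding P_def using M by (intro exI[of _ M]) simp
  qed
  show ?thesis
  proof (rule that[OF subseq_diagseq])
    fix e :: real assume e: "e > 0"
    have C: "C > 0" by (simp add: C_def add_nonneg_pos)
    obtain k :: nat where k: "C / e < real k" using reals_Archimedean2 by blast
    have "C * \<epsilon> k < e"
    proof -
      have "C < e * (real k + 1)" using k e by (simp add: field_simps)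
      then show ?thesis by (simp add: \<epsilon>_def field_simps)
    qed
    moreover obtain M where M: "\<And>i j. i \<ge> M \<Longrightarrow> j \<ge> M \<Longrightarrow>
        (LBINT x. (v (diagseq (Suc k + i)) x - v (diagseq (Suc k + j)) x)\<^sup>2) < C * \<epsilon> k"
      using D[of k] unfolding P_def by auto
    have "(LBINT x. (v (diagseq i) x - v (diagseq j) x)\<^sup>2) < C * \<epsilon> k"
      if "i \<ge> Suc k + M" "j \<ge> Suc k + M" for i j
      using M[of "i - Suc k" "j - Suc k"] that by simp
    ultimately show "\<exists>N. \<forall>i\<ge>N. \<forall>j\<ge>N. (LBINT x. (v (diagseq i) x - v (diagseq j) x)\<^sup>2) < e"
      by (intro exI[of _ "Suc k + M"]) (auto intro: less_trans)
  qed
qed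

section \<open>Distributional derivatives in time\<close>

text \<open>\<open>Ck_on\<close> asks for Frechet derivatives in every direction. On the line one
  explicit derivative is enough, and this form is closed under sums and products by a plain
  induction; \<open>k_times_differentiable_imp_Ck_on\<close> converts it back.\<close>

primrec k_times_differentiable :: "nat \<Rightarrow> (real \<Rightarrow> real) \<Rightarrow> bool" where
  "k_times_differentiable 0 f \<longleftrightarrow> continuous_on UNIV f"
| "k_times_differentiable (Suc k) f \<longleftrightarrow>
     (\<exists>f'. (\<forall>x. (f has_real_derivative f' x) (at x)) \<and> k_times_differentiable k f')"

lemma k_times_differentiable_Suc_imp:
  "k_times_differentiable (Suc k) f \<Longrightarrow> k_times_differentiable k f"
proof (induction k arbitrary: f)
  case 0
  then obtain f' where "\<And>x. (f has_real_derivative f' x) (at x)" by auto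
  then have "isCont f x" for x by (rule DERIV_isCont)
  then show ?case by (simp add: continuous_at_imp_continuous_on)
next
  case (Suc k)
  then show ?case by (metis k_times_differentiable.simps(2))
qed

lemma k_times_differentiable_const: "k_times_differentiable k (\<lambda>x. c)"
  by (induction k arbitrary: c) (auto intro!: exI[of _ "\<lambda>x. 0"])

lemma k_times_differentiable_add:
  "k_times_differentiable k f \<Longrightarrow> k_times_differentiable k h \<Longrightarrow> k_times_differentiable k (\<lambda>x. f x + h x)"
proof (induction k arbitrary: f h)
  case (Suc k)
  then obtain f' h' where "\<And>x. (f has_real_derivative f' x) (at x)" "k_times_differentiable k f'"
    "\<And>x. (h has_real_derivative h' x) (at x)" "k_times_differentiable k h'" by auto
  then show ?case using Suc.IH by (auto intro!: exI[of _ "\<lambda>x. f' x + h' x"] DERIV_add)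
qed (auto intro: continuous_on_add)

lemma k_times_differentiable_mult:
  "k_times_differentiable k f \<Longrightarrow> k_times_differentiable k h \<Longrightarrow> k_times_differentiable k (\<lambda>x. f x * h x)"
proof (induction k arbitrary: f h)
  case (Suc k)
  then obtain f' h' where d: "\<And>x. (f has_real_derivative f' x) (at x)" "k_times_differentiable k f'"
    "\<And>x. (h has_real_derivative h' x) (at x)" "k_times_differentiable k h'" by auto
  have "((\<lambda>x. f x * h x) has_real_derivative f' x * h x + h' x * f x) (at x)" for x
    using DERIV_mult[OF d(1)[of x] d(3)[of x]] .
  moreover have "k_times_differentiable k (\<lambda>x. f' x * h x + h' x * f x)"
    using Suc.IH d(2,4) Suc.prems[THEN k_times_differentiable_Suc_imp]
    by (intro k_times_differentiable_add) auto
  ultimately show ?case unfolding k_times_differentiable.simps by (intro exI conjI allI)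
qed (auto intro: continuous_on_mult)

lemma k_times_differentiable_imp_Ck_on: "k_times_differentiable k f \<Longrightarrow> Ck_on k f UNIV"
proof (induction k arbitrary: f)
  case (Suc k)
  then obtain f' where f': "\<And>x. (f has_real_derivative f' x) (at x)" "k_times_differentiable k f'" by auto
  have "frechet_derivative f (at x) h = f' x * h" for x h
    using frechet_derivative_at[OF f'(1)[of x, unfolded has_field_derivative_def]] by (metis mult.commute)
  moreover have "f differentiable at x" for x
    using f'(1)[of x] real_differentiable_def by blast
  moreover have "Ck_on k (\<lambda>x. f' x * h) UNIV" for h
    by (intro Suc.IH k_times_differentiable_mult f' k_times_differentiable_const)
  ultimately show ?case by simp
qed simp

text \<open>Up to linear combinations this family is closed under differentiation, so the smoothness
  of the classical flat function, the case \<open>m = 0\<close>, becomes an induction over all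
  \<open>m\<close> at once.\<close>

definition flat_function :: "nat \<Rightarrow> real \<Rightarrow> real" where
  "flat_function m y = (if y \<le> 0 then 0 else exp (- (1 / y)) * (1 / y) ^ m)"

text \<open>The exponential beats every power of \<open>1 / y\<close>; a quadratic bound is chosen
  so that the difference quotient at 0 tends to 0.\<close>

lemma flat_function_bound: "\<bar>flat_function m y\<bar> \<le> real (m + 2) ^ (m + 2) * y\<^sup>2"
proof (cases "y \<le> 0")
  case False
  \<comment> \<open>Two powers more than \<open>m\<close>; they become the factor
    \<open>y^2\<close>.\<close>
  define n where "n = m + 2"
  have y: "y > 0" using False by simp
  \<comment> \<open>The inequality \<open>x \<le> exp x\<close> at \<open>x = 1 / y / n\<close>,
    raised to the power \<open>n\<close>.\<close>
  have "(1 / y / n) ^ n \<le> exp (1 / y / n) ^ n"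
    using y by (intro power_mono) (auto intro: less_imp_le[OF exp_gt_self] order_trans[OF _ exp_ge_add_one_self])
  also have "\<dots> = exp (1 / y)" 
    unfolding exp_of_nat_mult[symmetric] by (simp add: n_def)
  finally have *: "(1 / y / n) ^ n \<le> exp (1 / y)" .
  have "(1 / y) ^ n = (real n * (1 / y / n)) ^ n" by (simp add: n_def)
  also have "\<dots> = real n ^ n * (1 / y / n) ^ n" by (rule power_mult_distrib)
  also have "\<dots> \<le> real n ^ n * exp (1 / y)" by (intro mult_left_mono *) simp
  finally have "(1 / y) ^ n \<le> real n ^ n * exp (1 / y)" .
  then have "(1 / y) ^ n * exp (- (1 / y)) \<le> real n ^ n * exp (1 / y) * exp (- (1 / y))"
    by (intro mult_right_mono) auto
  also have "\<dots> = real n ^ n" by (simp add: mult.assoc flip: exp_add)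
  finally have "(1 / y) ^ n * exp (- (1 / y)) * y\<^sup>2 \<le> real n ^ n * y\<^sup>2"
    by (intro mult_right_mono) auto
  moreover have "(1 / y) ^ n * y\<^sup>2 = (1 / y) ^ m" using y by (simp add: n_def power_add power_divide power2_eq_square)
  moreover have "\<bar>flat_function m y\<bar> = (1 / y) ^ m * exp (- (1 / y))"
    using y by (simp add: flat_function_def abs_mult)
  ultimately show ?thesis unfolding n_def by (metis mult.assoc mult.commute)
qed (simp add: flat_function_def)

lemma flat_function_has_derivative:
  "(flat_function m has_real_derivative
     flat_function (m + 2) y + (- real m) * flat_function (m + 1) y) (at y)"
proof -
  consider "y < 0" | "y = 0" | "y > 0" by linarith
  then show ?thesis
  proof cases
    case 1
    have "(flat_function m has_real_derivative 0) (at y)"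
      by (rule has_field_derivative_transform_within_open[of "\<lambda>x. 0" _ _ "{..<0}"])
        (use 1 in \<open>auto simp: flat_function_def\<close>)
    then show ?thesis using 1 by (simp add: flat_function_def)
  next
    case 2
    define C where "C = real (m + 2) ^ (m + 2)"
    have "((\<lambda>h. (flat_function m (0 + h) - flat_function m 0) / h) \<longlongrightarrow> 0) (at 0)"
    proof (rule Lim_null_comparison)
      show "\<forall>\<^sub>F h in at 0. norm ((flat_function m (0 + h) - flat_function m 0) / h) \<le> C * \<bar>h\<bar>"
      proof (rule always_eventually, rule allI)
        fix h :: real
        show "norm ((flat_function m (0 + h) - flat_function m 0) / h) \<le> C * \<bar>h\<bar>"
        proof (cases "h = 0")
          case False
          have "\<bar>flat_function m h\<bar> / \<bar>h\<bar> \<le> C * h\<^sup>2 / \<bar>h\<bar>"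
            by (intro divide_right_mono flat_function_bound[of m h, folded C_def]) simp
          also have "C * h\<^sup>2 / \<bar>h\<bar> = C * \<bar>h\<bar>" using False by (simp add: power2_eq_square abs_if)
          finally show ?thesis by (simp add: flat_function_def)
        qed simp
      qed
      show "((\<lambda>h. C * \<bar>h\<bar>) \<longlongrightarrow> 0) (at 0)"
        by (rule tendsto_eq_intros refl | simp)+
    qed
    then have "(flat_function m has_real_derivative 0) (at 0)" by (simp add: DERIV_def)
    then show ?thesis using 2 by (simp add: flat_function_def)
  next
    case 3
    have "((\<lambda>y. exp (- (1 / y)) * (1 / y) ^ m) has_real_derivative
        exp (- (1 / y)) * (1 / y) ^ (m + 2) + (- real m) * (exp (- (1 / y)) * (1 / y) ^ (m + 1))) (at y)"
    proof -
      have D: "((\<lambda>y. 1 / y) has_real_derivative - ((1 / y)\<^sup>2)) (at y)"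
        using 3 by (auto intro!: derivative_eq_intros simp: power2_eq_square)
      have E: "((\<lambda>y. exp (- (1 / y))) has_real_derivative exp (- (1 / y)) * (1 / y)\<^sup>2) (at y)"
        by (rule derivative_eq_intros D refl)+ simp
      have P: "((\<lambda>y. (1 / y) ^ m) has_real_derivative (- real m) * (1 / y) ^ (m + 1)) (at y)"
        by (rule DERIV_cong[OF DERIV_power[OF D, of m]]) (cases m; simp add: power2_eq_square algebra_simps add_divide_distrib diff_divide_distrib)
      show ?thesis using DERIV_mult[OF E P] by (simp add: power_add power2_eq_square mult_ac)
    qed
    then have "(flat_function m has_real_derivative
        exp (- (1 / y)) * (1 / y) ^ (m + 2) + (- real m) * (exp (- (1 / y)) * (1 / y) ^ (m + 1))) (at y)"
      by (rule has_field_derivative_transform_within_open[of _ _ _ "{0<..}"])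
        (use 3 in \<open>auto simp: flat_function_def\<close>)
    then show ?thesis using 3 by (simp add: flat_function_def)
  qed
qed

text \<open>For \<open>a < b\<close> the quadratic is positive exactly between \<open>a\<close> and
  \<open>b\<close>, so the composition is a smooth bump there. All \<open>m\<close> are treated
  together because differentiation raises \<open>m\<close>.\<close>

lemma flat_bump_k_times_differentiable:
  "k_times_differentiable k (\<lambda>x. flat_function m ((x - a) * (b - x)))"
proof (induction k arbitrary: m)
  case 0
  have "isCont (flat_function m) y" for y using flat_function_has_derivative by (rule DERIV_isCont)
  then have "continuous_on UNIV (flat_function m)" by (simp add: continuous_at_imp_continuous_on)
  then show ?case
    by (auto intro!: continuous_on_compose2[of UNIV "flat_function m"] continuous_intros)
next
  case (Suc k)
  let ?q = "\<lambda>x. (x - a) * (b - x)"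
  have "((\<lambda>x. flat_function m (?q x)) has_real_derivative
      (flat_function (m + 2) (?q x) + (- real m) * flat_function (m + 1) (?q x)) * (a + b + (-2) * x)) (at x)" for x
    by (rule DERIV_chain2[OF flat_function_has_derivative]) (auto intro!: derivative_eq_intros)
  moreover have "k_times_differentiable k (\<lambda>x::real. x)"
  proof (cases k)
    case (Suc j)
    then show ?thesis by (auto intro!: exI[of _ "\<lambda>x. 1"] k_times_differentiable_const)
  qed simp
  then have "k_times_differentiable k (\<lambda>x. (flat_function (m + 2) (?q x) +
      (- real m) * flat_function (m + 1) (?q x)) * (a + b + (-2) * x))"
    by (intro k_times_differentiable_mult k_times_differentiable_add k_times_differentiable_const Suc.IH)
  ultimately show ?case unfolding k_times_differentiable.simps by (intro exI conjI allI)
qed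

text \<open>A normalised primitive of the bump. The step builds cutoff functions, and its derivative
  is an averaging kernel concentrated on \<open>[a, b]\<close>.\<close>

lemma smooth_step_exists:
  fixes a b :: real
  assumes "a < b"
  obtains \<theta> \<theta>' where "\<And>k. k_times_differentiable k \<theta>" "\<And>x. (\<theta> has_real_derivative \<theta>' x) (at x)"
    "continuous_on UNIV \<theta>'" "\<And>x. 0 \<le> \<theta>' x" "\<And>x. x \<notin> {a..b} \<Longrightarrow> \<theta>' x = 0"
    "\<And>x. x \<le> a \<Longrightarrow> \<theta> x = 0" "\<And>x. b \<le> x \<Longrightarrow> \<theta> x = 1" "\<And>x. 0 \<le> \<theta> x" "\<And>x. \<theta> x \<le> 1"
proof -
  define B where "B x = flat_function 0 ((x - a) * (b - x))" for x
  have Bk: "k_times_differentiable k B" for k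
    unfolding B_def by (rule flat_bump_k_times_differentiable)
  have Bcont: "continuous_on UNIV B" using Bk[of 0] by simp
  have B0: "0 \<le> B x" for x by (simp add: B_def flat_function_def)
  have Bpos: "0 < B x" if "a < x" "x < b" for x using that by (simp add: B_def flat_function_def not_le)
  have Bout: "B x = 0" if "x \<le> a \<or> b \<le> x" for x
    using that assms by (auto simp: B_def flat_function_def mult_le_0_iff)
  have "isCont B x" for x using Bcont by (simp add: continuous_on_eq_continuous_at)
  then obtain S where "\<And>x. (S has_vector_derivative B x) (at x)"
    using einterval_antiderivative[of "-\<infinity>" "\<infinity>" B] by auto
  then have S: "(S has_real_derivative B x) (at x)" for x
    by (simp add: has_real_derivative_iff_has_vector_derivative)
  have mono: "S x \<le> S y" if "x \<le> y" for x y
    using S B0 by (intro DERIV_nonneg_imp_nondecreasing[OF that]) auto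
  have left: "S x = S a" if "x \<le> a" for x
  proof (cases "x < a")
    case True
    obtain z where "x < z" "z < a" "S a - S x = (a - x) * B z" using MVT2[OF True S] by auto
    then show ?thesis using Bout[of z] by simp
  qed (use that in simp)
  have right: "S x = S b" if "b \<le> x" for x
  proof (cases "b < x")
    case True
    obtain z where "b < z" "z < x" "S x - S b = (x - b) * B z" using MVT2[OF True S] by auto
    then show ?thesis using Bout[of z] by simp
  qed (use that in simp)
  obtain z where "a < z" "z < b" "S b - S a = (b - a) * B z" using MVT2[OF assms S] by auto
  then have "S b - S a > 0" using Bpos[of z] assms by simp
  \<comment> \<open>Normalises the total mass of the bump, positive by the mean value theorem, to
    1.\<close>
  define c where "c = 1 / (S b - S a)"
  have c: "c > 0" "c * (S b - S a) = 1" using \<open>S b - S a > 0\<close> by (auto simp: c_def)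
  define \<theta> where "\<theta> x = c * (S x + (- S a))" for x
  have d\<theta>: "(\<theta> has_real_derivative c * B x) (at x)" for x
    unfolding \<theta>_def by (auto intro!: derivative_eq_intros S)
  have "k_times_differentiable k S" for k
  proof (cases k)
    case (Suc j) then show ?thesis using S Bk by auto
  qed (use S DERIV_isCont in \<open>auto intro!: continuous_at_imp_continuous_on\<close>)
  then have "k_times_differentiable k \<theta>" for k
    unfolding \<theta>_def by (intro k_times_differentiable_mult k_times_differentiable_add k_times_differentiable_const)
  moreover have \<theta>01: "0 \<le> \<theta> x" "\<theta> x \<le> 1" for x
  proof -
    have "S a \<le> S x" using mono[of a x] left[of x] by linarith
    then show "0 \<le> \<theta> x" using c(1) by (simp add: \<theta>_def)
    have "S x \<le> S b" using mono[of x b] right[of x] by linarith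
    then have "c * (S x - S a) \<le> c * (S b - S a)" using c(1) by (intro mult_left_mono) auto
    then show "\<theta> x \<le> 1" using c(2) by (simp add: \<theta>_def)
  qed
  moreover have "continuous_on UNIV (\<lambda>x. c * B x)" by (intro continuous_on_mult continuous_on_const Bcont)
  moreover have "0 \<le> c * B x" for x using c(1) B0[of x] by simp
  moreover have "c * B x = 0" if "x \<notin> {a..b}" for x using Bout[of x] that by auto
  moreover have "\<theta> x = 0" if "x \<le> a" for x using left[OF that] by (simp add: \<theta>_def)
  moreover have "\<theta> x = 1" if "b \<le> x" for x using right[OF that] c(2) by (simp add: \<theta>_def)
  ultimately show ?thesis using d\<theta> that[of \<theta> "\<lambda>x. c * B x"] by blast
qed

text \<open>The weight \<open>\<theta>'\<close> is nonnegative and has integral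
  \<open>\<theta> q - \<theta> p = 1\<close>, so the integral is an average of values of
  \<open>f\<close> close to \<open>c\<close>. The rest is the passage between
  \<open>lebesgue_on {0<..}\<close> and \<open>lborel\<close>.\<close>

lemma smooth_step_average:
  fixes f \<theta> \<theta>' :: "real \<Rightarrow> real"
  assumes pq: "0 < p" "p \<le> q"
    and d: "\<And>x. (\<theta> has_real_derivative \<theta>' x) (at x)" and cont: "continuous_on UNIV \<theta>'"
    and nn: "\<And>x. 0 \<le> \<theta>' x" and out: "\<And>x. x \<notin> {p..q} \<Longrightarrow> \<theta>' x = 0" and val: "\<theta> p = 0" "\<theta> q = 1"
    and f: "continuous_on {0<..} f" and near: "\<And>x. x \<in> {p..q} \<Longrightarrow> \<bar>f x - c\<bar> \<le> e"
  shows "integrable (lebesgue_on {0<..}) (\<lambda>x. \<theta>' x * f x)"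
    "\<bar>(\<integral>x. \<theta>' x * f x \<partial>lebesgue_on {0<..}) - c\<bar> \<le> e"
proof -
  have int: "integrable (lebesgue_on {0<..}) (\<lambda>x. \<theta>' x * h x)"
    and eq: "(\<integral>x. \<theta>' x * h x \<partial>lebesgue_on {0<..}) = (LBINT x. \<theta>' x * h x * indicator {p..q} x)"
    if h: "continuous_on {p..q} h" for h :: "real \<Rightarrow> real"
  proof -
    have "continuous_on {p..q} (\<lambda>x. \<theta>' x * h x)"
      using h continuous_on_subset[OF cont] by (intro continuous_on_mult) auto
    then have i: "integrable lborel (\<lambda>x. indicator {p..q} x *\<^sub>R (\<theta>' x * h x))"
      using borel_integrable_atLeastAtMost' unfolding set_integrable_def by blast
    have e: "(\<lambda>x. indicator {0<..} x *\<^sub>R (\<theta>' x * h x)) = (\<lambda>x. indicator {p..q} x *\<^sub>R (\<theta>' x * h x))"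
      using out pq by (auto simp: indicator_def fun_eq_iff)
    show "integrable (lebesgue_on {0<..}) (\<lambda>x. \<theta>' x * h x)"
    proof (subst integrable_restrict_space)
      have "(\<lambda>x. indicator {p..q} x *\<^sub>R (\<theta>' x * h x)) \<in> borel_measurable lborel" using i by simp
      then show "integrable lebesgue (\<lambda>x. indicator {0<..} x *\<^sub>R (\<theta>' x * h x))"
        unfolding e using i by (subst integrable_completion)
    qed simp
    have "(\<integral>x. \<theta>' x * h x \<partial>lebesgue_on {0<..}) = (\<integral>x. indicator {0<..} x *\<^sub>R (\<theta>' x * h x) \<partial>lebesgue)"
      by (rule integral_restrict_space) simp
    also have "\<dots> = (LBINT x. indicator {p..q} x *\<^sub>R (\<theta>' x * h x))"
      unfolding e using i by (intro integral_completion) auto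
    finally show "(\<integral>x. \<theta>' x * h x \<partial>lebesgue_on {0<..}) = (LBINT x. \<theta>' x * h x * indicator {p..q} x)"
      by (simp add: mult.commute)
  qed
  have fpq: "continuous_on {p..q} f" using pq by (intro continuous_on_subset[OF f]) auto
  show i: "integrable (lebesgue_on {0<..}) (\<lambda>x. \<theta>' x * f x)" by (rule int[OF fpq])
  have "isCont \<theta>' x" for x using cont by (simp add: continuous_on_eq_continuous_at)
  then have one: "(\<integral>x. \<theta>' x \<partial>lebesgue_on {0<..}) = 1"
    using eq[of "\<lambda>x. 1"] integral_FTC_Icc_real[OF pq(2) d] val by simp
  have i1: "integrable (lebesgue_on {0<..}) \<theta>'" using int[of "\<lambda>x. 1"] by simp
  have "(\<integral>x. \<theta>' x * f x \<partial>lebesgue_on {0<..}) - c = (\<integral>x. \<theta>' x * f x - \<theta>' x * c \<partial>lebesgue_on {0<..})"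
    using i i1 one by simp
  also have "\<bar>\<dots>\<bar> \<le> (\<integral>x. \<theta>' x * e \<partial>lebesgue_on {0<..})"
  proof -
    have "\<bar>\<theta>' x * f x - \<theta>' x * c\<bar> \<le> \<theta>' x * e" for x
    proof (cases "x \<in> {p..q}")
      case True
      then show ?thesis using mult_left_mono[OF near[OF True] nn[of x]] nn[of x]
        by (simp add: abs_mult flip: right_diff_distrib)
    qed (use out in simp)
    then show ?thesis using i i1
      by (intro order_trans[OF integral_abs_bound] integral_mono integrable_abs Bochner_Integration.integrable_diff) auto
  qed
  also have "\<dots> = e" using one by simp
  finally show "\<bar>(\<integral>x. \<theta>' x * f x \<partial>lebesgue_on {0<..}) - c\<bar> \<le> e" .
qed

text \<open>The test function is a smooth approximation of the indicator of \<open>[a, b]\<close>: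
  its derivative averages \<open>f\<close> near the two endpoints, while the other side is dominated
  by \<open>H\<close>. It is supported inside \<open>[a, b]\<close>, so the bound involves exactly
  this interval.\<close>

lemma distributional_derivative_increment:
  fixes f h H :: "real \<Rightarrow> real"
  assumes ab: "0 < a" "a < b" and f: "continuous_on {0<..} f"
    and dd: "\<And>\<eta>. test_function 0 \<infinity> \<eta> \<Longrightarrow>
       (\<integral>t. \<eta> t * h t \<partial>lebesgue_on {0<..}) = - (\<integral>t. deriv \<eta> t * f t \<partial>lebesgue_on {0<..})"
    and hH: "AE t in lebesgue_on {0<..}. \<bar>h t\<bar> \<le> H t"
    and H: "integrable (lebesgue_on {0<..}) (\<lambda>t. indicator {a..b} t * H t)"
  shows "\<bar>f b - f a\<bar> \<le> (\<integral>t. indicator {a..b} t * H t \<partial>lebesgue_on {0<..})"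
proof (rule field_le_epsilon)
  fix e :: real assume e: "e > 0"
  have near: "\<exists>d>0. \<forall>x. \<bar>x - c\<bar> < d \<longrightarrow> \<bar>f x - f c\<bar> < e / 2" if "c > 0" for c
  proof -
    have "isCont f c" using f that by (auto simp: continuous_on_eq_continuous_at)
    then show ?thesis
      using half_gt_zero[OF e] unfolding continuous_at_eps_delta dist_real_def by blast
  qed
  obtain d1 where d1: "d1 > 0" "\<And>x. \<bar>x - a\<bar> < d1 \<Longrightarrow> \<bar>f x - f a\<bar> < e / 2"
    using near[of a] ab by auto
  obtain d2 where d2: "d2 > 0" "\<And>x. \<bar>x - b\<bar> < d2 \<Longrightarrow> \<bar>f x - f b\<bar> < e / 2"
    using near[of b] ab by auto
  \<comment> \<open>Keeps the two transition windows from overlapping and inside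
    \<open>[a, b]\<close>, and the deviation of \<open>f\<close> from its endpoint value on each of
    them below \<open>e / 2\<close>.\<close>
  define \<epsilon> where "\<epsilon> = min (min (d1 / 2) (d2 / 2)) ((b - a) / 2)"
  have \<epsilon>: "\<epsilon> > 0" "\<epsilon> < d1" "\<epsilon> < d2" "\<epsilon> \<le> (b - a) / 2"
    using d1(1) d2(1) ab by (auto simp: \<epsilon>_def min_def)
  have order: "a < a + \<epsilon>" "a + \<epsilon> \<le> b - \<epsilon>" "b - \<epsilon> < b" using \<epsilon> by (auto simp: field_simps)
  obtain \<theta>1 \<theta>1' where s1: "\<And>k. k_times_differentiable k \<theta>1" "\<And>x. (\<theta>1 has_real_derivative \<theta>1' x) (at x)"
    "continuous_on UNIV \<theta>1'" "\<And>x. 0 \<le> \<theta>1' x" "\<And>x. x \<notin> {a..a + \<epsilon>} \<Longrightarrow> \<theta>1' x = 0"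
    "\<And>x. x \<le> a \<Longrightarrow> \<theta>1 x = 0" "\<And>x. a + \<epsilon> \<le> x \<Longrightarrow> \<theta>1 x = 1" "\<And>x. 0 \<le> \<theta>1 x" "\<And>x. \<theta>1 x \<le> 1"
    by (rule smooth_step_exists[OF order(1)]) (rule that)
  obtain \<theta>2 \<theta>2' where s2: "\<And>k. k_times_differentiable k \<theta>2" "\<And>x. (\<theta>2 has_real_derivative \<theta>2' x) (at x)"
    "continuous_on UNIV \<theta>2'" "\<And>x. 0 \<le> \<theta>2' x" "\<And>x. x \<notin> {b - \<epsilon>..b} \<Longrightarrow> \<theta>2' x = 0"
    "\<And>x. x \<le> b - \<epsilon> \<Longrightarrow> \<theta>2 x = 0" "\<And>x. b \<le> x \<Longrightarrow> \<theta>2 x = 1" "\<And>x. 0 \<le> \<theta>2 x" "\<And>x. \<theta>2 x \<le> 1"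
    by (rule smooth_step_exists[OF order(3)]) (rule that)
  \<comment> \<open>Rises on \<open>[a, a + \<epsilon>]\<close> and falls on
    \<open>[b - \<epsilon>, b]\<close>.\<close>
  define \<eta> where "\<eta> x = \<theta>1 x + (-1) * \<theta>2 x" for x
  have \<eta>out: "\<eta> x = 0" if "x \<notin> {a..b}" for x
    using that order s1(6)[of x] s1(7)[of x] s2(6)[of x] s2(7)[of x] by (auto simp: \<eta>_def)
  have \<eta>01: "0 \<le> \<eta> x" "\<eta> x \<le> 1" for x
  proof -
    show "\<eta> x \<le> 1" using s1(9)[of x] s2(8)[of x] by (simp add: \<eta>_def)
    show "0 \<le> \<eta> x"
      using s1(7)[of x] s1(8)[of x] s2(6)[of x] s2(9)[of x] order by (cases "x \<le> b - \<epsilon>") (auto simp: \<eta>_def)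
  qed
  have "k_times_differentiable k \<eta>" for k
    unfolding \<eta>_def by (intro k_times_differentiable_mult k_times_differentiable_add k_times_differentiable_const s1 s2)
  then have "test_function 0 \<infinity> \<eta>"
    unfolding test_function_def smooth_fun_on_def
    using k_times_differentiable_imp_Ck_on \<eta>out ab
    by (intro conjI exI[of _ a] exI[of _ b] allI impI) simp_all
  note dd = dd[OF this]
  have d\<eta>: "deriv \<eta> x = \<theta>1' x - \<theta>2' x" for x
    unfolding \<eta>_def by (rule DERIV_imp_deriv) (auto intro!: derivative_eq_intros s1 s2)
  have A1: "integrable (lebesgue_on {0<..}) (\<lambda>x. \<theta>1' x * f x)"
    "\<bar>(\<integral>x. \<theta>1' x * f x \<partial>lebesgue_on {0<..}) - f a\<bar> \<le> e / 2"
  proof -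
    have "\<bar>f x - f a\<bar> \<le> e / 2" if "x \<in> {a..a + \<epsilon>}" for x
      using d1(2)[of x] that \<epsilon> by auto
    from smooth_step_average[OF ab(1) _ s1(2-5) _ _ f this, of "a + \<epsilon>"] s1(6)[of a] s1(7)[of "a + \<epsilon>"] order
    show "integrable (lebesgue_on {0<..}) (\<lambda>x. \<theta>1' x * f x)"
      "\<bar>(\<integral>x. \<theta>1' x * f x \<partial>lebesgue_on {0<..}) - f a\<bar> \<le> e / 2" by auto
  qed
  have A2: "integrable (lebesgue_on {0<..}) (\<lambda>x. \<theta>2' x * f x)"
    "\<bar>(\<integral>x. \<theta>2' x * f x \<partial>lebesgue_on {0<..}) - f b\<bar> \<le> e / 2"
  proof -
    have "\<bar>f x - f b\<bar> \<le> e / 2" if "x \<in> {b - \<epsilon>..b}" for x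
      using d2(2)[of x] that \<epsilon> by auto
    from smooth_step_average[OF _ _ s2(2-5) _ _ f this, of "b - \<epsilon>" b] s2(6)[of "b - \<epsilon>"] s2(7)[of b] order ab
    show "integrable (lebesgue_on {0<..}) (\<lambda>x. \<theta>2' x * f x)"
      "\<bar>(\<integral>x. \<theta>2' x * f x \<partial>lebesgue_on {0<..}) - f b\<bar> \<le> e / 2" by auto
  qed
  have "(\<integral>t. \<eta> t * h t \<partial>lebesgue_on {0<..}) =
      (\<integral>x. \<theta>2' x * f x \<partial>lebesgue_on {0<..}) - (\<integral>x. \<theta>1' x * f x \<partial>lebesgue_on {0<..})"
    unfolding dd d\<eta> left_diff_distrib using A1(1) A2(1) by simp
  moreover have "\<bar>\<integral>t. \<eta> t * h t \<partial>lebesgue_on {0<..}\<bar> \<le> (\<integral>t. indicator {a..b} t * H t \<partial>lebesgue_on {0<..})"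
  proof -
    have ae: "AE t in lebesgue_on {0<..}. norm (\<eta> t * h t) \<le> indicator {a..b} t * H t"
      using hH
    proof eventually_elim
      case (elim t)
      show ?case
      proof (cases "t \<in> {a..b}")
        case True
        have "\<bar>\<eta> t\<bar> * \<bar>h t\<bar> \<le> 1 * \<bar>h t\<bar>" using \<eta>01[of t] by (intro mult_right_mono) auto
        then show ?thesis using True elim by (simp add: abs_mult)
      qed (simp add: \<eta>out)
    qed
    show ?thesis
    proof (cases "integrable (lebesgue_on {0<..}) (\<lambda>t. \<eta> t * h t)")
      case True
      have "\<bar>\<integral>t. \<eta> t * h t \<partial>lebesgue_on {0<..}\<bar> \<le> (\<integral>t. norm (\<eta> t * h t) \<partial>lebesgue_on {0<..})"
        by (metis integral_norm_bound real_norm_def)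
      also have "\<dots> \<le> (\<integral>t. indicator {a..b} t * H t \<partial>lebesgue_on {0<..})"
        using True H ae by (intro integral_mono_AE integrable_norm)
      finally show ?thesis .
    next
      \<comment> \<open>\<open>h\<close> may fail to be measurable; the Bochner integral is then \<open>0\<close>\<close>
      case False
      have "0 \<le> (\<integral>t. indicator {a..b} t * H t \<partial>lebesgue_on {0<..})"
        using ae by (intro integral_nonneg_AE) (auto elim!: eventually_mono intro: order_trans[OF norm_ge_zero])
      then show ?thesis using False by (simp add: not_integrable_integral_eq)
    qed
  qed
  ultimately show "\<bar>f b - f a\<bar> \<le> (\<integral>t. indicator {a..b} t * H t \<partial>lebesgue_on {0<..}) + e"
    using A1(2) A2(2) by linarith
qed

section \<open>The elliptic equation\<close>

text \<open>The bounds may vary with \<open>n\<close>: Fatou is applied to tails, on which they are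
  below \<open>B + e\<close>.\<close>

lemma integrable_Fatou_lim:
  fixes f :: "nat \<Rightarrow> 'a \<Rightarrow> real"
  assumes "\<And>n. integrable M (f n)" "\<And>n. AE x in M. 0 \<le> f n x" "h \<in> borel_measurable M"
    and lim: "AE x in M. (\<lambda>n. f n x) \<longlonglongrightarrow> h x" and b: "\<And>n. (\<integral>x. f n x \<partial>M) \<le> b n" "b \<longlonglongrightarrow> B"
  shows "integrable M h" "(\<integral>x. h x \<partial>M) \<le> B"
proof -
  have *: "integrable M h \<and> (\<integral>x. h x \<partial>M) \<le> B + e" if e: "e > 0" for e
  proof -
    have "\<forall>\<^sub>F n in sequentially. b n < B + e" using b(2) e by (intro order_tendstoD(2)) auto
    then obtain N where N: "\<And>n. n \<ge> N \<Longrightarrow> b n < B + e" by (auto simp: eventually_sequentially)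
    have l: "AE x in M. (\<lambda>n. f (n + N) x) \<longlonglongrightarrow> h x"
      using lim by eventually_elim (rule LIMSEQ_ignore_initial_segment)
    have "(\<integral>x. f (n + N) x \<partial>M) \<le> B + e" for n using b(1)[of "n + N"] N[of "n + N"] by simp
    note F = integrable_Fatou[of M "\<lambda>n. f (n + N)", OF assms(1,2,3) l this]
    show ?thesis by (rule conjI[OF F])
  qed
  show "integrable M h" using *[of 1] by simp
  show "(\<integral>x. h x \<partial>M) \<le> B" by (rule field_le_epsilon) (rule conjunct2[OF *])
qed

lemma X_space_weak_limit:
  fixes v :: "nat \<Rightarrow> real ^ 'n \<Rightarrow> real"
  assumes a: "0 < a" "a < 1" and v: "\<And>n. v n \<in> X_space a \<Omega>" and z: "z \<in> borel_measurable borel"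
    and lim: "AE x in lborel. (\<lambda>n. v n x) \<longlonglongrightarrow> z x"
    and K: "\<And>n. X_norm a (v n) \<le> K" and y: "y \<in> X_space a \<Omega>"
  shows "(\<lambda>n. frac_form a (v n) y) \<longlonglongrightarrow> frac_form a z y"
proof -
  have z': "z \<in> borel_measurable lborel" using z by simp
  show ?thesis unfolding frac_form_eq
    by (intro tendsto_mult tendsto_const sq_integrable_weak_limit[OF X_space_gagliardo[OF v]
        measurable_gagliardo[OF z'] AE_gagliardo_tendsto[OF a lim] gagliardo_integral_bound[OF a K] X_space_gagliardo[OF y]])
qed

text \<open>Passage from the integrals over \<Omega> of the definitions to integrals over the whole
  space, to which the L2 facts apply; it rests on the vanishing of \<open>z\<close> outside
  \<Omega>.\<close>

lemma L2_functional_eq: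
  assumes z: "z \<in> X_space a \<Omega>" and f: "f \<in> borel_measurable borel" and \<Omega>: "open \<Omega>"
  shows "L2_functional \<Omega> f z = (LBINT x. f x * z x)"
  unfolding L2_functional_def set_lebesgue_integral_def
proof (rule integral_cong_AE)
  have [measurable]: "z \<in> borel_measurable borel" "f \<in> borel_measurable borel" "\<Omega> \<in> sets borel"
    using X_space_measurable[OF z] f \<Omega> by auto
  show "(\<lambda>x. indicat_real \<Omega> x *\<^sub>R (f x * z x)) \<in> borel_measurable lborel" by measurable
  show "(\<lambda>x. f x * z x) \<in> borel_measurable lborel" by measurable
  show "AE x in lborel. indicat_real \<Omega> x *\<^sub>R (f x * z x) = f x * z x"
    using X_space_AE_zero[OF z] by eventually_elim (auto simp: indicator_def)
qed

lemma L2_space_compose_iff: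
  assumes v: "v \<in> X_space a \<Omega>" and h: "continuous_on UNIV h" "h 0 = 0" and \<Omega>: "open \<Omega>"
  shows "(\<lambda>x. h (v x)) \<in> L2_space \<Omega> \<longleftrightarrow> sq_integrable lborel (\<lambda>x. h (v x))"
proof -
  have [measurable]: "v \<in> borel_measurable borel" "h \<in> borel_measurable borel" "\<Omega> \<in> sets borel"
    using X_space_measurable[OF v] h(1) \<Omega> by (auto intro: borel_measurable_continuous_onI)
  have "integrable lborel (\<lambda>x. indicat_real \<Omega> x *\<^sub>R (h (v x))\<^sup>2) \<longleftrightarrow> integrable lborel (\<lambda>x. (h (v x))\<^sup>2)"
  proof (rule integrable_cong_AE)
    show "AE x in lborel. indicat_real \<Omega> x *\<^sub>R (h (v x))\<^sup>2 = (h (v x))\<^sup>2"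
      using X_space_AE_zero[OF v] by eventually_elim (auto simp: indicator_def h(2))
  qed measurable
  then show ?thesis
    by (simp add: L2_space_def set_borel_measurable_def set_integrable_def sq_integrable_def)
qed

locale cahn_hilliard =
  fixes \<Omega> :: "(real ^ 'n) set" and s \<sigma> \<Lambda> :: real and g G :: "real \<Rightarrow> real"
  assumes \<Omega>: "open \<Omega>" "bounded \<Omega>"
    and s: "0 < s" "s < 1" and \<sigma>: "0 < \<sigma>" "\<sigma> < 1"
    and g_C1: "g C1_differentiable_on UNIV" and g0: "g 0 = 0"
    and \<Lambda>: "\<Lambda> \<ge> 0" and g_lower: "\<And>r. deriv g r \<ge> - \<Lambda>"
    and G: "\<And>r. (G has_real_derivative g r) (at r)"
    and coercive: "\<exists>\<kappa>>0. Liminf at_infinity (\<lambda>r. ereal (g r * r + (lambda1 \<sigma> \<Omega> - \<kappa>) * r\<^sup>2)) > 0"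
begin

text \<open>The equation \<open>\<AA>\<^sub>\<sigma> v + g(v) = w\<close> with a free right-hand
  side, in whole-space integrals. The stationary problem is the case \<open>w = 0\<close>, and
  almost every pair \<open>u t\<close>, \<open>w t\<close> is another instance.\<close>

definition elliptic :: "(real ^ 'n \<Rightarrow> real) \<Rightarrow> (real ^ 'n \<Rightarrow> real) \<Rightarrow> bool" where
  "elliptic v w \<longleftrightarrow> v \<in> X_space \<sigma> \<Omega> \<and> w \<in> X_space s \<Omega> \<and> sq_integrable lborel (\<lambda>x. g (v x)) \<and>
     (\<forall>z\<in>X_space \<sigma> \<Omega>. (LBINT x. w x * z x) = frac_form \<sigma> v z + (LBINT x. g (v x) * z x))"

definition finite_energy :: "(real ^ 'n \<Rightarrow> real) \<Rightarrow> bool" where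
  "finite_energy v \<longleftrightarrow> set_integrable lborel \<Omega> (\<lambda>x. G (v x))"

text \<open>Real valued, for arithmetic with energy differences. The integral defaults to 0 when
  \<open>G(v)\<close> is not integrable, so this is the energy only under
  \<open>finite_energy\<close>; \<open>energy_eq_real_energy\<close> makes the link.\<close>

definition real_energy :: "(real ^ 'n \<Rightarrow> real) \<Rightarrow> real" where
  "real_energy v = (X_norm \<sigma> v)\<^sup>2 / 2 + (LINT x:\<Omega>|lborel. G (v x))"

lemma \<Omega>_sets [measurable]: "\<Omega> \<in> sets borel"
  using \<Omega> by simp

lemma \<Omega>_finite: "emeasure lborel \<Omega> < \<infinity>"
  using \<Omega> by (intro emeasure_bounded_finite)

lemma g_deriv: "(g has_real_derivative deriv g r) (at r)"
  and deriv_g_continuous: "continuous_on UNIV (deriv g)"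
proof -
  obtain D where D: "\<And>x. (g has_vector_derivative D x) (at x)" "continuous_on UNIV D"
    using g_C1 unfolding C1_differentiable_on_def by auto
  then have d: "(g has_real_derivative D x) (at x)" for x
    by (simp add: has_real_derivative_iff_has_vector_derivative)
  then have "deriv g = D" by (auto simp: fun_eq_iff intro: DERIV_imp_deriv)
  then show "(g has_real_derivative deriv g r) (at r)" "continuous_on UNIV (deriv g)"
    using d D(2) by auto
qed

lemma g_continuous: "continuous_on UNIV g"
  using DERIV_isCont[OF g_deriv] by (simp add: continuous_at_imp_continuous_on)

lemma G_continuous: "continuous_on UNIV G"
  using DERIV_isCont[OF G] by (simp add: continuous_at_imp_continuous_on)

lemma g_measurable [measurable]: "g \<in> borel_measurable borel"
  by (rule borel_measurable_continuous_onI[OF g_continuous])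

lemma G_measurable [measurable]: "G \<in> borel_measurable borel"
  by (rule borel_measurable_continuous_onI[OF G_continuous])

section \<open>Semiconvexity of the potential and of the energy\<close>

lemma beta_mono: "p \<le> q \<Longrightarrow> g p + \<Lambda> * p \<le> g q + \<Lambda> * q"
  by (rule DERIV_nonneg_imp_nondecreasing[of p q "\<lambda>r. g r + \<Lambda> * r"])
    (auto intro!: exI derivative_eq_intros g_deriv simp: g_lower[THEN order_trans[rotated]] minus_le_iff
      intro: add_nonneg_nonneg order_trans[OF _ add_right_mono[OF g_lower]])

lemma g_semimonotone: "- \<Lambda> * (p - q)\<^sup>2 \<le> (g p - g q) * (p - q)"
proof -
  have "0 \<le> ((g p + \<Lambda> * p) - (g q + \<Lambda> * q)) * (p - q)"
    using beta_mono[of p q] beta_mono[of q p]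
    by (cases "p \<le> q") (auto intro: mult_nonneg_nonneg mult_nonpos_nonpos)
  then show ?thesis by (simp add: power2_eq_square algebra_simps)
qed

text \<open>Adding \<open>\<Lambda> / 2 * r^2\<close> to \<open>G\<close> gives a function with
  nondecreasing derivative, which lies above its tangents; subtracting the quadratic again leaves
  the defect in \<open>(q - p)^2\<close>.\<close>

lemma G_semiconvex: "g p * (q - p) - \<Lambda> / 2 * (q - p)\<^sup>2 \<le> G q - G p"
proof -
  define H where "H r = G r + \<Lambda> / 2 * r\<^sup>2" for r
  have H: "(H has_real_derivative g r + \<Lambda> * r) (at r)" for r
    unfolding H_def by (auto intro!: derivative_eq_intros G)
  have "(g p + \<Lambda> * p) * (q - p) \<le> H q - H p"
  proof (cases q p rule: linorder_cases)
    case less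
    obtain z where z: "q < z" "z < p" "H p - H q = (p - q) * (g z + \<Lambda> * z)"
      using MVT2[OF less H] by auto
    have "(p - q) * (g z + \<Lambda> * z) \<le> (p - q) * (g p + \<Lambda> * p)"
      using less z by (intro mult_left_mono beta_mono) auto
    then show ?thesis using z(3) by (simp add: algebra_simps)
  next
    case greater
    obtain z where z: "p < z" "z < q" "H q - H p = (q - p) * (g z + \<Lambda> * z)"
      using MVT2[OF greater H] by auto
    have "(q - p) * (g p + \<Lambda> * p) \<le> (q - p) * (g z + \<Lambda> * z)"
      using greater z by (intro mult_left_mono beta_mono) auto
    then show ?thesis using z(3) by (simp add: algebra_simps)
  qed simp
  then show ?thesis by (simp add: H_def power2_eq_square field_simps)
qed

lemma G_lower: "G 0 - \<Lambda> / 2 * r\<^sup>2 \<le> G r"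
  using G_semiconvex[of 0 r] g0 by simp

text \<open>The tangent at \<open>r\<close>, evaluated at 0. It lets \<open>g(v) v\<close> control
  \<open>G(v)\<close> from above, so that square integrability of \<open>g(v)\<close> gives finite
  energy although \<open>g\<close> has no growth bound.\<close>

lemma G_upper: "G r \<le> G 0 + g r * r + \<Lambda> / 2 * r\<^sup>2"
  using G_semiconvex[of r 0] by simp

lemma LINT_\<Omega>_eq:
  assumes z: "z \<in> X_space a \<Omega>" and f: "f \<in> borel_measurable borel"
  shows "(LINT x:\<Omega>|lborel. f x * z x) = (LBINT x. f x * z x)"
  using L2_functional_eq[OF z f \<Omega>(1)] by (simp add: L2_functional_def)

lemma set_integrable_sq_mult:
  assumes "sq_integrable lborel f" "sq_integrable lborel h"
  shows "set_integrable lborel \<Omega> (\<lambda>x. f x * h x)"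
  unfolding set_integrable_def using sq_integrable_mult_integrable[OF assms]
  by (intro integrable_mult_indicator) auto

lemma set_integrable_sq:
  assumes "sq_integrable lborel f"
  shows "set_integrable lborel \<Omega> (\<lambda>x. (f x)\<^sup>2)"
  using set_integrable_sq_mult[OF assms assms] by (simp add: power2_eq_square)

lemma set_integrable_const: "set_integrable lborel \<Omega> (\<lambda>x. c :: real)"
  unfolding set_integrable_def using \<Omega>_finite by (auto intro!: integrable_mult_left)

lemma elliptic_finite_energy:
  assumes "elliptic v w"
  shows "finite_energy v"
proof -
  have v: "v \<in> X_space \<sigma> \<Omega>" "sq_integrable lborel (\<lambda>x. g (v x))" using assms by (auto simp: elliptic_def)
  note v2 = X_space_sq_integrable[OF v(1)]
  note [measurable] = X_space_measurable[OF v(1)]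
  have "set_integrable lborel \<Omega> (\<lambda>x. \<bar>G 0\<bar> + \<bar>g (v x) * v x\<bar> + \<Lambda> / 2 * (v x)\<^sup>2)"
    by (intro set_integral_add set_integrable_const set_integrable_abs set_integrable_sq_mult v2 v(2)
        set_integrable_mult_right set_integrable_sq)
  then show ?thesis unfolding finite_energy_def
  proof (rule set_integrable_bound)
    show "set_borel_measurable lborel \<Omega> (\<lambda>x. G (v x))" by (simp add: set_borel_measurable_def)
    have "\<bar>G r\<bar> \<le> \<bar>G 0\<bar> + \<bar>g r * r\<bar> + \<Lambda> / 2 * r\<^sup>2" for r
      using G_lower[of r] G_upper[of r] \<Lambda> by (auto simp: abs_le_iff)
    then show "AE x in lborel. x \<in> \<Omega> \<longrightarrow> norm (G (v x)) \<le> norm (\<bar>G 0\<bar> + \<bar>g (v x) * v x\<bar> + \<Lambda> / 2 * (v x)\<^sup>2)"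
      using \<Lambda> by (intro AE_I2 impI) (smt (verit) real_norm_def)
  qed
qed

text \<open>The quadratic part is expanded exactly, the potential is bounded below by semiconvexity,
  and the equation turns the first-order terms into a pairing with \<open>w\<close>. The remaining
  half of the squared norm is what later converts an energy comparison into a norm bound.\<close>

lemma elliptic_energy_inequality:
  assumes "elliptic v w" and z: "z \<in> X_space \<sigma> \<Omega>" "finite_energy z"
  shows "(LBINT x. w x * (z x - v x)) + (X_norm \<sigma> (\<lambda>x. z x - v x))\<^sup>2 / 2
      - \<Lambda> / 2 * (LBINT x. (z x - v x)\<^sup>2) \<le> real_energy z - real_energy v"
proof -
  have v: "v \<in> X_space \<sigma> \<Omega>" "sq_integrable lborel (\<lambda>x. g (v x))"
    and eq: "\<And>z. z \<in> X_space \<sigma> \<Omega> \<Longrightarrow> (LBINT x. w x * z x) = frac_form \<sigma> v z + (LBINT x. g (v x) * z x)"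
    using assms by (auto simp: elliptic_def)
  define d where "d = (\<lambda>x. z x - v x)"
  have d: "d \<in> X_space \<sigma> \<Omega>" unfolding d_def by (rule X_space_diff[OF z(1) v(1)])
  note d2 = X_space_sq_integrable[OF d]
  note [measurable] = X_space_measurable[OF v(1)] X_space_measurable[OF d]
  have fv: "set_integrable lborel \<Omega> (\<lambda>x. G (v x))" "set_integrable lborel \<Omega> (\<lambda>x. G (z x))"
    using elliptic_finite_energy[OF assms(1)] z(2) by (auto simp: finite_energy_def)
  have i: "set_integrable lborel \<Omega> (\<lambda>x. g (v x) * d x)" "set_integrable lborel \<Omega> (\<lambda>x. \<Lambda> / 2 * (d x)\<^sup>2)"
    by (intro set_integrable_mult_right set_integrable_sq set_integrable_sq_mult v(2) d2)+
  have "(LINT x:\<Omega>|lborel. g (v x) * d x - \<Lambda> / 2 * (d x)\<^sup>2) \<le> (LINT x:\<Omega>|lborel. G (z x) - G (v x))"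
    by (intro set_integral_mono set_integral_diff fv i) (simp only: d_def G_semiconvex)
  then have "(LINT x:\<Omega>|lborel. g (v x) * d x) - (LINT x:\<Omega>|lborel. \<Lambda> / 2 * (d x)\<^sup>2) \<le>
      (LINT x:\<Omega>|lborel. G (z x)) - (LINT x:\<Omega>|lborel. G (v x))"
    using fv i by (simp add: set_integral_diff)
  moreover have "(LINT x:\<Omega>|lborel. g (v x) * d x) = (LBINT x. g (v x) * d x)"
    by (intro LINT_\<Omega>_eq[OF d]) simp
  moreover have "(LINT x:\<Omega>|lborel. \<Lambda> / 2 * (d x)\<^sup>2) = \<Lambda> / 2 * (LBINT x. (d x)\<^sup>2)"
    using LINT_\<Omega>_eq[OF d, of d] by (simp add: power2_eq_square)
  moreover have "(X_norm \<sigma> z)\<^sup>2 = (X_norm \<sigma> v)\<^sup>2 + 2 * frac_form \<sigma> v d + (X_norm \<sigma> d)\<^sup>2"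
    using X_norm_square_add[OF \<sigma> v(1) d] by (simp add: d_def)
  ultimately have "(LBINT x. w x * d x) + (X_norm \<sigma> d)\<^sup>2 / 2
      - \<Lambda> / 2 * (LBINT x. (d x)\<^sup>2) \<le> real_energy z - real_energy v"
    unfolding eq[OF d] real_energy_def by argo
  then show ?thesis by (simp add: d_def)
qed

text \<open>The squared norm is bounded below by
  \<open>2 * frac_form \<sigma> (v n) z - (X_norm \<sigma> z)^2\<close>, which is affine in
  \<open>v n\<close> and converges by weak convergence; Fatou handles the potential after a shift
  that makes it nonnegative.\<close>

lemma real_energy_lower_semicontinuous:
  assumes v: "\<And>n. v n \<in> X_space \<sigma> \<Omega>" "\<And>n. finite_energy (v n)" "\<And>n. real_energy (v n) \<le> B"
    and K: "\<And>n. X_norm \<sigma> (v n) \<le> K" and z: "z \<in> X_space \<sigma> \<Omega>"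
    and lim: "AE x in lborel. (\<lambda>n. v n x) \<longlonglongrightarrow> z x"
    and L2: "(\<lambda>n. LBINT x. (v n x - z x)\<^sup>2) \<longlonglongrightarrow> 0"
  shows "finite_energy z" "real_energy z \<le> B"
proof -
  note zm [measurable] = X_space_measurable[OF z]
  note vm [measurable] = X_space_measurable[OF v(1)]
  have vi: "integrable lborel (\<lambda>x. (v n x)\<^sup>2)" for n using X_space_sq_integrable[OF v(1)] by (simp add: sq_integrable_def)
  have zi: "integrable lborel (\<lambda>x. (z x)\<^sup>2)" using X_space_sq_integrable[OF z] by (simp add: sq_integrable_def)
  \<comment> \<open>Nonnegative by \<open>G_lower\<close>. The integral of the added quadratic term
    converges because \<open>v n\<close> tends to \<open>z\<close> in L2.\<close>
  define \<Gamma> where "\<Gamma> r = G r + \<Lambda> / 2 * r\<^sup>2 - G 0" for r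
  have \<Gamma>0: "0 \<le> \<Gamma> r" for r using G_lower[of r] by (simp add: \<Gamma>_def)
  have \<Gamma>m [measurable]: "\<Gamma> \<in> borel_measurable borel" unfolding \<Gamma>_def by measurable
  have \<Gamma>c: "isCont \<Gamma> r" for r
    unfolding \<Gamma>_def using DERIV_isCont[OF G] by (intro continuous_intros) auto
  define m where "m = (LINT x:\<Omega>|lborel. G 0)"
  have \<Gamma>I: "set_integrable lborel \<Omega> (\<lambda>x. \<Gamma> (y x)) \<longleftrightarrow> finite_energy y"
    "finite_energy y \<Longrightarrow> (LINT x:\<Omega>|lborel. \<Gamma> (y x)) = (LINT x:\<Omega>|lborel. G (y x)) + \<Lambda> / 2 * (LBINT x. (y x)\<^sup>2) - m"
    if y: "y \<in> X_space \<sigma> \<Omega>" for y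
  proof -
    note [measurable] = X_space_measurable[OF y]
    have i: "set_integrable lborel \<Omega> (\<lambda>x. \<Lambda> / 2 * (y x)\<^sup>2)"
      by (intro set_integrable_mult_right set_integrable_sq X_space_sq_integrable[OF y])
    have e: "(\<lambda>x. G (y x)) = (\<lambda>x. \<Gamma> (y x) - \<Lambda> / 2 * (y x)\<^sup>2 + G 0)" by (simp add: \<Gamma>_def)
    show "set_integrable lborel \<Omega> (\<lambda>x. \<Gamma> (y x)) \<longleftrightarrow> finite_energy y"
    proof
      assume "set_integrable lborel \<Omega> (\<lambda>x. \<Gamma> (y x))"
      then show "finite_energy y" unfolding finite_energy_def e
        by (intro set_integral_add set_integral_diff set_integrable_const i)
    next
      assume "finite_energy y"
      then show "set_integrable lborel \<Omega> (\<lambda>x. \<Gamma> (y x))" unfolding finite_energy_def \<Gamma>_def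
        by (intro set_integral_add set_integral_diff set_integrable_const i)
    qed
    assume f: "finite_energy y"
    have "(LINT x:\<Omega>|lborel. \<Lambda> / 2 * (y x)\<^sup>2) = \<Lambda> / 2 * (LBINT x. (y x)\<^sup>2)"
      using LINT_\<Omega>_eq[OF y, of "\<lambda>x. \<Lambda> / 2 * y x"] by (simp add: power2_eq_square mult.assoc)
    then show "(LINT x:\<Omega>|lborel. \<Gamma> (y x)) = (LINT x:\<Omega>|lborel. G (y x)) + \<Lambda> / 2 * (LBINT x. (y x)\<^sup>2) - m"
      using f i set_integrable_const[of "G 0"] unfolding \<Gamma>_def m_def finite_energy_def
      by (simp add: set_integral_add set_integral_diff)
  qed
  \<comment> \<open>Upper bound for the integral of \<open>\<Gamma> (v n)\<close>: the energy bound,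
    with the squared norm replaced by its affine lower bound.\<close>
  define b where "b n = B - frac_form \<sigma> (v n) z + (X_norm \<sigma> z)\<^sup>2 / 2 + \<Lambda> / 2 * (LBINT x. (v n x)\<^sup>2) - m" for n
  have "(\<lambda>n. LBINT x. (v n x)\<^sup>2) \<longlonglongrightarrow> (LBINT x. (z x)\<^sup>2)"
  proof -
    have eq: "(LBINT x. (v n x)\<^sup>2) = (LBINT x. (v n x - z x)\<^sup>2) + 2 * (LBINT x. (v n x - z x) * z x) + (LBINT x. (z x)\<^sup>2)" for n
    proof -
      have d: "sq_integrable lborel (\<lambda>x. v n x - z x)"
        by (intro sq_integrable_diff X_space_sq_integrable[OF v(1)] X_space_sq_integrable[OF z])
      have "(LBINT x. (v n x)\<^sup>2) = (\<integral>x. (v n x - z x)\<^sup>2 + 2 * ((v n x - z x) * z x) + (z x)\<^sup>2 \<partial>lborel)"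
        by (rule Bochner_Integration.integral_cong) (auto simp: power2_eq_square algebra_simps)
      then show ?thesis
        using zi d sq_integrable_mult_integrable[OF d X_space_sq_integrable[OF z]] by (simp add: sq_integrable_def)
    qed
    have "(\<lambda>n. LBINT x. (v n x - z x) * z x) \<longlonglongrightarrow> 0"
    proof (rule Lim_null_comparison)
      show "\<forall>\<^sub>F n in sequentially. norm (LBINT x. (v n x - z x) * z x) \<le>
          sqrt (LBINT x. (v n x - z x)\<^sup>2) * sqrt (LBINT x. (z x)\<^sup>2)"
        unfolding real_norm_def
        by (intro always_eventually allI sq_integrable_Cauchy_Schwarz_abs sq_integrable_diff
            X_space_sq_integrable[OF v(1)] X_space_sq_integrable[OF z])
      show "(\<lambda>n. sqrt (LBINT x. (v n x - z x)\<^sup>2) * sqrt (LBINT x. (z x)\<^sup>2)) \<longlonglongrightarrow> 0"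
        by (rule tendsto_eq_intros L2 refl | simp)+
    qed
    from tendsto_add[OF tendsto_add[OF L2 tendsto_mult[OF tendsto_const[of 2] this]]
        tendsto_const[of "LBINT x. (z x)\<^sup>2"]]
    show ?thesis unfolding eq by simp
  qed
  then have b: "b \<longlonglongrightarrow> B - frac_form \<sigma> z z + (X_norm \<sigma> z)\<^sup>2 / 2 + \<Lambda> / 2 * (LBINT x. (z x)\<^sup>2) - m"
    unfolding b_def by (intro tendsto_intros X_space_weak_limit[OF \<sigma> v(1) zm lim K z])
  have vb: "(LINT x:\<Omega>|lborel. \<Gamma> (v n x)) \<le> b n" for n
  proof -
    have "0 \<le> (X_norm \<sigma> (\<lambda>x. v n x - z x))\<^sup>2" by simp
    then have "2 * frac_form \<sigma> (v n) z - (X_norm \<sigma> z)\<^sup>2 \<le> (X_norm \<sigma> (v n))\<^sup>2"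
      unfolding X_norm_square_diff[OF \<sigma> v(1) z] by simp
    then show ?thesis using v(3)[of n] \<Gamma>I(2)[OF v(1) v(2), of n] by (simp add: b_def real_energy_def)
  qed
  have F: "integrable lborel (\<lambda>x. indicator \<Omega> x *\<^sub>R \<Gamma> (z x))"
    "(LBINT x. indicator \<Omega> x *\<^sub>R \<Gamma> (z x)) \<le>
      B - frac_form \<sigma> z z + (X_norm \<sigma> z)\<^sup>2 / 2 + \<Lambda> / 2 * (LBINT x. (z x)\<^sup>2) - m"
  proof -
    have 1: "integrable lborel (\<lambda>x. indicator \<Omega> x *\<^sub>R \<Gamma> (v n x))" for n
      using \<Gamma>I(1)[OF v(1)] v(2) by (simp add: set_integrable_def)
    have 2: "AE x in lborel. 0 \<le> indicator \<Omega> x *\<^sub>R \<Gamma> (v n x)" for n by (simp add: \<Gamma>0)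
    have 3: "(\<lambda>x. indicator \<Omega> x *\<^sub>R \<Gamma> (z x)) \<in> borel_measurable lborel" by measurable
    have 4: "AE x in lborel. (\<lambda>n. indicator \<Omega> x *\<^sub>R \<Gamma> (v n x)) \<longlonglongrightarrow> indicator \<Omega> x *\<^sub>R \<Gamma> (z x)"
      using lim by eventually_elim (intro tendsto_intros isCont_tendsto_compose[OF \<Gamma>c])
    have 5: "(LBINT x. indicator \<Omega> x *\<^sub>R \<Gamma> (v n x)) \<le> b n" for n
      using vb[of n] by (simp add: set_lebesgue_integral_def)
    show "integrable lborel (\<lambda>x. indicator \<Omega> x *\<^sub>R \<Gamma> (z x))"
      "(LBINT x. indicator \<Omega> x *\<^sub>R \<Gamma> (z x)) \<le>
      B - frac_form \<sigma> z z + (X_norm \<sigma> z)\<^sup>2 / 2 + \<Lambda> / 2 * (LBINT x. (z x)\<^sup>2) - m"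
      using integrable_Fatou_lim[OF 1 2 3 4 5 b] by auto
  qed
  show fz: "finite_energy z" using F(1) \<Gamma>I(1)[OF z] by (simp add: set_integrable_def)
  show "real_energy z \<le> B"
    using F(2) \<Gamma>I(2)[OF z fz] X_norm_square[OF \<sigma>, of z] by (simp add: real_energy_def set_lebesgue_integral_def)
qed

section \<open>A priori bounds for the elliptic equation\<close>

lemma lambda1_Rayleigh:
  assumes v: "v \<in> X_space \<sigma> \<Omega>"
  shows "lambda1 \<sigma> \<Omega> * (LBINT x. (v x)\<^sup>2) \<le> (X_norm \<sigma> v)\<^sup>2"
proof (cases "AE x in lborel. v x = 0")
  case True
  then have "(LBINT x. (v x)\<^sup>2) = 0" by (intro integral_eq_zero_AE) auto
  then show ?thesis by simp
next
  case False
  note [measurable] = X_space_measurable[OF v]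
  have i: "integrable lborel (\<lambda>x. (v x)\<^sup>2)" using X_space_sq_integrable[OF v] by (simp add: sq_integrable_def)
  have "(LBINT x. (v x)\<^sup>2) \<noteq> 0"
    using False integral_nonneg_eq_0_iff_AE[OF i] by auto
  moreover have "0 \<le> (LBINT x. (v x)\<^sup>2)" by simp
  ultimately have pos: "0 < (LBINT x. (v x)\<^sup>2)" by linarith
  have L: "(L2_norm_on \<Omega> v)\<^sup>2 = (LBINT x. (v x)\<^sup>2)"
    using LINT_\<Omega>_eq[OF v, of v] by (simp add: L2_norm_on_def power2_eq_square flip: power2_eq_square)
  have "lambda1 \<sigma> \<Omega> \<le> (X_norm \<sigma> v)\<^sup>2 / (L2_norm_on \<Omega> v)\<^sup>2"
    unfolding lambda1_def using v False
    by (intro cINF_lower bdd_belowI2[of _ 0]) auto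
  then show ?thesis using pos by (simp add: L field_simps)
qed

text \<open>The limit inferior gives positivity outside a bounded set; on the remaining compact
  interval continuity gives a bound, which becomes the constant \<open>C\<close>.\<close>

lemma pointwise_coercivity:
  obtains \<kappa> C where "\<kappa> > 0" "C \<ge> 0" "\<And>r. - (lambda1 \<sigma> \<Omega> - \<kappa>) * r\<^sup>2 - C \<le> g r * r"
proof -
  obtain \<kappa> where \<kappa>: "\<kappa> > 0" "Liminf at_infinity (\<lambda>r. ereal (g r * r + (lambda1 \<sigma> \<Omega> - \<kappa>) * r\<^sup>2)) > 0"
    using coercive by blast
  define f where "f r = g r * r + (lambda1 \<sigma> \<Omega> - \<kappa>) * r\<^sup>2" for r
  have "\<forall>\<^sub>F r in at_infinity. ereal 0 < ereal (f r)"
    using less_LiminfD[OF \<kappa>(2)] by (simp add: f_def)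
  then obtain R where R: "\<And>r. R \<le> norm r \<Longrightarrow> 0 < f r" unfolding eventually_at_infinity by auto
  \<comment> \<open>The threshold \<open>R\<close> may be negative, hence the absolute
    values.\<close>
  have "continuous_on {-\<bar>R\<bar>..\<bar>R\<bar>} f" unfolding f_def
    by (intro continuous_intros continuous_on_subset[OF g_continuous]) auto
  then have "bounded (f ` {-\<bar>R\<bar>..\<bar>R\<bar>})" by (intro compact_imp_bounded compact_continuous_image) auto
  then obtain C where "\<forall>y\<in>f ` {-\<bar>R\<bar>..\<bar>R\<bar>}. norm y \<le> C" unfolding bounded_iff by blast
  then have C: "\<bar>f r\<bar> \<le> C" if "r \<in> {-\<bar>R\<bar>..\<bar>R\<bar>}" for r using that by auto
  have C0: "0 \<le> C" using C[of 0] by auto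
  have "- C \<le> f r" for r
  proof (cases "\<bar>r\<bar> \<le> \<bar>R\<bar>")
    case True
    then have "r \<in> {-\<bar>R\<bar>..\<bar>R\<bar>}" unfolding atLeastAtMost_iff by linarith
    from C[OF this] show ?thesis by linarith
  next
    case False
    then have "R \<le> norm r" by simp
    from R[OF this] show ?thesis using C0 by linarith
  qed
  then have "- (lambda1 \<sigma> \<Omega> - \<kappa>) * r\<^sup>2 - C \<le> g r * r" for r
    by (smt (verit) f_def mult_minus_left)
  then show ?thesis using that \<kappa>(1) C0 by blast
qed

text \<open>The equation is tested with \<open>v\<close>. The quadratic lower bound for
  \<open>g r * r\<close> has a coefficient strictly below the first eigenvalue, so a fixed fraction
  of the squared norm survives and absorbs the pairing with \<open>w\<close>.\<close>

lemma elliptic_bound: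
  obtains C where "\<And>v w. elliptic v w \<Longrightarrow> (X_norm \<sigma> v)\<^sup>2 \<le> C * (1 + (X_norm s w)\<^sup>2)"
proof -
  obtain \<kappa> C where C: "\<kappa> > 0" "C \<ge> 0" "\<And>r. - (lambda1 \<sigma> \<Omega> - \<kappa>) * r\<^sup>2 - C \<le> g r * r"
    by (rule pointwise_coercivity) (rule that)
  define l where "l = lambda1 \<sigma> \<Omega>"
  obtain P where P: "P > 0" "\<And>v. v \<in> X_space \<sigma> \<Omega> \<Longrightarrow> (LBINT x. (v x)\<^sup>2) \<le> P * (X_norm \<sigma> v)\<^sup>2"
    by (rule X_space_Poincare[OF \<sigma> \<Omega>(2)]) (rule that)
  obtain Q where Q: "Q > 0" "\<And>v. v \<in> X_space s \<Omega> \<Longrightarrow> (LBINT x. (v x)\<^sup>2) \<le> Q * (X_norm s v)\<^sup>2"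
    by (rule X_space_Poincare[OF s \<Omega>(2)]) (rule that)
  \<comment> \<open>The surviving fraction: for \<open>l \<le> \<kappa>\<close> the L2 term already
    has the right sign, otherwise the Rayleigh quotient leaves
    \<open>1 - (l - \<kappa>) / l = \<kappa> / l\<close>.\<close>
  define c where "c = (if l \<le> \<kappa> then 1 else \<kappa> / l)"
  have c: "c > 0" using C(1) by (auto simp: c_def)
  have coer: "c * (X_norm \<sigma> v)\<^sup>2 \<le> (X_norm \<sigma> v)\<^sup>2 - (l - \<kappa>) * (LBINT x. (v x)\<^sup>2)" if "v \<in> X_space \<sigma> \<Omega>" for v
  proof (cases "l \<le> \<kappa>")
    case True
    then show ?thesis by (simp add: c_def mult_nonpos_nonneg)
  next
    case False
    then have l: "l > 0" using C(1) by linarith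
    have "(LBINT x. (v x)\<^sup>2) \<le> (X_norm \<sigma> v)\<^sup>2 / l"
      using lambda1_Rayleigh[OF that] l by (simp add: l_def field_simps)
    then have "(l - \<kappa>) * (LBINT x. (v x)\<^sup>2) \<le> (l - \<kappa>) * ((X_norm \<sigma> v)\<^sup>2 / l)"
      using False by (intro mult_left_mono) auto
    then show ?thesis using False l by (simp add: c_def field_simps)
  qed
  define m where "m = (LINT x:\<Omega>|lborel. C)"
  have m: "0 \<le> m" unfolding m_def set_lebesgue_integral_def using C(2) by (intro integral_nonneg_AE) auto
  have "(X_norm \<sigma> v)\<^sup>2 \<le> (2 * m / c + P * Q / c\<^sup>2) * (1 + (X_norm s w)\<^sup>2)" if E: "elliptic v w" for v w
  proof -
    have v: "v \<in> X_space \<sigma> \<Omega>" "w \<in> X_space s \<Omega>" "sq_integrable lborel (\<lambda>x. g (v x))"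
      and eq: "(LBINT x. w x * v x) = frac_form \<sigma> v v + (LBINT x. g (v x) * v x)"
      using E by (auto simp: elliptic_def)
    note v2 = X_space_sq_integrable[OF v(1)]
    note [measurable] = X_space_measurable[OF v(1)]
    define x where "x = X_norm \<sigma> v"
    define y where "y = X_norm s w"
    have xy: "x \<ge> 0" "y \<ge> 0" by (auto simp: x_def y_def X_norm_nonneg[OF \<sigma>] X_norm_nonneg[OF s])
    have i: "set_integrable lborel \<Omega> (\<lambda>x. - (l - \<kappa>) * (v x)\<^sup>2)"
      by (intro set_integrable_mult_right set_integrable_sq v2)
    have "(LINT x:\<Omega>|lborel. - (l - \<kappa>) * (v x)\<^sup>2 - C) \<le> (LINT x:\<Omega>|lborel. g (v x) * v x)"
      using C(3) by (intro set_integral_mono set_integral_diff i set_integrable_const set_integrable_sq_mult v2 v)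
        (auto simp: l_def)
    then have "(LINT x:\<Omega>|lborel. - (l - \<kappa>) * (v x)\<^sup>2) - m \<le> (LBINT x. g (v x) * v x)"
      using i set_integrable_const[of C] LINT_\<Omega>_eq[OF v(1), of "\<lambda>x. g (v x)"]
      by (simp add: set_integral_diff m_def)
    moreover have "(LINT x:\<Omega>|lborel. (v x)\<^sup>2) = (LBINT x. (v x)\<^sup>2)"
      using LINT_\<Omega>_eq[OF v(1), of v] by (simp add: power2_eq_square)
    then have "(LINT x:\<Omega>|lborel. - (l - \<kappa>) * (v x)\<^sup>2) = - (l - \<kappa>) * (LBINT x. (v x)\<^sup>2)"
      by simp
    ultimately have 1: "c * x\<^sup>2 \<le> m + (LBINT x. w x * v x)"
      using coer[OF v(1)] eq X_norm_square[OF \<sigma>, of v] unfolding x_def by linarith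
    have "(LBINT x. w x * v x)\<^sup>2 \<le> (LBINT x. (w x)\<^sup>2) * (LBINT x. (v x)\<^sup>2)"
      by (intro sq_integrable_Cauchy_Schwarz v2 X_space_sq_integrable[OF v(2)])
    also have "\<dots> \<le> (Q * y\<^sup>2) * (P * x\<^sup>2)"
      using P(2)[OF v(1)] Q(2)[OF v(2)] Q(1) by (intro mult_mono) (auto simp: x_def y_def)
    finally have 2: "(LBINT x. w x * v x)\<^sup>2 \<le> (Q * y\<^sup>2) * (P * x\<^sup>2)" .
    \<comment> \<open>Young's inequality in the form \<open>4 * (A * B) \<le> (A + B)^2\<close>,
      weighted so that the term \<open>c * x^2\<close> can be absorbed on the left.\<close>
    have am: "2 * t \<le> c * x\<^sup>2 + P * Q * y\<^sup>2 / c" if t: "t\<^sup>2 \<le> (Q * y\<^sup>2) * (P * x\<^sup>2)" for t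
    proof (rule power2_le_imp_le)
      have "(2 * t)\<^sup>2 \<le> 4 * ((c * x\<^sup>2) * (P * Q * y\<^sup>2 / c))" using t c by (simp add: mult_ac)
      also have "\<dots> \<le> (c * x\<^sup>2 + P * Q * y\<^sup>2 / c)\<^sup>2"
      proof -
        have "4 * (A * B) \<le> (A + B)\<^sup>2" for A B :: real
          using zero_le_power2[of "A - B"] by (simp add: power2_eq_square algebra_simps)
        then show ?thesis .
      qed
      finally show "(2 * t)\<^sup>2 \<le> (c * x\<^sup>2 + P * Q * y\<^sup>2 / c)\<^sup>2" .
      show "0 \<le> c * x\<^sup>2 + P * Q * y\<^sup>2 / c" using c P Q by simp
    qed
    have "c * x\<^sup>2 \<le> 2 * m + P * Q * y\<^sup>2 / c" using 1 am[OF 2] by linarith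
    then have "x\<^sup>2 \<le> (2 * m + P * Q * y\<^sup>2 / c) / c" using c by (simp add: field_simps)
    also have "\<dots> = 2 * m / c + P * Q / c\<^sup>2 * y\<^sup>2" by (simp add: add_divide_distrib power2_eq_square)
    also have "\<dots> \<le> (2 * m / c + P * Q / c\<^sup>2) * (1 + y\<^sup>2)"
    proof -
      have "A + B * y\<^sup>2 \<le> (A + B) * (1 + y\<^sup>2)" if "0 \<le> A" "0 \<le> B" for A B
        using that mult_nonneg_nonneg[OF that(1) zero_le_power2[of y]] by (simp add: algebra_simps)
      moreover have "0 \<le> 2 * m / c" "0 \<le> P * Q / c\<^sup>2" using m c P(1) Q(1) by simp_all
      ultimately show ?thesis by blast
    qed
    finally show ?thesis by (simp add: x_def y_def)
  qed
  then show ?thesis by (rule that)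
qed

text \<open>\<open>g r + \<Lambda> * r\<close> is continuously differentiable, hence Lipschitz on
  the compact interval into which the truncation maps, and the truncation does not increase
  distances.\<close>

lemma beta_truncation_Lipschitz:
  obtains L where "\<And>p q. \<bar>(g (max (- k) (min k p)) + \<Lambda> * max (- k) (min k p)) -
      (g (max (- k) (min k q)) + \<Lambda> * max (- k) (min k q))\<bar> \<le> L * \<bar>p - q\<bar>"
proof -
  define \<beta> where "\<beta> r = g r + \<Lambda> * r" for r
  define T where "T r = max (- k) (min k r)" for r :: real
  define S where "S = {- \<bar>k\<bar>..\<bar>k\<bar>}"
  have d: "(\<beta> has_real_derivative deriv g r + \<Lambda>) (at r)" for r
    unfolding \<beta>_def by (auto intro!: derivative_eq_intros g_deriv)
  have "continuous_on S (\<lambda>r. deriv g r + \<Lambda>)"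
    by (intro continuous_intros continuous_on_subset[OF deriv_g_continuous]) auto
  then have "bounded ((\<lambda>r. deriv g r + \<Lambda>) ` S)"
    unfolding S_def by (intro compact_imp_bounded compact_continuous_image compact_Icc)
  then obtain L where "\<forall>y\<in>(\<lambda>r. deriv g r + \<Lambda>) ` S. norm y \<le> L" unfolding bounded_iff by blast
  then have L: "norm (deriv g r + \<Lambda>) \<le> L" if "r \<in> S" for r using that by blast
  have "0 \<in> S" by (simp add: S_def)
  from L[OF this] norm_ge_zero[of "deriv g 0 + \<Lambda>"] have L0: "0 \<le> L" by linarith
  have "\<bar>\<beta> (T p) - \<beta> (T q)\<bar> \<le> L * \<bar>p - q\<bar>" for p q
  proof -
    have "T p \<in> S" "T q \<in> S" by (auto simp: T_def S_def)
    then have "norm (\<beta> (T p) - \<beta> (T q)) \<le> L * norm (T p - T q)"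
      by (intro field_differentiable_bound[of S \<beta> "\<lambda>r. deriv g r + \<Lambda>"])
        (auto simp: S_def L[unfolded S_def real_norm_def] intro: has_field_derivative_at_within d)
    also have "\<dots> \<le> L * norm (p - q)"
      by (intro mult_left_mono L0) (auto simp: T_def max_def min_def)
    finally show ?thesis by simp
  qed
  then show ?thesis using that unfolding \<beta>_def T_def by blast
qed

text \<open>
  The equation is tested with \<open>\<beta>\<close> of a truncation of \<open>v\<close>, where \<open>\<beta> r = g r + \<Lambda> r\<close> is nondecreasing, so that
  the quadratic form contributes a nonnegative term.
\<close>

lemma elliptic_beta_bound:
  assumes "elliptic v w"
  shows "(LBINT x. (g (v x) + \<Lambda> * v x)\<^sup>2) \<le> (LBINT x. (w x + \<Lambda> * v x)\<^sup>2)"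
proof -
  have v: "v \<in> X_space \<sigma> \<Omega>" "w \<in> X_space s \<Omega>" "sq_integrable lborel (\<lambda>x. g (v x))"
    and eq: "\<And>z. z \<in> X_space \<sigma> \<Omega> \<Longrightarrow> (LBINT x. w x * z x) = frac_form \<sigma> v z + (LBINT x. g (v x) * z x)"
    using assms by (auto simp: elliptic_def)
  note [measurable] = X_space_measurable[OF v(1)] X_space_measurable[OF v(2)]
  note v2 = X_space_sq_integrable[OF v(1)] and w2 = X_space_sq_integrable[OF v(2)]
  define \<beta> where "\<beta> r = g r + \<Lambda> * r" for r
  have [measurable]: "\<beta> \<in> borel_measurable borel" unfolding \<beta>_def by measurable
  have \<beta>_mono: "\<beta> p \<le> \<beta> q" if "p \<le> q" for p q using beta_mono[OF that] by (simp add: \<beta>_def)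
  have \<beta>0: "\<beta> 0 = 0" by (simp add: \<beta>_def g0)
  have b2: "sq_integrable lborel (\<lambda>x. \<beta> (v x))"
    unfolding \<beta>_def by (intro sq_integrable_add sq_integrable_cmult v v2)
  have f2: "sq_integrable lborel (\<lambda>x. w x + \<Lambda> * v x)"
    by (intro sq_integrable_add sq_integrable_cmult w2 v2)
  \<comment> \<open>\<open>\<beta>\<close> need not be Lipschitz, so \<open>\<beta> (v x)\<close>
    may fail to be an admissible test function; cutting its argument off at \<open>k\<close> makes
    it one.\<close>
  define h where "h k r = \<beta> (max (- real k) (min (real k) r))" for k :: nat and r
  have [measurable]: "h k \<in> borel_measurable borel" for k unfolding h_def by measurable
  have h0: "h k 0 = 0" for k by (simp add: h_def \<beta>0)
  have hX: "(\<lambda>x. h k (v x)) \<in> X_space \<sigma> \<Omega>" for k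
  proof -
    obtain L where "\<And>p q. \<bar>(g (max (- real k) (min (real k) p)) + \<Lambda> * max (- real k) (min (real k) p)) -
        (g (max (- real k) (min (real k) q)) + \<Lambda> * max (- real k) (min (real k) q))\<bar> \<le> L * \<bar>p - q\<bar>"
      by (rule beta_truncation_Lipschitz[of "real k"]) (rule that)
    then have L: "\<bar>h k p - h k q\<bar> \<le> L * \<bar>p - q\<bar>" for p q unfolding h_def \<beta>_def .
    show ?thesis by (rule X_space_Lipschitz[OF \<sigma> v(1) _ h0 L]) simp
  qed
  \<comment> \<open>\<open>h k r\<close> lies between 0 and \<open>\<beta> r\<close>.\<close>
  have h_sq: "(h k r)\<^sup>2 \<le> \<beta> r * h k r" for k r
  proof (cases "r \<ge> 0")
    case True
    have "0 \<le> h k r" unfolding h_def using \<beta>_mono[of 0 "max (- real k) (min (real k) r)"] True by (simp add: \<beta>0)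
    moreover have "h k r \<le> \<beta> r" unfolding h_def by (rule \<beta>_mono) (use True in auto)
    ultimately show ?thesis by (simp add: power2_eq_square mult_right_mono)
  next
    case False
    have "h k r \<le> 0" unfolding h_def using \<beta>_mono[of "max (- real k) (min (real k) r)" 0] False by (simp add: \<beta>0)
    moreover have "\<beta> r \<le> h k r" unfolding h_def by (rule \<beta>_mono) (use False in auto)
    ultimately show ?thesis by (simp add: power2_eq_square mult_right_mono_neg)
  qed
  define M where "M = (LBINT x. (w x + \<Lambda> * v x)\<^sup>2)"
  have hM: "(LBINT x. (h k (v x))\<^sup>2) \<le> M" for k
  proof -
    note h2 = X_space_sq_integrable[OF hX[of k]]
    define I where "I = (LBINT x. (h k (v x))\<^sup>2)"
    have I0: "0 \<le> I" by (simp add: I_def)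
    have "mono (h k)" unfolding h_def by (intro monoI \<beta>_mono) (auto simp: max_def min_def)
    then have "0 \<le> frac_form \<sigma> v (\<lambda>x. h k (v x))" by (rule frac_form_mono_nonneg[OF \<sigma>])
    then have 1: "(LBINT x. g (v x) * h k (v x)) \<le> (LBINT x. w x * h k (v x))"
      using eq[OF hX[of k]] by simp
    have "I \<le> (LBINT x. \<beta> (v x) * h k (v x))"
      unfolding I_def using h2 sq_integrable_mult_integrable[OF b2 h2] h_sq
      by (intro integral_mono) (auto simp: sq_integrable_def)
    also have "\<dots> = (LBINT x. g (v x) * h k (v x)) + \<Lambda> * (LBINT x. v x * h k (v x))"
      using sq_integrable_mult_integrable[OF v(3) h2] sq_integrable_mult_integrable[OF v2 h2]
      by (simp add: \<beta>_def distrib_right mult.assoc)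
    also have "\<dots> \<le> (LBINT x. w x * h k (v x)) + \<Lambda> * (LBINT x. v x * h k (v x))"
      using 1 by simp
    also have "\<dots> = (LBINT x. (w x + \<Lambda> * v x) * h k (v x))"
      using sq_integrable_mult_integrable[OF w2 h2] sq_integrable_mult_integrable[OF v2 h2]
      by (simp add: distrib_right mult.assoc)
    finally have "I\<^sup>2 \<le> (LBINT x. (w x + \<Lambda> * v x) * h k (v x))\<^sup>2"
      using I0 by (intro power_mono)
    also have "\<dots> \<le> M * I" unfolding M_def I_def by (rule sq_integrable_Cauchy_Schwarz[OF f2 h2])
    finally have "I * I \<le> M * I" by (simp add: power2_eq_square)
    moreover have "0 \<le> M" by (simp add: M_def)
    ultimately show ?thesis using I0 unfolding I_def[symmetric] by (cases "I = 0") auto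
  qed
  \<comment> \<open>At each point the truncation is inactive for large \<open>k\<close>, so Fatou
    carries the uniform bound over to \<open>\<beta>\<close>.\<close>
  have lim: "AE x in lborel. (\<lambda>k. h k (v x)) \<longlonglongrightarrow> \<beta> (v x)"
  proof (rule AE_I2)
    fix x
    obtain K :: nat where K: "\<bar>v x\<bar> < real K" using reals_Archimedean2 by blast
    have "h k (v x) = \<beta> (v x)" if "k \<ge> K" for k
    proof -
      have "\<bar>v x\<bar> \<le> real k" using K that by linarith
      then have "max (- real k) (min (real k) (v x)) = v x" by (auto simp: max_def min_def)
      then show ?thesis by (simp add: h_def)
    qed
    then show "(\<lambda>k. h k (v x)) \<longlonglongrightarrow> \<beta> (v x)"
      by (intro tendsto_eventually) (auto simp: eventually_sequentially)
  qed
  have "(\<lambda>x. \<beta> (v x)) \<in> borel_measurable lborel" by measurable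
  from sq_integrable_Fatou(2)[OF X_space_sq_integrable[OF hX] this lim hM]
  show ?thesis by (simp add: M_def \<beta>_def)
qed

text \<open>Undoes the shift by \<open>\<Lambda> * v\<close> on both sides: of the coefficient 6,
  the right-hand side of \<open>elliptic_beta_bound\<close> contributes 4 and the left-hand side 2.
  This is the bound that permits the limit in the nonlinear term.\<close>

lemma elliptic_nonlinearity_bound:
  assumes "elliptic v w"
  shows "(LBINT x. (g (v x))\<^sup>2) \<le> 4 * (LBINT x. (w x)\<^sup>2) + 6 * \<Lambda>\<^sup>2 * (LBINT x. (v x)\<^sup>2)"
proof -
  have v: "v \<in> X_space \<sigma> \<Omega>" "w \<in> X_space s \<Omega>" "sq_integrable lborel (\<lambda>x. g (v x))"
    using assms by (auto simp: elliptic_def)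
  note v2 = X_space_sq_integrable[OF v(1)] and w2 = X_space_sq_integrable[OF v(2)]
  have "(LBINT x. (g (v x))\<^sup>2) = (LBINT x. ((g (v x) + \<Lambda> * v x) + (- \<Lambda>) * v x)\<^sup>2)" by simp
  also have "\<dots> \<le> 2 * (LBINT x. (g (v x) + \<Lambda> * v x)\<^sup>2) + 2 * (LBINT x. ((- \<Lambda>) * v x)\<^sup>2)"
    by (intro integral_square_add_le sq_integrable_add sq_integrable_cmult v v2)
  also have "(LBINT x. (g (v x) + \<Lambda> * v x)\<^sup>2) \<le> (LBINT x. (w x + \<Lambda> * v x)\<^sup>2)"
    by (rule elliptic_beta_bound[OF assms])
  also have "\<dots> \<le> 2 * (LBINT x. (w x)\<^sup>2) + 2 * (LBINT x. (\<Lambda> * v x)\<^sup>2)"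
    by (intro integral_square_add_le sq_integrable_add sq_integrable_cmult w2 v2)
  finally show ?thesis by (simp add: power_mult_distrib)
qed

text \<open>The difference of the equations is tested with the difference of the solutions, and
  semimonotonicity costs only \<open>\<Lambda> * D\<close>. For bounded right-hand sides the bound
  tends to 0 with \<open>D\<close>, which upgrades L2 Cauchy sequences to Cauchy sequences in the
  energy norm.\<close>

lemma elliptic_difference_bound:
  assumes 1: "elliptic v1 w1" and 2: "elliptic v2 w2"
  defines "D \<equiv> (LBINT x. (v1 x - v2 x)\<^sup>2)"
  shows "(X_norm \<sigma> (\<lambda>x. v1 x - v2 x))\<^sup>2 \<le> sqrt (LBINT x. (w1 x - w2 x)\<^sup>2) * sqrt D + \<Lambda> * D"
proof -
  have v: "v1 \<in> X_space \<sigma> \<Omega>" "w1 \<in> X_space s \<Omega>" "sq_integrable lborel (\<lambda>x. g (v1 x))"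
    "v2 \<in> X_space \<sigma> \<Omega>" "w2 \<in> X_space s \<Omega>" "sq_integrable lborel (\<lambda>x. g (v2 x))"
    and eq: "\<And>z. z \<in> X_space \<sigma> \<Omega> \<Longrightarrow> (LBINT x. w1 x * z x) = frac_form \<sigma> v1 z + (LBINT x. g (v1 x) * z x)"
      "\<And>z. z \<in> X_space \<sigma> \<Omega> \<Longrightarrow> (LBINT x. w2 x * z x) = frac_form \<sigma> v2 z + (LBINT x. g (v2 x) * z x)"
    using assms by (auto simp: elliptic_def)
  define d where "d = (\<lambda>x. v1 x - v2 x)"
  have d: "d \<in> X_space \<sigma> \<Omega>" unfolding d_def by (rule X_space_diff[OF v(1) v(4)])
  note d2 = X_space_sq_integrable[OF d]
  note i = sq_integrable_mult_integrable[OF X_space_sq_integrable[OF v(2)] d2]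
    sq_integrable_mult_integrable[OF X_space_sq_integrable[OF v(5)] d2]
    sq_integrable_mult_integrable[OF v(3) d2] sq_integrable_mult_integrable[OF v(6) d2]
  have D: "D = (LBINT x. (d x)\<^sup>2)" by (simp add: D_def d_def)
  have "(X_norm \<sigma> d)\<^sup>2 = frac_form \<sigma> v1 d - frac_form \<sigma> v2 d"
    using frac_form_diff_left[OF v(1,4) d] by (simp add: X_norm_square[OF \<sigma>] flip: d_def)
  also have "\<dots> = (LBINT x. (w1 x - w2 x) * d x) - (LBINT x. (g (v1 x) - g (v2 x)) * d x)"
    using eq(1)[OF d] eq(2)[OF d] i by (simp add: left_diff_distrib)
  finally have "(X_norm \<sigma> d)\<^sup>2 = \<dots>" .
  moreover have "- (\<Lambda> * D) \<le> (LBINT x. (g (v1 x) - g (v2 x)) * d x)"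
  proof -
    have "(\<integral>x. - \<Lambda> * (d x)\<^sup>2 \<partial>lborel) \<le> (LBINT x. (g (v1 x) - g (v2 x)) * d x)"
    proof (rule integral_mono)
      show "integrable lborel (\<lambda>x. - \<Lambda> * (d x)\<^sup>2)" using d2 by (simp add: sq_integrable_def)
      show "integrable lborel (\<lambda>x. (g (v1 x) - g (v2 x)) * d x)" using i by (simp add: left_diff_distrib)
      show "- \<Lambda> * (d x)\<^sup>2 \<le> (g (v1 x) - g (v2 x)) * d x" for x
        unfolding d_def by (rule g_semimonotone)
    qed
    then show ?thesis by (simp add: D)
  qed
  moreover have "(LBINT x. (w1 x - w2 x) * d x) \<le> sqrt (LBINT x. (w1 x - w2 x)\<^sup>2) * sqrt D"
    unfolding D by (rule order_trans[OF abs_ge_self])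
      (intro sq_integrable_Cauchy_Schwarz_abs sq_integrable_diff d2 X_space_sq_integrable[OF v(2)] X_space_sq_integrable[OF v(5)])
  ultimately have "(X_norm \<sigma> d)\<^sup>2 \<le> sqrt (LBINT x. (w1 x - w2 x)\<^sup>2) * sqrt D + \<Lambda> * D" by linarith
  then show ?thesis by (simp add: d_def)
qed

lemma elliptic_compactness:
  fixes v w :: "nat \<Rightarrow> real ^ 'n \<Rightarrow> real"
  assumes E: "\<And>n. elliptic (v n) (w n)" and w0: "(\<lambda>n. X_norm s (w n)) \<longlonglongrightarrow> 0"
  obtains r :: "nat \<Rightarrow> nat" and \<phi> where "strict_mono r" "elliptic \<phi> (\<lambda>x. 0)"
    "(\<lambda>n. X_norm \<sigma> (\<lambda>x. v (r n) x - \<phi> x)) \<longlonglongrightarrow> 0"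
proof -
  have vX: "v n \<in> X_space \<sigma> \<Omega>" and wX: "w n \<in> X_space s \<Omega>" and gv: "sq_integrable lborel (\<lambda>x. g (v n x))"
    and eq: "\<And>z. z \<in> X_space \<sigma> \<Omega> \<Longrightarrow>
      (LBINT x. w n x * z x) = frac_form \<sigma> (v n) z + (LBINT x. g (v n x) * z x)" for n
    using E[of n] by (auto simp: elliptic_def)
  note v2 = X_space_sq_integrable[OF vX] and w2 = X_space_sq_integrable[OF wX]
  obtain P where P: "P > 0" "\<And>v. v \<in> X_space \<sigma> \<Omega> \<Longrightarrow> (LBINT x. (v x)\<^sup>2) \<le> P * (X_norm \<sigma> v)\<^sup>2"
    by (rule X_space_Poincare[OF \<sigma> \<Omega>(2)]) (rule that)
  obtain Q where Q: "Q > 0" "\<And>v. v \<in> X_space s \<Omega> \<Longrightarrow> (LBINT x. (v x)\<^sup>2) \<le> Q * (X_norm s v)\<^sup>2"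
    by (rule X_space_Poincare[OF s \<Omega>(2)]) (rule that)
  have "bounded (range (\<lambda>n. X_norm s (w n)))"
    using w0 convergent_imp_bounded by blast
  then obtain W where W: "\<And>n. X_norm s (w n) \<le> W"
    unfolding bounded_iff by (auto dest: spec) (metis abs_le_D1)
  have W0: "0 \<le> W" using W[of 0] X_norm_nonneg[OF s, of "w 0"] by linarith
  have W2: "(X_norm s (w n))\<^sup>2 \<le> W\<^sup>2" for n by (intro power_mono W X_norm_nonneg[OF s])
  have wL2: "(LBINT x. (w n x)\<^sup>2) \<le> Q * W\<^sup>2" for n
    using Q(2)[OF wX[of n]] mult_left_mono[OF W2[of n], of Q] Q(1) by linarith
  obtain C where C: "\<And>v w. elliptic v w \<Longrightarrow> (X_norm \<sigma> v)\<^sup>2 \<le> C * (1 + (X_norm s w)\<^sup>2)"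
    by (rule elliptic_bound) (rule that)
  define K where "K = sqrt (\<bar>C\<bar> * (1 + W\<^sup>2))"
  have K2: "K\<^sup>2 = \<bar>C\<bar> * (1 + W\<^sup>2)" by (simp add: K_def)
  have vK2: "(X_norm \<sigma> (v n))\<^sup>2 \<le> K\<^sup>2" for n
  proof -
    have "(X_norm \<sigma> (v n))\<^sup>2 \<le> C * (1 + (X_norm s (w n))\<^sup>2)" by (rule C[OF E])
    also have "\<dots> \<le> \<bar>C\<bar> * (1 + W\<^sup>2)" using W2[of n] by (intro mult_mono) auto
    finally show ?thesis by (simp add: K2)
  qed
  have K0: "0 \<le> K" by (simp add: K_def)
  have vK: "X_norm \<sigma> (v n) \<le> K" for n using vK2[of n] K0 power2_le_imp_le by blast
  have vL2: "(LBINT x. (v n x)\<^sup>2) \<le> P * K\<^sup>2" for n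
    using P(2)[OF vX[of n]] mult_left_mono[OF vK2[of n], of P] P(1) by linarith
  obtain r1 :: "nat \<Rightarrow> nat" where r1: "strict_mono r1"
    "\<And>e. e > 0 \<Longrightarrow> \<exists>N. \<forall>i\<ge>N. \<forall>j\<ge>N. (LBINT x. (v (r1 i) x - v (r1 j) x)\<^sup>2) < e"
    by (rule X_space_compact[OF \<sigma> \<Omega> vX vK]) (rule that)
  obtain r2 where r2: "strict_mono r2" "AE x in lborel. Cauchy (\<lambda>i. v (r1 (r2 i)) x)"
    using L2_Cauchy_AE_subseq[of \<Omega> lborel "\<lambda>i. v (r1 i)"] \<Omega>_finite v2 X_space_AE_zero[OF vX] r1(2) by auto
  define r where "r = r1 \<circ> r2"
  have r: "strict_mono r" unfolding r_def by (rule strict_mono_o[OF r1(1) r2(1)])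
  define z where "z i = v (r i)" for i
  have z: "z i \<in> X_space \<sigma> \<Omega>" for i by (simp add: z_def vX)
  note z2 = X_space_sq_integrable[OF z]
  note [measurable] = X_space_measurable[OF z]
  have zC: "\<exists>N. \<forall>i\<ge>N. \<forall>j\<ge>N. (LBINT x. (z i x - z j x)\<^sup>2) < e" if e: "e > 0" for e
  proof -
    obtain N where N: "\<And>i j. i \<ge> N \<Longrightarrow> j \<ge> N \<Longrightarrow> (LBINT x. (v (r1 i) x - v (r1 j) x)\<^sup>2) < e"
      using r1(2)[OF e] by blast
    have "r2 i \<ge> N" if "i \<ge> N" for i using seq_suble[OF r2(1), of i] that by simp
    then show ?thesis unfolding z_def r_def o_def by (intro exI[of _ N] allI impI N)
  qed
  \<comment> \<open>A Borel function defined everywhere, which is the actual limit only almost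
    everywhere.\<close>
  define \<phi> where "\<phi> x = lim (\<lambda>i. z i x)" for x
  have \<phi>m: "\<phi> \<in> borel_measurable borel" unfolding \<phi>_def by measurable
  have lim: "AE x in lborel. (\<lambda>i. z i x) \<longlonglongrightarrow> \<phi> x"
    using r2(2)
  proof eventually_elim
    case (elim x)
    then show ?case by (simp add: \<phi>_def z_def r_def Cauchy_convergent_iff convergent_LIMSEQ_iff)
  qed
  have zK: "X_norm \<sigma> (z i) \<le> K" for i unfolding z_def by (rule vK)
  have zL2: "(LBINT x. (z i x)\<^sup>2) \<le> P * K\<^sup>2" for i unfolding z_def by (rule vL2)
  have \<phi>: "\<phi> \<in> X_space \<sigma> \<Omega>" by (rule X_space_Fatou(1)[OF \<sigma> z \<phi>m lim zL2 zK])
  have XC: "\<exists>N. \<forall>i\<ge>N. \<forall>j\<ge>N. X_norm \<sigma> (\<lambda>x. z i x - z j x) \<le> e" if e: "e > 0" for e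
  proof -
    define A where "A = sqrt (4 * (Q * W\<^sup>2))"
    have wA: "sqrt (LBINT x. (w (r i) x - w (r j) x)\<^sup>2) \<le> A" for i j
    proof -
      have "(LBINT x. (w (r i) x + (-1) * w (r j) x)\<^sup>2) \<le>
          2 * (LBINT x. (w (r i) x)\<^sup>2) + 2 * (LBINT x. ((-1) * w (r j) x)\<^sup>2)"
        by (intro integral_square_add_le sq_integrable_cmult w2)
      then show ?thesis using wL2[of "r i"] wL2[of "r j"] by (simp add: A_def)
    qed
    have A0: "0 \<le> A" using Q by (simp add: A_def)
    \<comment> \<open>Right continuity at 0 yields the threshold \<delta>; the filter excludes
      \<open>D = 0\<close>, which is treated separately below.\<close>
    have "((\<lambda>D. A * sqrt D + \<Lambda> * D) \<longlongrightarrow> A * sqrt 0 + \<Lambda> * 0) (at_right 0)"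
      by (intro tendsto_intros)
    then have "\<forall>\<^sub>F D in at_right 0. A * sqrt D + \<Lambda> * D < e\<^sup>2"
      using e by (intro order_tendstoD(2)) auto
    then obtain \<delta> where \<delta>: "\<delta> > 0" "\<And>D. 0 < D \<Longrightarrow> D < \<delta> \<Longrightarrow> A * sqrt D + \<Lambda> * D < e\<^sup>2"
      unfolding eventually_at_right_field by auto
    obtain N where N: "\<And>i j. i \<ge> N \<Longrightarrow> j \<ge> N \<Longrightarrow> (LBINT x. (z i x - z j x)\<^sup>2) < \<delta>"
      using zC[OF \<delta>(1)] by blast
    have "X_norm \<sigma> (\<lambda>x. z i x - z j x) \<le> e" if ij: "i \<ge> N" "j \<ge> N" for i j
    proof (rule power2_le_imp_le)
      define D where "D = (LBINT x. (z i x - z j x)\<^sup>2)"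
      have D0: "0 \<le> D" by (simp add: D_def)
      have "(X_norm \<sigma> (\<lambda>x. z i x - z j x))\<^sup>2 \<le> sqrt (LBINT x. (w (r i) x - w (r j) x)\<^sup>2) * sqrt D + \<Lambda> * D"
        unfolding z_def D_def by (rule elliptic_difference_bound[OF E E])
      also have "\<dots> \<le> A * sqrt D + \<Lambda> * D"
        using D0 by (intro add_right_mono mult_right_mono wA) auto
      also have "\<dots> \<le> e\<^sup>2"
      proof (cases "D = 0")
        case False
        then have "0 < D" using D0 by linarith
        moreover have "D < \<delta>" using N[OF ij] by (simp add: D_def)
        ultimately show ?thesis by (rule less_imp_le[OF \<delta>(2)])
      qed simp
      finally show "(X_norm \<sigma> (\<lambda>x. z i x - z j x))\<^sup>2 \<le> e\<^sup>2" .
    qed (use e in simp)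
    then show ?thesis by blast
  qed
  have strong: "(\<lambda>i. X_norm \<sigma> (\<lambda>x. z i x - \<phi> x)) \<longlonglongrightarrow> 0"
  proof (rule LIMSEQ_I)
    fix e :: real assume e: "e > 0"
    obtain N where N: "\<And>i j. i \<ge> N \<Longrightarrow> j \<ge> N \<Longrightarrow> X_norm \<sigma> (\<lambda>x. z i x - z j x) \<le> e / 2"
      using XC[of "e / 2"] e by auto
    \<comment> \<open>The limit is already known, so instead of completeness it suffices to let the
      second index tend to infinity by lower semicontinuity of the norm.\<close>
    have "X_norm \<sigma> (\<lambda>x. z i x - \<phi> x) \<le> e / 2" if i: "i \<ge> N" for i
    proof (rule X_space_Fatou(2)[OF \<sigma>])
      show d: "(\<lambda>x. z i x - z (j + N) x) \<in> X_space \<sigma> \<Omega>" for j by (intro X_space_diff z)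
      show n: "X_norm \<sigma> (\<lambda>x. z i x - z (j + N) x) \<le> e / 2" for j using N[OF i, of "j + N"] by simp
      show "(\<lambda>x. z i x - \<phi> x) \<in> borel_measurable borel" using \<phi>m by measurable
      show "AE x in lborel. (\<lambda>j. z i x - z (j + N) x) \<longlonglongrightarrow> z i x - \<phi> x"
        using lim by eventually_elim (intro tendsto_intros LIMSEQ_ignore_initial_segment)
      show "(LBINT x. (z i x - z (j + N) x)\<^sup>2) \<le> P * (e / 2)\<^sup>2" for j
        using P(2)[OF d[of j]] mult_left_mono[OF power_mono[OF n[of j] X_norm_nonneg[OF \<sigma>], of 2], of P] P(1)
        by linarith
    qed
    then have "norm (X_norm \<sigma> (\<lambda>x. z i x - \<phi> x) - 0) < e" if "i \<ge> N" for i
      using that e X_norm_nonneg[OF \<sigma>, of "\<lambda>x. z i x - \<phi> x"] by fastforce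
    then show "\<exists>N. \<forall>i\<ge>N. norm (X_norm \<sigma> (\<lambda>x. z i x - \<phi> x) - 0) < e" by blast
  qed
  \<comment> \<open>Uniform bound for the squared L2 norms of the nonlinear terms; with almost
    everywhere convergence it identifies their weak limit as \<open>g (\<phi> x)\<close>.\<close>
  define B where "B = 4 * (Q * W\<^sup>2) + 6 * \<Lambda>\<^sup>2 * (P * K\<^sup>2)"
  have gB: "(LBINT x. (g (z i x))\<^sup>2) \<le> B" for i
  proof -
    have "(LBINT x. (g (z i x))\<^sup>2) \<le> 4 * (LBINT x. (w (r i) x)\<^sup>2) + 6 * \<Lambda>\<^sup>2 * (LBINT x. (z i x)\<^sup>2)"
      unfolding z_def by (rule elliptic_nonlinearity_bound[OF E])
    also have "\<dots> \<le> B" unfolding B_def by (intro add_mono mult_left_mono wL2 zL2) auto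
    finally show ?thesis .
  qed
  have gz: "sq_integrable lborel (\<lambda>x. g (z i x))" for i by (simp add: z_def gv)
  have g\<phi>m: "(\<lambda>x. g (\<phi> x)) \<in> borel_measurable lborel" using \<phi>m by measurable
  have glim: "AE x in lborel. (\<lambda>i. g (z i x)) \<longlonglongrightarrow> g (\<phi> x)"
    using lim by eventually_elim (rule isCont_tendsto_compose[OF DERIV_isCont[OF g_deriv]])
  have "elliptic \<phi> (\<lambda>x. 0)"
    unfolding elliptic_def
  proof (intro conjI ballI)
    show "sq_integrable lborel (\<lambda>x. g (\<phi> x))" by (rule sq_integrable_Fatou(1)[OF gz g\<phi>m glim gB])
    fix y assume y: "y \<in> X_space \<sigma> \<Omega>"
    note y2 = X_space_sq_integrable[OF y]
    have 1: "(\<lambda>i. frac_form \<sigma> (z i) y) \<longlonglongrightarrow> frac_form \<sigma> \<phi> y"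
      by (rule X_space_weak_limit[OF \<sigma> z \<phi>m lim zK y])
    have 2: "(\<lambda>i. LBINT x. g (z i x) * y x) \<longlonglongrightarrow> (LBINT x. g (\<phi> x) * y x)"
      by (rule sq_integrable_weak_limit[OF gz g\<phi>m glim gB y2])
    have 3: "(\<lambda>i. LBINT x. w (r i) x * y x) \<longlonglongrightarrow> 0"
    proof (rule Lim_null_comparison)
      show "\<forall>\<^sub>F i in sequentially. norm (LBINT x. w (r i) x * y x) \<le>
          sqrt Q * X_norm s (w (r i)) * sqrt (LBINT x. (y x)\<^sup>2)"
      proof (intro always_eventually allI)
        fix i
        have "\<bar>\<integral>x. w (r i) x * y x \<partial>lborel\<bar> \<le> sqrt (LBINT x. (w (r i) x)\<^sup>2) * sqrt (LBINT x. (y x)\<^sup>2)"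
          by (rule sq_integrable_Cauchy_Schwarz_abs[OF w2 y2])
        also have "\<dots> \<le> sqrt (Q * (X_norm s (w (r i)))\<^sup>2) * sqrt (LBINT x. (y x)\<^sup>2)"
          by (intro mult_right_mono real_sqrt_le_mono Q(2) wX) simp
        finally show "norm (LBINT x. w (r i) x * y x) \<le> sqrt Q * X_norm s (w (r i)) * sqrt (LBINT x. (y x)\<^sup>2)"
          by (simp add: real_sqrt_mult X_norm_nonneg[OF s])
      qed
      show "(\<lambda>i. sqrt Q * X_norm s (w (r i)) * sqrt (LBINT x. (y x)\<^sup>2)) \<longlonglongrightarrow> 0"
        using LIMSEQ_subseq_LIMSEQ[OF w0 r] by (auto intro!: tendsto_eq_intros simp: o_def)
    qed
    have "(\<lambda>i. LBINT x. w (r i) x * y x) \<longlonglongrightarrow> frac_form \<sigma> \<phi> y + (LBINT x. g (\<phi> x) * y x)"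
      using tendsto_add[OF 1 2] eq[OF y, of "r _"] by (simp add: z_def)
    then show "(LBINT x. 0 * y x) = frac_form \<sigma> \<phi> y + (LBINT x. g (\<phi> x) * y x)"
      using LIMSEQ_unique[OF 3] by simp
  qed (auto simp: \<phi> X_space_zero)
  then show ?thesis using that[OF r] strong by (simp add: z_def)
qed

end

section \<open>Weak solutions\<close>

locale cahn_hilliard_solution = cahn_hilliard \<Omega> s \<sigma> \<Lambda> g G
  for \<Omega> :: "(real ^ 'n) set" and s \<sigma> \<Lambda> g G +
  fixes u w :: "real \<Rightarrow> real ^ 'n \<Rightarrow> real"
  assumes solution: "weak_solution \<Omega> s \<sigma> g 0 \<infinity> u w"
begin

section \<open>The dissipation and the times at which the equation holds\<close>

definition W :: "real \<Rightarrow> real" where "W t = X_norm s (w t)"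

text \<open>Cumulative form, so that bounds over successive time windows telescope.\<close>

definition dissipation :: "real \<Rightarrow> real" where
  "dissipation x = (\<integral>t. indicator {..x} t * (W t)\<^sup>2 \<partial>lebesgue_on {0<..})"

lemma time_interval_eq: "time_interval 0 \<infinity> = {0<..}"
  by (auto simp: time_interval_def)

lemma u_X_space: "0 \<le> t \<Longrightarrow> u t \<in> X_space \<sigma> \<Omega>"
  using solution by (auto simp: weak_solution_def weakly_continuous_X_def)

lemma W_nonneg: "0 \<le> W t"
  by (simp add: W_def X_norm_nonneg[OF s])

lemma W_sq_integrable: "sq_integrable (lebesgue_on {0<..}) W"
proof -
  have i: "integrable (lebesgue_on {0<..}) (\<lambda>t. (W t)\<^sup>2)"
    using solution by (simp add: weak_solution_def L2_time_def time_interval_eq W_def)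
  then have "(\<lambda>t. sqrt ((W t)\<^sup>2)) \<in> borel_measurable (lebesgue_on {0<..})" by measurable
  then show ?thesis using i by (simp add: sq_integrable_def W_nonneg)
qed

text \<open>Collects the almost everywhere statements contained in the notion of weak solution. On
  the infinite time interval \<open>g(u)\<close> is only locally square integrable, so countably
  many exceptional sets, one for each bounded interval, are united.\<close>

lemma AE_elliptic: "AE t in lebesgue_on {0<..}. elliptic (u t) (w t)"
proof -
  have L: "{0<..} \<inter> space lebesgue \<in> sets (lebesgue :: real measure)"
    "{0<..<b} \<inter> space lebesgue \<in> sets (lebesgue :: real measure)" for b :: real by auto
  have w: "AE t in lebesgue_on {0<..}. w t \<in> X_space s \<Omega>"
    using solution by (simp add: weak_solution_def L2_time_def time_interval_eq)
  have "AE t in lebesgue_on {0<..<b}. (\<lambda>x. g (u t x)) \<in> L2_space \<Omega>" if "b > 0" for b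
    using solution that by (simp add: weak_solution_def L2_loc_time_def L2_time_def)
  from this[of "real (Suc _)"]
  have "AE t in lebesgue. t \<in> {0<..<real (Suc n)} \<longrightarrow> (\<lambda>x. g (u t x)) \<in> L2_space \<Omega>" for n
    unfolding AE_restrict_space_iff[OF L(2)] by simp
  then have "AE t in lebesgue. \<forall>n. t \<in> {0<..<real (Suc n)} \<longrightarrow> (\<lambda>x. g (u t x)) \<in> L2_space \<Omega>"
    unfolding AE_all_countable by blast
  then have "AE t in lebesgue. t \<in> {0<..} \<longrightarrow> (\<lambda>x. g (u t x)) \<in> L2_space \<Omega>"
  proof eventually_elim
    case (elim t)
    obtain n :: nat where "t < real n" using reals_Archimedean2 by blast
    then show ?case using elim[rule_format, of n] by auto
  qed
  then have g: "AE t in lebesgue_on {0<..}. (\<lambda>x. g (u t x)) \<in> L2_space \<Omega>"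
    unfolding AE_restrict_space_iff[OF L(1)] .
  have "AE t in lebesgue_on {0<..}. \<forall>v\<in>X_space \<sigma> \<Omega>. L2_functional \<Omega> (w t) v =
        frac_form \<sigma> (u t) v + L2_functional \<Omega> (\<lambda>x. g (u t x)) v"
    using solution unfolding weak_solution_def time_interval_eq by blast
  moreover have "AE t in lebesgue_on {0<..}. t \<in> {0 :: real<..}" unfolding AE_restrict_space_iff[OF L(1)] by simp
  ultimately show ?thesis using w g
  proof eventually_elim
    case (elim t)
    then have ut: "u t \<in> X_space \<sigma> \<Omega>" by (intro u_X_space) auto
    note [measurable] = X_space_measurable[OF ut] X_space_measurable[OF elim(3)]
    have gu: "(\<lambda>x. g (u t x)) \<in> borel_measurable borel" by measurable
    have "sq_integrable lborel (\<lambda>x. g (u t x))"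
      using elim(4) L2_space_compose_iff[OF ut g_continuous g0 \<Omega>(1)] by simp
    moreover have "(LBINT x. w t x * z x) = frac_form \<sigma> (u t) z + (LBINT x. g (u t x) * z x)"
      if z: "z \<in> X_space \<sigma> \<Omega>" for z
      using elim(1)[rule_format, OF z] L2_functional_eq[OF z gu \<Omega>(1)]
        L2_functional_eq[OF z X_space_measurable[OF elim(3)] \<Omega>(1)] by simp
    ultimately show ?case unfolding elliptic_def using ut elim(3) by blast
  qed
qed

lemma interval_integrable:
  assumes "A \<in> sets borel"
  shows "integrable (lebesgue_on {0<..}) (\<lambda>t. indicator A t * (W t)\<^sup>2)"
proof -
  have "integrable (lebesgue_on {0<..}) (\<lambda>t. (W t)\<^sup>2)" using W_sq_integrable by (simp add: sq_integrable_def)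
  moreover have "A \<inter> {0<..} \<in> sets (lebesgue_on {0<..})"
    using assms by (auto simp: sets_restrict_space_iff intro!: image_eqI[of _ _ A])
  ultimately have "integrable (lebesgue_on {0<..}) (\<lambda>t. indicator (A \<inter> {0<..}) t *\<^sub>R (W t)\<^sup>2)"
    by (intro integrable_mult_indicator)
  moreover have "integrable (lebesgue_on {0<..}) (\<lambda>t. indicator A t * (W t)\<^sup>2) \<longleftrightarrow>
      integrable (lebesgue_on {0<..}) (\<lambda>t. indicator (A \<inter> {0<..}) t *\<^sub>R (W t)\<^sup>2)"
    by (rule Bochner_Integration.integrable_cong) (auto simp: indicator_def)
  ultimately show ?thesis by simp
qed

lemma dissipation_diff:
  assumes "a \<le> b"
  shows "(\<integral>t. indicator {a..b} t * (W t)\<^sup>2 \<partial>lebesgue_on {0<..}) = dissipation b - dissipation a"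
proof -
  have "dissipation b - dissipation a = (\<integral>t. indicator {..b} t * (W t)\<^sup>2 - indicator {..a} t * (W t)\<^sup>2 \<partial>lebesgue_on {0<..})"
    unfolding dissipation_def by (intro Bochner_Integration.integral_diff[symmetric] interval_integrable) auto
  also have "\<dots> = (\<integral>t. indicator {a..b} t * (W t)\<^sup>2 \<partial>lebesgue_on {0<..})"
  \<comment> \<open>The difference of the indicators belongs to the half-open interval from
    \<open>a\<close> to \<open>b\<close>; the endpoint \<open>a\<close> is a null set.\<close>
  proof (rule integral_cong_AE)
    have "AE t in lebesgue. t \<noteq> a" by (rule AE_completion[OF AE_lborel_singleton])
    then have "AE t in lebesgue_on {0<..}. t \<noteq> a" by (subst AE_restrict_space_iff) (auto elim!: eventually_mono)
    then show "AE t in lebesgue_on {0<..}. indicator {..b} t * (W t)\<^sup>2 - indicator {..a} t * (W t)\<^sup>2 =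
        indicator {a..b} t * (W t)\<^sup>2"
      by eventually_elim (use assms in \<open>auto simp: indicator_def\<close>)
    show "(\<lambda>t. indicator {a..b} t * (W t)\<^sup>2) \<in> borel_measurable (lebesgue_on {0<..})"
      using interval_integrable[of "{a..b}"] by auto
    show "(\<lambda>t. indicator {..b} t * (W t)\<^sup>2 - indicator {..a} t * (W t)\<^sup>2) \<in> borel_measurable (lebesgue_on {0<..})"
      using interval_integrable[of "{..b}"] interval_integrable[of "{..a}"] by auto
  qed
  finally show ?thesis by simp
qed

lemma dissipation_mono: "a \<le> b \<Longrightarrow> dissipation a \<le> dissipation b"
proof -
  assume "a \<le> b"
  have "0 \<le> (\<integral>t. indicator {a..b} t * (W t)\<^sup>2 \<partial>lebesgue_on {0<..})"
    by (intro integral_nonneg_AE) auto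
  then show ?thesis using dissipation_diff[OF \<open>a \<le> b\<close>] by simp
qed

text \<open>Square integrability of \<open>W\<close> over all times gives the dissipation a finite
  limit. This is the source of all smallness at large times.\<close>

lemma dissipation_vanishes: "((\<lambda>t. dissipation t - dissipation (t - 1)) \<longlongrightarrow> 0) at_top"
proof -
  have i: "integrable (lebesgue_on {0<..}) (\<lambda>t. (W t)\<^sup>2)" using W_sq_integrable by (simp add: sq_integrable_def)
  have "(dissipation \<longlongrightarrow> (\<integral>t. (W t)\<^sup>2 \<partial>lebesgue_on {0<..})) at_top"
    unfolding dissipation_def
  proof (rule integral_dominated_convergence_at_top[where w = "\<lambda>t. (W t)\<^sup>2"])
    show "AE t in lebesgue_on {0<..}. ((\<lambda>x. indicator {..x} t * (W t)\<^sup>2) \<longlongrightarrow> (W t)\<^sup>2) at_top"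
    proof (rule AE_I2)
      fix t
      have "\<forall>\<^sub>F x in at_top. indicator {..x} t * (W t)\<^sup>2 = (W t)\<^sup>2"
        using eventually_ge_at_top[of t] by eventually_elim simp
      then show "((\<lambda>x. indicator {..x} t * (W t)\<^sup>2) \<longlongrightarrow> (W t)\<^sup>2) at_top" by (rule tendsto_eventually)
    qed
    show "\<forall>\<^sub>F x in at_top. AE t in lebesgue_on {0<..}. norm (indicator {..x} t * (W t)\<^sup>2) \<le> (W t)\<^sup>2"
      by (auto simp: indicator_def)
    show "(\<lambda>t. (W t)\<^sup>2) \<in> borel_measurable (lebesgue_on {0<..})" using i by simp
    show "(\<lambda>t. indicator {..x} t * (W t)\<^sup>2) \<in> borel_measurable (lebesgue_on {0<..})" for x
      using interval_integrable[of "{..x}"] by auto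
  qed (rule i)
  moreover from this have "((\<lambda>t. dissipation (t - 1)) \<longlongrightarrow> (\<integral>t. (W t)\<^sup>2 \<partial>lebesgue_on {0<..})) at_top"
  proof (rule filterlim_compose)
    show "filterlim (\<lambda>t::real. t - 1) at_top at_top"
      using filterlim_tendsto_add_at_top[OF tendsto_const[of "-1"] filterlim_ident[of at_top]] by simp
  qed
  ultimately show ?thesis using tendsto_diff by fastforce
qed

text \<open>Almost every time is elliptic. If \<open>W^2\<close> exceeded its mean over
  \<open>[a, b]\<close> at all of these, then \<open>W^2\<close> minus its mean would be positive
  almost everywhere on the interval and yet have integral 0.\<close>

lemma elliptic_time_exists:
  assumes ab: "0 < a" "a < b"
  obtains \<tau> where "a \<le> \<tau>" "\<tau> \<le> b" "elliptic (u \<tau>) (w \<tau>)"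
    "(W \<tau>)\<^sup>2 * (b - a) \<le> dissipation b - dissipation a"
proof (rule ccontr)
  let ?L = "lebesgue_on {0<..} :: real measure"
  assume "\<not> thesis"
  then have neg: "dissipation b - dissipation a < (W \<tau>)\<^sup>2 * (b - a)"
    if "elliptic (u \<tau>) (w \<tau>)" "\<tau> \<in> {a..b}" for \<tau> using that(1,2) \<open>\<And>\<tau>. _ \<Longrightarrow> _ \<Longrightarrow> _ \<Longrightarrow> _ \<Longrightarrow> thesis\<close> by force
  define m where "m = (dissipation b - dissipation a) / (b - a)"
  have S: "{a..b} \<in> sets ?L" using ab by (auto simp: sets_restrict_space_iff intro!: image_eqI[of _ _ "{a..b}"])
  have "emeasure ?L {a..b} = emeasure lebesgue {a..b}" by (rule emeasure_restrict_space) (use ab in auto)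
  then have em: "emeasure ?L {a..b} = ennreal (b - a)" using ab by simp
  have I: "integrable ?L (indicat_real {a..b})" using S em by (intro integrable_real_indicator) auto
  have "{a..b} \<inter> {0<..} = {a..b}" using ab by auto
  then have I1: "(\<integral>t. indicat_real {a..b} t \<partial>?L) = b - a"
    using S em ab by (simp add: measure_def)
  note i = interval_integrable[of "{a..b}"]
  define f where "f t = indicator {a..b} t * (W t)\<^sup>2 - m * indicator {a..b} t" for t
  have fi: "integrable ?L f" unfolding f_def using I i by auto
  have "(\<integral>t. f t \<partial>?L) = 0"
    unfolding f_def using I i I1 dissipation_diff[of a b] ab by (simp add: m_def)
  moreover have pos: "AE t in ?L. (t \<in> {a..b} \<longrightarrow> 0 < f t) \<and> 0 \<le> f t"
    using AE_elliptic
  proof eventually_elim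
    case (elim t)
    show ?case
    proof (cases "t \<in> {a..b}")
      case True
      have "m < (W t)\<^sup>2" unfolding m_def using neg[OF elim True] ab by (simp add: pos_divide_less_eq)
      then show ?thesis using True by (simp add: f_def)
    qed (auto simp: f_def)
  qed
  ultimately have "AE t in ?L. f t = 0"
    using integral_nonneg_eq_0_iff_AE[OF fi] by (auto elim!: eventually_mono)
  with pos have "AE t in ?L. t \<notin> {a..b}" by eventually_elim auto
  then have "emeasure ?L {a..b} = 0" 
    using S ab by (subst (asm) AE_iff_measurable[of "{a..b}"]) auto
  then show False using em ab by simp
qed

section \<open>Increments of the solution in time\<close>

lemma L2_functional_X_dual:
  assumes v: "v \<in> X_space s \<Omega>"
  shows "(\<lambda>z. L2_functional \<Omega> z v) \<in> X_dual \<sigma> \<Omega>"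
proof -
  obtain P where P: "P > 0" "\<And>v. v \<in> X_space \<sigma> \<Omega> \<Longrightarrow> (LBINT x. (v x)\<^sup>2) \<le> P * (X_norm \<sigma> v)\<^sup>2"
    by (rule X_space_Poincare[OF \<sigma> \<Omega>(2)]) (rule that)
  note v2 = X_space_sq_integrable[OF v]
  have eq: "L2_functional \<Omega> z v = (LBINT x. z x * v x)" if "z \<in> X_space \<sigma> \<Omega>" for z
    by (rule L2_functional_eq[OF v X_space_measurable[OF that] \<Omega>(1)])
  have i: "integrable lborel (\<lambda>x. z x * v x)" if "z \<in> X_space \<sigma> \<Omega>" for z
    by (rule sq_integrable_mult_integrable[OF X_space_sq_integrable[OF that] v2])
  have "\<bar>L2_functional \<Omega> z v\<bar> \<le> sqrt P * sqrt (LBINT x. (v x)\<^sup>2) * X_norm \<sigma> z" if z: "z \<in> X_space \<sigma> \<Omega>" for z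
  proof -
    have "\<bar>L2_functional \<Omega> z v\<bar> \<le> sqrt (LBINT x. (z x)\<^sup>2) * sqrt (LBINT x. (v x)\<^sup>2)"
      unfolding eq[OF z] by (rule sq_integrable_Cauchy_Schwarz_abs[OF X_space_sq_integrable[OF z] v2])
    also have "\<dots> \<le> sqrt (P * (X_norm \<sigma> z)\<^sup>2) * sqrt (LBINT x. (v x)\<^sup>2)"
      by (intro mult_right_mono real_sqrt_le_mono P(2) z) simp
    finally show ?thesis by (simp add: real_sqrt_mult X_norm_nonneg[OF \<sigma>] mult_ac)
  qed
  then have "\<exists>K. \<forall>z\<in>X_space \<sigma> \<Omega>. \<bar>L2_functional \<Omega> z v\<bar> \<le> K * X_norm \<sigma> z" by blast
  then show ?thesis unfolding X_dual_def
    by (auto simp: eq i X_space_add X_space_cmult distrib_right mult.assoc)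
qed

text \<open>By the equation, the time derivative of the pairing with \<open>v\<close> is bounded by
  \<open>X_norm s v * W t\<close>, and Cauchy-Schwarz in time does the rest. The pairing is
  continuous by weak continuity of \<open>u\<close> and \<open>L2_functional_X_dual\<close>, so the
  bound holds for all positive times and not only for almost all.\<close>

lemma increment_bound:
  assumes ab: "0 < a" "a < b" and v: "v \<in> X_space s \<Omega>"
  shows "\<bar>\<integral>x. (u b x - u a x) * v x \<partial>lborel\<bar> \<le> X_norm s v * sqrt ((b - a) * (dissipation b - dissipation a))"
proof -
  let ?L = "lebesgue_on {0<..} :: real measure"
  note v2 = X_space_sq_integrable[OF v]
  define f where "f t = L2_functional \<Omega> (u t) v" for t
  have eq: "f t = (LBINT x. u t x * v x)" if "0 \<le> t" for t
    unfolding f_def by (rule L2_functional_eq[OF v X_space_measurable[OF u_X_space[OF that]] \<Omega>(1)])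
  obtain u' where u': "distributional_derivative s \<Omega> 0 \<infinity> (\<lambda>t. L2_functional \<Omega> (u t)) u'"
    "AE t in ?L. \<forall>v\<in>X_space s \<Omega>. u' t v + frac_form s (w t) v = 0"
    using solution unfolding weak_solution_def time_interval_eq by (elim conjE exE) (rule that)
  have cont: "continuous_on {0<..} f"
  proof -
    have "weakly_continuous_X \<sigma> \<Omega> 0 \<infinity> u" using solution unfolding weak_solution_def by (rule conjunct1)
    then have "\<forall>F\<in>X_dual \<sigma> \<Omega>. continuous_on {t. 0 \<le> t \<and> ereal t < \<infinity>} (\<lambda>t. F (u t))"
      unfolding weakly_continuous_X_def by (rule conjunct2)
    from bspec[OF this L2_functional_X_dual[OF v]]
    have "continuous_on {t. 0 \<le> t \<and> ereal t < \<infinity>} f" by (simp add: f_def)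
    then show ?thesis by (rule continuous_on_subset) auto
  qed
  have hH: "AE t in ?L. \<bar>u' t v\<bar> \<le> X_norm s v * W t"
    using u'(2) AE_elliptic
  proof eventually_elim
    case (elim t)
    then have "w t \<in> X_space s \<Omega>" by (simp add: elliptic_def)
    moreover have "u' t v = - frac_form s (w t) v" using elim(1) v by (simp add: eq_neg_iff_add_eq_0)
    ultimately show ?case using frac_form_bound[OF s _ v, of "w t"] by (simp add: W_def mult.commute)
  qed
  have S: "{a..b} \<in> sets ?L" using ab by (auto simp: sets_restrict_space_iff intro!: image_eqI[of _ _ "{a..b}"])
  have "emeasure ?L {a..b} = emeasure lebesgue {a..b}" by (rule emeasure_restrict_space) (use ab in auto)
  then have em: "emeasure ?L {a..b} = ennreal (b - a)" using ab by simp
  have I: "sq_integrable ?L (indicat_real {a..b})" using S em by (intro sq_integrable_indicator) auto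
  have I2: "(\<integral>t. (indicat_real {a..b} t)\<^sup>2 \<partial>?L) = b - a"
  proof -
    have "(\<integral>t. (indicat_real {a..b} t)\<^sup>2 \<partial>?L) = (\<integral>t. indicat_real {a..b} t \<partial>?L)"
      by (rule Bochner_Integration.integral_cong) (auto simp: indicator_def)
    moreover have "{a..b} \<inter> {0<..} = {a..b}" using ab by auto
    ultimately show ?thesis using S em ab by (simp add: measure_def)
  qed
  have Iw: "sq_integrable ?L (\<lambda>t. indicator {a..b} t * W t)"
  proof (rule sq_integrable_bound[OF W_sq_integrable])
    show "(\<lambda>t. indicator {a..b} t * W t) \<in> borel_measurable ?L"
      by (intro borel_measurable_times sq_integrable_measurable[OF W_sq_integrable] sq_integrable_measurable[OF I])
  qed (auto simp: indicator_def)
  have int: "integrable ?L (\<lambda>t. indicator {a..b} t * W t)"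
    by (rule sq_integrable_mult_integrable[OF I W_sq_integrable])
  have "\<bar>f b - f a\<bar> \<le> (\<integral>t. indicator {a..b} t * (X_norm s v * W t) \<partial>?L)"
  proof (rule distributional_derivative_increment[OF ab cont _ hH])
    show "(\<integral>t. \<eta> t * u' t v \<partial>?L) = - (\<integral>t. deriv \<eta> t * f t \<partial>?L)" if "test_function 0 \<infinity> \<eta>" for \<eta>
      using u'(1) that v by (simp add: distributional_derivative_def time_interval_eq f_def)
    show "integrable ?L (\<lambda>t. indicat_real {a..b} t * (X_norm s v * W t))"
      using integrable_mult_right[OF int, of "X_norm s v"] by (simp add: mult_ac)
  qed
  \<comment> \<open>The indicator is doubled for Cauchy-Schwarz: one copy yields the length
    \<open>b - a\<close>, the other localises \<open>W\<close>.\<close>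
  also have "\<dots> = X_norm s v * (\<integral>t. indicator {a..b} t * (indicator {a..b} t * W t) \<partial>?L)"
    unfolding integral_mult_right_zero[symmetric]
    by (rule Bochner_Integration.integral_cong) (auto simp: indicator_def)
  also have "\<dots> \<le> X_norm s v * (sqrt (\<integral>t. (indicat_real {a..b} t)\<^sup>2 \<partial>?L) * sqrt (\<integral>t. (indicator {a..b} t * W t)\<^sup>2 \<partial>?L))"
    using sq_integrable_Cauchy_Schwarz_abs[OF I Iw] by (intro mult_left_mono X_norm_nonneg[OF s]) linarith
  also have "(\<integral>t. (indicator {a..b} t * W t)\<^sup>2 \<partial>?L) = dissipation b - dissipation a"
  proof -
    have "(\<integral>t. (indicator {a..b} t * W t)\<^sup>2 \<partial>?L) = (\<integral>t. indicator {a..b} t * (W t)\<^sup>2 \<partial>?L)"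
      by (rule Bochner_Integration.integral_cong) (auto simp: indicator_def power_mult_distrib)
    then show ?thesis using dissipation_diff[of a b] ab by simp
  qed
  also have "f b - f a = (LBINT x. (u b x - u a x) * v x)"
    using ab sq_integrable_mult_integrable[OF X_space_sq_integrable[OF u_X_space] v2]
    by (simp add: eq left_diff_distrib)
  finally show ?thesis by (simp add: I2 real_sqrt_mult)
qed

text \<open>The Ehrling inequality for an increment of \<open>u\<close>. Increments are controlled
  only against test functions of order \<open>s\<close>, while their norm has order
  \<open>\<sigma>\<close>, which is why that inequality carries two orders.\<close>

lemma L2_increment_bound:
  assumes "e > 0"
  obtains C where "C \<ge> 0" "\<And>a b. 0 < a \<Longrightarrow> a < b \<Longrightarrow> (LBINT x. (u b x - u a x)\<^sup>2) \<le>
      e * (X_norm \<sigma> (\<lambda>x. u b x - u a x))\<^sup>2 + C * ((b - a) * (dissipation b - dissipation a))"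
proof -
  obtain I :: "(real ^ 'n) set" and \<psi> K where E: "finite I" "\<And>i. i \<in> I \<Longrightarrow> \<psi> i \<in> X_space s \<Omega>" "K \<ge> 0"
    "\<And>v. v \<in> X_space \<sigma> \<Omega> \<Longrightarrow> (LBINT x. (v x)\<^sup>2) \<le>
        e * (X_norm \<sigma> v)\<^sup>2 + K * (\<Sum>i\<in>I. (LBINT x. v x * \<psi> i x)\<^sup>2)"
    by (rule X_space_Ehrling[OF s \<sigma> \<Omega> assms]) (rule that)
  define C where "C = K * (\<Sum>i\<in>I. (X_norm s (\<psi> i))\<^sup>2)"
  have C: "C \<ge> 0" using E(3) by (simp add: C_def sum_nonneg)
  have "(LBINT x. (u b x - u a x)\<^sup>2) \<le>
      e * (X_norm \<sigma> (\<lambda>x. u b x - u a x))\<^sup>2 + C * ((b - a) * (dissipation b - dissipation a))"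
    if ab: "0 < a" "a < b" for a b
  proof -
    define R where "R = (b - a) * (dissipation b - dissipation a)"
    have R: "R \<ge> 0" using ab dissipation_mono[of a b] by (simp add: R_def)
    have "(LBINT x. (u b x - u a x) * \<psi> i x)\<^sup>2 \<le> (X_norm s (\<psi> i))\<^sup>2 * R" if i: "i \<in> I" for i
    proof -
      have "\<bar>\<integral>x. (u b x - u a x) * \<psi> i x \<partial>lborel\<bar>\<^sup>2 \<le> (X_norm s (\<psi> i) * sqrt R)\<^sup>2"
        unfolding R_def by (intro power_mono increment_bound ab E(2) i) simp
      then show ?thesis using R by (simp add: power_mult_distrib)
    qed
    then have "(\<Sum>i\<in>I. (LBINT x. (u b x - u a x) * \<psi> i x)\<^sup>2) \<le> (\<Sum>i\<in>I. (X_norm s (\<psi> i))\<^sup>2 * R)"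
      by (rule sum_mono)
    then have "K * (\<Sum>i\<in>I. (LBINT x. (u b x - u a x) * \<psi> i x)\<^sup>2) \<le> K * (\<Sum>i\<in>I. (X_norm s (\<psi> i))\<^sup>2 * R)"
      using E(3) by (rule mult_left_mono)
    also have "\<dots> = C * R" by (simp add: C_def sum_distrib_right mult.assoc)
    finally show ?thesis
      using E(4)[OF X_space_diff[OF u_X_space u_X_space], of b a] ab by (simp add: R_def)
  qed
  then show ?thesis using that C by blast
qed

text \<open>The bound in the energy norm enters with an arbitrarily small Ehrling factor, and the
  remaining term vanishes with \<open>t - \<tau> k\<close>.\<close>

lemma u_L2_convergence:
  assumes \<tau>: "\<And>k. 0 < \<tau> k" "\<And>k. \<tau> k < t" "\<tau> \<longlonglongrightarrow> t"
    and B: "\<And>k. X_norm \<sigma> (\<lambda>x. u t x - u (\<tau> k) x) \<le> B"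
  shows "(\<lambda>k. LBINT x. (u (\<tau> k) x - u t x)\<^sup>2) \<longlonglongrightarrow> 0"
proof (rule LIMSEQ_I)
  fix e :: real assume e: "e > 0"
  define \<epsilon> where "\<epsilon> = e / (2 * (B\<^sup>2 + 1))"
  have B1: "0 < 2 * (B\<^sup>2 + 1)" by (simp add: add_nonneg_pos)
  have \<epsilon>: "\<epsilon> > 0" using e B1 unfolding \<epsilon>_def by (rule divide_pos_pos)
  obtain C where C: "C \<ge> 0" "\<And>a b. 0 < a \<Longrightarrow> a < b \<Longrightarrow> (LBINT x. (u b x - u a x)\<^sup>2) \<le>
      \<epsilon> * (X_norm \<sigma> (\<lambda>x. u b x - u a x))\<^sup>2 + C * ((b - a) * (dissipation b - dissipation a))"
    by (rule L2_increment_bound[OF \<epsilon>]) (rule that)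
  \<comment> \<open>Dominates the dissipation between \<open>\<tau> k\<close> and \<open>t\<close>
    uniformly in \<open>k\<close>.\<close>
  define D where "D = dissipation t - dissipation 0"
  have "(\<lambda>k. C * ((t - \<tau> k) * D)) \<longlonglongrightarrow> C * ((t - t) * D)" by (intro tendsto_intros \<tau>)
  then have "\<forall>\<^sub>F k in sequentially. C * ((t - \<tau> k) * D) < e / 2"
    using e by (intro order_tendstoD(2)) auto
  then obtain N where N: "\<And>k. k \<ge> N \<Longrightarrow> C * ((t - \<tau> k) * D) < e / 2" by (auto simp: eventually_sequentially)
  have "(LBINT x. (u (\<tau> k) x - u t x)\<^sup>2) < e" if k: "k \<ge> N" for k
  proof -
    have "\<epsilon> * (X_norm \<sigma> (\<lambda>x. u t x - u (\<tau> k) x))\<^sup>2 \<le> \<epsilon> * B\<^sup>2"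
      using \<epsilon> by (intro mult_left_mono power_mono B X_norm_nonneg[OF \<sigma>]) auto
    also have "\<dots> \<le> \<epsilon> * (B\<^sup>2 + 1)" using \<epsilon> by simp
    also have "\<dots> = e / 2"
    proof -
      have "e / (2 * y) * y = e / 2" if "0 < 2 * y" for y :: real using that by simp
      from this[OF B1] show ?thesis unfolding \<epsilon>_def .
    qed
    finally have 1: "\<epsilon> * (X_norm \<sigma> (\<lambda>x. u t x - u (\<tau> k) x))\<^sup>2 \<le> e / 2" .
    have "(t - \<tau> k) * (dissipation t - dissipation (\<tau> k)) \<le> (t - \<tau> k) * D"
      using \<tau>(1)[of k] \<tau>(2)[of k] dissipation_mono[of 0 "\<tau> k"] by (intro mult_left_mono) (auto simp: D_def)
    then have "C * ((t - \<tau> k) * (dissipation t - dissipation (\<tau> k))) \<le> C * ((t - \<tau> k) * D)"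
      using C(1) by (rule mult_left_mono)
    moreover have "(LBINT x. (u t x - u (\<tau> k) x)\<^sup>2) = (LBINT x. (u (\<tau> k) x - u t x)\<^sup>2)"
      by (simp add: power2_commute)
    ultimately show ?thesis using C(2)[OF \<tau>(1) \<tau>(2), of k] N[OF k] 1 by linarith
  qed
  then show "\<exists>N. \<forall>k\<ge>N. norm ((LBINT x. (u (\<tau> k) x - u t x)\<^sup>2) - 0) < e" by auto
qed

text \<open>The product \<open>(b - a) * (dissipation b - dissipation a)\<close> is symmetric, so
  \<open>a\<close> may come before or after \<open>b\<close>. With \<open>a\<close> later the
  inequality limits the growth of the energy; with \<open>a\<close> earlier it bounds the increment
  in norm.\<close>

lemma energy_increment_bound:
  obtains C where "C \<ge> 0" "\<And>a b. 0 < a \<Longrightarrow> 0 < b \<Longrightarrow> elliptic (u a) (w a) \<Longrightarrow> finite_energy (u b) \<Longrightarrow>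
    (X_norm \<sigma> (\<lambda>x. u b x - u a x))\<^sup>2 / 4 \<le> real_energy (u b) - real_energy (u a) +
      W a * sqrt ((b - a) * (dissipation b - dissipation a)) + C * ((b - a) * (dissipation b - dissipation a))"
proof -
  \<comment> \<open>With this Ehrling factor the L2 defect uses at most a quarter of the squared
    norm out of the available half; the summand 1 covers \<open>\<Lambda> = 0\<close>.\<close>
  have e: "1 / (2 * (\<Lambda> + 1)) > 0" using \<Lambda> by simp
  obtain C where C: "C \<ge> 0" "\<And>a b. 0 < a \<Longrightarrow> a < b \<Longrightarrow> (LBINT x. (u b x - u a x)\<^sup>2) \<le>
      1 / (2 * (\<Lambda> + 1)) * (X_norm \<sigma> (\<lambda>x. u b x - u a x))\<^sup>2 + C * ((b - a) * (dissipation b - dissipation a))"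
    by (rule L2_increment_bound[OF e]) (rule that)
  have "(X_norm \<sigma> (\<lambda>x. u b x - u a x))\<^sup>2 / 4 \<le> real_energy (u b) - real_energy (u a) +
      W a * sqrt ((b - a) * (dissipation b - dissipation a)) +
      \<Lambda> / 2 * C * ((b - a) * (dissipation b - dissipation a))"
    if ab: "0 < a" "0 < b" and E: "elliptic (u a) (w a)" and F: "finite_energy (u b)" for a b
  proof -
    define R where "R = (b - a) * (dissipation b - dissipation a)"
    define X where "X = (X_norm \<sigma> (\<lambda>x. u b x - u a x))\<^sup>2"
    define d where "d = (LBINT x. (u b x - u a x)\<^sup>2)"
    have wa: "w a \<in> X_space s \<Omega>" using E by (simp add: elliptic_def)
    have "d \<le> 1 / (2 * (\<Lambda> + 1)) * X + C * R \<and> \<bar>\<integral>x. w a x * (u b x - u a x) \<partial>lborel\<bar> \<le> W a * sqrt R"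
    proof (cases a b rule: linorder_cases)
      case less
      then show ?thesis using C(2)[OF ab(1) less] increment_bound[OF ab(1) less wa]
        by (simp add: d_def X_def R_def W_def mult.commute)
    next
      case equal
      then show ?thesis using \<Lambda> by (simp add: d_def X_def R_def)
    next
      case greater
      have "R = (a - b) * (dissipation a - dissipation b)" by (simp add: R_def algebra_simps)
      moreover have "X = (X_norm \<sigma> (\<lambda>x. u a x - u b x))\<^sup>2" by (simp add: X_def X_norm_commute[OF \<sigma>, of "u b"])
      moreover have "d = (LBINT x. (u a x - u b x)\<^sup>2)" by (simp add: d_def power2_commute)
      moreover have "(LBINT x. w a x * (u b x - u a x)) = - (LBINT x. (u a x - u b x) * w a x)"
        unfolding Bochner_Integration.integral_minus[symmetric]
        by (rule Bochner_Integration.integral_cong) (auto simp: algebra_simps)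
      ultimately show ?thesis using C(2)[OF ab(2) greater] increment_bound[OF ab(2) greater wa]
        by (simp add: W_def)
    qed
    then have d: "d \<le> 1 / (2 * (\<Lambda> + 1)) * X + C * R"
      and i: "\<bar>\<integral>x. w a x * (u b x - u a x) \<partial>lborel\<bar> \<le> W a * sqrt R" by auto
    have "\<Lambda> / 2 * d \<le> \<Lambda> / 2 * (1 / (2 * (\<Lambda> + 1)) * X + C * R)" using d \<Lambda> by (intro mult_left_mono) auto
    also have "\<dots> = \<Lambda> / (4 * (\<Lambda> + 1)) * X + \<Lambda> / 2 * C * R" using \<Lambda> by (simp add: field_simps)
    also have "\<Lambda> / (4 * (\<Lambda> + 1)) * X \<le> 1 / 4 * X"
      using \<Lambda> by (intro mult_right_mono) (auto simp: X_def divide_simps)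
    finally have "\<Lambda> / 2 * d \<le> X / 4 + \<Lambda> / 2 * C * R" by simp
    moreover have "(LBINT x. w a x * (u b x - u a x)) + X / 2 - \<Lambda> / 2 * d \<le> real_energy (u b) - real_energy (u a)"
      unfolding X_def d_def using ab by (intro elliptic_energy_inequality[OF E u_X_space F]) auto
    ultimately have "X / 4 \<le> real_energy (u b) - real_energy (u a) + W a * sqrt R + \<Lambda> / 2 * C * R"
      using i by linarith
    then show ?thesis by (simp add: X_def R_def)
  qed
  then show ?thesis using that[of "\<Lambda> / 2 * C"] C(1) \<Lambda> by simp
qed

text \<open>
  The energy is compared along times \<open>\<tau> k\<close> in the dyadic windows \<open>[t - 2\<^sup>-\<^sup>k, t - 2\<^sup>-\<^sup>k\<^sup>-\<^sup>1]\<close>, chosen so that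
  \<open>W (\<tau> k)\<close> is at most the quadratic mean of \<open>W\<close> over the window: the powers of \<open>2\<close> in the size of
  \<open>W (\<tau> k)\<close> and in that of the increment of \<open>u\<close> cancel, and the sum of the errors is controlled by
  the dissipation over \<open>[t - 1, t]\<close>.
\<close>

lemma elliptic_time_nearby:
  obtains C where "C \<ge> 0" "\<And>t. t \<ge> 2 \<Longrightarrow> \<exists>\<tau>. t - 1 \<le> \<tau> \<and> elliptic (u \<tau>) (w \<tau>) \<and>
      (W \<tau>)\<^sup>2 \<le> 2 * (dissipation t - dissipation (t - 1)) \<and> finite_energy (u t) \<and>
      real_energy (u t) \<le> real_energy (u \<tau>) + C * (dissipation t - dissipation (t - 1)) \<and>
      (X_norm \<sigma> (\<lambda>x. u t x - u \<tau> x))\<^sup>2 \<le> C * (dissipation t - dissipation (t - 1))"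
proof -
  obtain C where C: "C \<ge> 0" "\<And>a b. 0 < a \<Longrightarrow> 0 < b \<Longrightarrow> elliptic (u a) (w a) \<Longrightarrow> finite_energy (u b) \<Longrightarrow>
    (X_norm \<sigma> (\<lambda>x. u b x - u a x))\<^sup>2 / 4 \<le> real_energy (u b) - real_energy (u a) +
      W a * sqrt ((b - a) * (dissipation b - dissipation a)) + C * ((b - a) * (dissipation b - dissipation a))"
    by (rule energy_increment_bound) (rule that)
  have "\<exists>\<tau>. t - 1 \<le> \<tau> \<and> elliptic (u \<tau>) (w \<tau>) \<and>
      (W \<tau>)\<^sup>2 \<le> 2 * (dissipation t - dissipation (t - 1)) \<and> finite_energy (u t) \<and>
      real_energy (u t) \<le> real_energy (u \<tau>) + (16 + 8 * C) * (dissipation t - dissipation (t - 1)) \<and>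
      (X_norm \<sigma> (\<lambda>x. u t x - u \<tau> x))\<^sup>2 \<le> (16 + 8 * C) * (dissipation t - dissipation (t - 1))"
    if t: "t \<ge> 2" for t
  proof -
    define D where "D = dissipation t - dissipation (t - 1)"
    have D: "D \<ge> 0" using dissipation_mono[of "t - 1" t] by (simp add: D_def)
    \<comment> \<open>The window from \<open>d k\<close> to \<open>d (Suc k)\<close> has length
      \<open>(1 / 2) ^ Suc k\<close>; \<open>t \<ge> 2\<close> keeps all windows in positive
      time.\<close>
    define d where "d k = t - (1 / 2) ^ k" for k :: nat
    have half: "0 < (1 / 2 :: real) ^ k" "(1 / 2 :: real) ^ k \<le> 1" for k :: nat
      by (auto simp: power_le_one)
    have d0: "d 0 = t - 1" by (simp add: d_def)
    have dpos: "0 < d k" for k using t half(2)[of k] unfolding d_def by linarith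
    have dlt: "d k < t" for k using half(1)[of k] unfolding d_def by linarith
    have ddiff: "d (Suc k) - d k = (1 / 2) ^ Suc k" for k by (simp add: d_def)
    have dstep: "d k < d (Suc k)" for k using ddiff[of k] half(1)[of "Suc k"] by linarith
    have "\<exists>\<tau>. d k \<le> \<tau> \<and> \<tau> \<le> d (Suc k) \<and> elliptic (u \<tau>) (w \<tau>) \<and>
        (W \<tau>)\<^sup>2 * (1 / 2) ^ Suc k \<le> dissipation (d (Suc k)) - dissipation (d k)" for k
      by (rule elliptic_time_exists[OF dpos[of k] dstep[of k]]) (unfold ddiff, blast)
    then obtain \<tau> where \<tau>: "\<And>k. d k \<le> \<tau> k" "\<And>k. \<tau> k \<le> d (Suc k)" "\<And>k. elliptic (u (\<tau> k)) (w (\<tau> k))"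
        "\<And>k. (W (\<tau> k))\<^sup>2 * (1 / 2) ^ Suc k \<le> dissipation (d (Suc k)) - dissipation (d k)"
      by metis
    have \<tau>pos: "0 < \<tau> k" for k using dpos[of k] \<tau>(1)[of k] by linarith
    have \<tau>lt: "\<tau> k < t" for k using dlt[of "Suc k"] \<tau>(2)[of k] by linarith
    have \<tau>step: "\<tau> k \<le> \<tau> (Suc k)" for k using \<tau>(2)[of k] \<tau>(1)[of "Suc k"] by linarith
    have \<tau>mono: "\<tau> 0 \<le> \<tau> k" for k by (induction k) (use \<tau>step order_trans in auto)
    have \<tau>0: "t - 1 \<le> \<tau> 0" using \<tau>(1)[of 0] d0 by simp
    have fin: "finite_energy (u (\<tau> k))" for k by (rule elliptic_finite_energy[OF \<tau>(3)])
    \<comment> \<open>The increment bound is used backwards in time: the equation at the later time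
      \<open>\<tau> (Suc n)\<close> is compared with the earlier state, which bounds the later
      energy from above. Below, \<open>A\<close> is the dissipation over the window of
      \<open>\<tau> (Suc n)\<close> and \<open>B\<close> the one between the two times.\<close>
    have step: "real_energy (u (\<tau> (Suc n))) \<le> real_energy (u (\<tau> n)) +
        (dissipation (d (Suc (Suc n))) - dissipation (d (Suc n))) +
        (1 + C) * (dissipation (\<tau> (Suc n)) - dissipation (\<tau> n))" for n
    proof -
      define A where "A = dissipation (d (Suc (Suc n))) - dissipation (d (Suc n))"
      define B where "B = dissipation (\<tau> (Suc n)) - dissipation (\<tau> n)"
      define h where "h = \<tau> (Suc n) - \<tau> n"
      have A0: "0 \<le> A" using dissipation_mono[OF less_imp_le[OF dstep[of "Suc n"]]] by (simp add: A_def)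
      have B0: "0 \<le> B" using dissipation_mono[OF \<tau>step[of n]] by (simp add: B_def)
      have h0: "0 \<le> h" using \<tau>step[of n] by (simp add: h_def)
      have h1: "h \<le> (1 / 2) ^ n" using \<tau>(1)[of n] \<tau>lt[of "Suc n"] by (simp add: h_def d_def)
      have h2: "h \<le> 1" using h1 half(2)[of n] by linarith
      have R: "(\<tau> n - \<tau> (Suc n)) * (dissipation (\<tau> n) - dissipation (\<tau> (Suc n))) = h * B"
        by (simp add: h_def B_def algebra_simps)
      \<comment> \<open>The window of \<open>\<tau> (Suc n)\<close> has length
        \<open>(1 / 2) ^ (n + 2)\<close>, while \<open>h\<close> is only bounded by
        \<open>(1 / 2) ^ n\<close>; the quotient of the two is the 4.\<close>
      have WA: "(W (\<tau> (Suc n)))\<^sup>2 * (1 / 2) ^ n \<le> 4 * A"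
        using \<tau>(4)[of "Suc n"] by (simp add: A_def)
      have "W (\<tau> (Suc n)) * sqrt (h * B) \<le> A + B"
      proof (rule power2_le_imp_le)
        have "(W (\<tau> (Suc n)) * sqrt (h * B))\<^sup>2 = (W (\<tau> (Suc n)))\<^sup>2 * h * B"
          using h0 B0 by (simp add: power_mult_distrib mult.assoc)
        also have "\<dots> \<le> (W (\<tau> (Suc n)))\<^sup>2 * (1 / 2) ^ n * B"
          using h1 B0 by (intro mult_right_mono mult_left_mono) auto
        also have "\<dots> \<le> 4 * A * B" using WA B0 by (rule mult_right_mono)
        also have "\<dots> \<le> (A + B)\<^sup>2"
          using zero_le_power2[of "A - B"] by (simp add: power2_eq_square algebra_simps)
        finally show "(W (\<tau> (Suc n)) * sqrt (h * B))\<^sup>2 \<le> (A + B)\<^sup>2" .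
      qed (use A0 B0 in simp)
      moreover have "C * (h * B) \<le> C * B"
        using C(1) h2 B0 mult_right_mono[OF h2 B0] by (intro mult_left_mono) auto
      moreover have "0 \<le> (X_norm \<sigma> (\<lambda>x. u (\<tau> n) x - u (\<tau> (Suc n)) x))\<^sup>2 / 4" by simp
      ultimately have "real_energy (u (\<tau> (Suc n))) \<le> real_energy (u (\<tau> n)) + (A + B) + C * B"
        using C(2)[OF \<tau>pos[of "Suc n"] \<tau>pos[of n] \<tau>(3) fin] unfolding R by linarith
      then show ?thesis unfolding A_def[symmetric] B_def[symmetric] by (simp add: distrib_right)
    qed
    have bound: "dissipation x - dissipation y \<le> D" if "x \<le> t" "t - 1 \<le> y" for x y
      using dissipation_mono[OF that(1)] dissipation_mono[OF that(2)] by (simp add: D_def)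
    \<comment> \<open>Both error sums telescope, so each is controlled by the dissipation over
      \<open>[t - 1, t]\<close>; together they give the constant \<open>1 + (1 + C)\<close>.\<close>
    have sumb: "real_energy (u (\<tau> n)) \<le> real_energy (u (\<tau> 0)) +
        (dissipation (d (Suc n)) - dissipation (d 1)) + (1 + C) * (dissipation (\<tau> n) - dissipation (\<tau> 0))" for n
    proof (induction n)
      case (Suc n)
      then show ?case using step[of n] by (simp add: algebra_simps)
    qed simp
    have E: "real_energy (u (\<tau> n)) \<le> real_energy (u (\<tau> 0)) + (2 + C) * D" for n
    proof -
      have "dissipation (d (Suc n)) - dissipation (d 1) \<le> D"
        using dlt[of "Suc n"] dstep[of 0] d0 by (intro bound) auto
      moreover have "(1 + C) * (dissipation (\<tau> n) - dissipation (\<tau> 0)) \<le> (1 + C) * D"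
        using \<tau>lt[of n] \<tau>0 C(1) by (intro mult_left_mono bound) auto
      ultimately show ?thesis using sumb[of n] by (simp add: algebra_simps)
    qed
    have W0: "(W (\<tau> 0))\<^sup>2 \<le> 2 * D"
    proof -
      have "dissipation (d (Suc 0)) - dissipation (d 0) \<le> D" using dlt[of "Suc 0"] d0 by (intro bound) auto
      then show ?thesis using \<tau>(4)[of 0] by simp
    qed
    \<comment> \<open>Now forwards from the fixed time \<open>\<tau> 0\<close>: the energy has
      hardly grown, so the quadratic term must be small. The constant is
      \<open>4 * ((2 + C) + 2 + C)\<close>.\<close>
    have near: "(X_norm \<sigma> (\<lambda>x. u b x - u (\<tau> 0) x))\<^sup>2 \<le> (16 + 8 * C) * D"
      if b: "\<tau> 0 \<le> b" "b \<le> t" "finite_energy (u b)" "real_energy (u b) \<le> real_energy (u (\<tau> 0)) + (2 + C) * D" for b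
    proof -
      define R where "R = (b - \<tau> 0) * (dissipation b - dissipation (\<tau> 0))"
      have B: "0 \<le> dissipation b - dissipation (\<tau> 0)" "dissipation b - dissipation (\<tau> 0) \<le> D"
        using dissipation_mono[OF b(1)] bound[OF b(2) \<tau>0] by auto
      have "R \<le> 1 * D" unfolding R_def using B b \<tau>0 by (intro mult_mono) auto
      then have R: "R \<le> D" by simp
      have R0: "0 \<le> R" unfolding R_def using B b by simp
      have "W (\<tau> 0) * sqrt R \<le> 2 * D"
      proof (rule power2_le_imp_le)
        have "(W (\<tau> 0) * sqrt R)\<^sup>2 = (W (\<tau> 0))\<^sup>2 * R" using R0 by (simp add: power_mult_distrib)
        also have "\<dots> \<le> (2 * D) * D" using W0 R R0 D by (intro mult_mono) auto
        also have "\<dots> \<le> (2 * D)\<^sup>2" by (simp add: power2_eq_square)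
        finally show "(W (\<tau> 0) * sqrt R)\<^sup>2 \<le> (2 * D)\<^sup>2" .
      qed (use D in simp)
      moreover have "C * R \<le> C * D" using R C(1) by (rule mult_left_mono)
      moreover have "0 < b" using b(1) \<tau>pos[of 0] by linarith
      ultimately have "(X_norm \<sigma> (\<lambda>x. u b x - u (\<tau> 0) x))\<^sup>2 / 4 \<le> (2 + C) * D + 2 * D + C * D"
        using C(2)[OF \<tau>pos[of 0] _ \<tau>(3) b(3)] b(4) unfolding R_def by fastforce
      then show ?thesis by (simp add: algebra_simps)
    qed
    define M where "M = sqrt ((16 + 8 * C) * D)"
    have nearM: "X_norm \<sigma> (\<lambda>x. u (\<tau> k) x - u (\<tau> 0) x) \<le> M" for k
    proof -
      have "(X_norm \<sigma> (\<lambda>x. u (\<tau> k) x - u (\<tau> 0) x))\<^sup>2 \<le> (16 + 8 * C) * D"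
        by (rule near[OF \<tau>mono less_imp_le[OF \<tau>lt] fin E])
      then show ?thesis unfolding M_def by (rule real_le_rsqrt)
    qed
    have uX: "u (\<tau> k) \<in> X_space \<sigma> \<Omega>" "u t \<in> X_space \<sigma> \<Omega>" for k
      using \<tau>pos[of k] t by (auto intro: u_X_space)
    define K where "K = M + X_norm \<sigma> (u (\<tau> 0))"
    have K: "X_norm \<sigma> (u (\<tau> k)) \<le> K" for k
      using X_norm_triangle[OF \<sigma> X_space_diff[OF uX(1)[of k] uX(1)[of 0]] uX(1)[of 0]] nearM[of k]
      by (simp add: K_def)
    have "X_norm \<sigma> (\<lambda>x. u t x - u (\<tau> k) x) \<le> X_norm \<sigma> (\<lambda>x. u t x - u (\<tau> 0) x) + M" for k
      using X_norm_triangle_diff[OF \<sigma> uX(2) uX(1)[of 0] uX(1)[of k]] nearM[of k]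
        X_norm_commute[OF \<sigma>, of "u (\<tau> 0)" "u (\<tau> k)"] by simp
    moreover have "\<tau> \<longlonglongrightarrow> t"
    proof (rule tendsto_sandwich)
      show "\<forall>\<^sub>F k in sequentially. d k \<le> \<tau> k" "\<forall>\<^sub>F k in sequentially. \<tau> k \<le> t"
        using \<tau>(1) less_imp_le[OF \<tau>lt] by auto
      have "(\<lambda>k. t - (1 / 2 :: real) ^ k) \<longlonglongrightarrow> t - 0" by (intro tendsto_intros LIMSEQ_realpow_zero) auto
      then show "d \<longlonglongrightarrow> t" by (simp add: d_def[abs_def])
    qed simp
    ultimately have L2: "(\<lambda>k. LBINT x. (u (\<tau> k) x - u t x)\<^sup>2) \<longlonglongrightarrow> 0"
      by (intro u_L2_convergence \<tau>pos \<tau>lt)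
    have "integrable lborel (\<lambda>x. (u (\<tau> k) x - u t x)\<^sup>2)" for k
      using X_space_sq_integrable[OF X_space_diff[OF uX]] by (simp add: sq_integrable_def)
    \<comment> \<open>Lower semicontinuity requires almost everywhere convergence, which holds along
      a subsequence.\<close>
    from tendsto_L1_AE_subseq[of lborel "\<lambda>k x. (u (\<tau> k) x - u t x)\<^sup>2", OF this]
    have "\<exists>r::nat \<Rightarrow> nat. strict_mono r \<and> (AE x in lborel. (\<lambda>k. (u (\<tau> (r k)) x - u t x)\<^sup>2) \<longlonglongrightarrow> 0)"
      using L2 by simp
    then obtain r :: "nat \<Rightarrow> nat" where
      r: "strict_mono r" "AE x in lborel. (\<lambda>k. (u (\<tau> (r k)) x - u t x)\<^sup>2) \<longlonglongrightarrow> 0" by blast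
    have lim: "AE x in lborel. (\<lambda>k. u (\<tau> (r k)) x) \<longlonglongrightarrow> u t x"
      using r(2)
    proof eventually_elim
      case (elim x)
      then have "(\<lambda>k. sqrt ((u (\<tau> (r k)) x - u t x)\<^sup>2)) \<longlonglongrightarrow> sqrt 0" by (rule tendsto_real_sqrt)
      then show ?case by (simp add: tendsto_rabs_zero_iff LIM_zero_iff)
    qed
    have L2r: "(\<lambda>k. LBINT x. (u (\<tau> (r k)) x - u t x)\<^sup>2) \<longlonglongrightarrow> 0"
      using LIMSEQ_subseq_LIMSEQ[OF L2 r(1)] by (simp add: o_def)
    \<comment> \<open>Gives finiteness of the energy at the arbitrary time \<open>t\<close>,
      together with the energy bound that \<open>near\<close> asks for at
      \<open>b = t\<close>.\<close>
    note lsc = real_energy_lower_semicontinuous[of "\<lambda>k. u (\<tau> (r k))", OF uX(1) fin E K uX(2) lim L2r]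
    have "real_energy (u t) \<le> real_energy (u (\<tau> 0)) + (16 + 8 * C) * D"
    proof -
      have "(2 + C) * D \<le> (16 + 8 * C) * D" using C(1) D by (intro mult_right_mono) auto
      then show ?thesis using lsc(2) by linarith
    qed
    moreover have "(X_norm \<sigma> (\<lambda>x. u t x - u (\<tau> 0) x))\<^sup>2 \<le> (16 + 8 * C) * D"
      by (rule near[OF less_imp_le[OF \<tau>lt] order_refl lsc])
    ultimately show ?thesis using \<tau>0 \<tau>(3)[of 0] W0 lsc(1) unfolding D_def by blast
  qed
  then show ?thesis using that[of "16 + 8 * C"] C(1) by simp
qed

end

section \<open>Transfer to the notions of the statement\<close>

context cahn_hilliard
begin

lemma energy_eq_real_energy:
  assumes "v \<in> X_space \<sigma> \<Omega>" "finite_energy v"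
  shows "energy \<sigma> \<Omega> G v = ereal (real_energy v)"
proof -
  define f where "f x = indicator \<Omega> x *\<^sub>R G (v x)" for x
  have f: "integrable lborel f" using assms(2) 
    by (simp add: finite_energy_def set_integrable_def f_def[abs_def])
  have fin: "(\<integral>\<^sup>+x. ennreal (f x) \<partial>lborel) \<noteq> \<infinity>" "(\<integral>\<^sup>+x. ennreal (- f x) \<partial>lborel) \<noteq> \<infinity>"
    using real_integrable_def[of lborel f] f by auto
  have eq: "(\<integral>\<^sup>+x\<in>\<Omega>. ennreal (G (v x)) \<partial>lborel) = (\<integral>\<^sup>+x. ennreal (f x) \<partial>lborel)"
    "(\<integral>\<^sup>+x\<in>\<Omega>. ennreal (- G (v x)) \<partial>lborel) = (\<integral>\<^sup>+x. ennreal (- f x) \<partial>lborel)"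
    by (auto simp: f_def intro!: nn_integral_cong split: split_indicator)
  have e: "enn2ereal p = ereal (enn2real p)" if "p \<noteq> \<infinity>" for p
    using that by (cases p) (auto simp: enn2ereal_ennreal)
  have "(LINT x:\<Omega>|lborel. G (v x)) = enn2real (\<integral>\<^sup>+x. ennreal (f x) \<partial>lborel) - enn2real (\<integral>\<^sup>+x. ennreal (- f x) \<partial>lborel)"
    unfolding real_lebesgue_integral_def[OF f, symmetric] set_lebesgue_integral_def by (simp add: f_def[abs_def])
  then show ?thesis
    unfolding energy_def eq e[OF fin(1)] e[OF fin(2)] real_energy_def by simp
qed

lemma finite_energy_energy_domain:
  assumes "v \<in> X_space \<sigma> \<Omega>" "finite_energy v"
  shows "v \<in> energy_domain \<sigma> \<Omega> G"
proof -
  have "integrable lborel (\<lambda>x. max 0 (- (indicator \<Omega> x *\<^sub>R G (v x))))"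
    using assms(2) by (intro integrable_max) (auto simp: finite_energy_def set_integrable_def)
  moreover have "(\<lambda>x. indicator \<Omega> x *\<^sub>R max 0 (- G (v x))) = (\<lambda>x. max 0 (- (indicator \<Omega> x *\<^sub>R G (v x))))"
    by (auto simp: indicator_def)
  ultimately show ?thesis using assms(1) by (simp add: energy_domain_def set_integrable_def)
qed

lemma stationary_solution_iff_elliptic: "stationary_solution \<sigma> \<Omega> g \<phi> \<longleftrightarrow> elliptic \<phi> (\<lambda>x. 0)"
proof (cases "\<phi> \<in> X_space \<sigma> \<Omega>")
  case True
  note [measurable] = X_space_measurable[OF True]
  have "(\<lambda>x. g (\<phi> x)) \<in> borel_measurable borel" by measurable
  then show ?thesis
    using L2_functional_eq[OF _ _ \<Omega>(1), of _ \<sigma> "\<lambda>x. g (\<phi> x)"] L2_space_compose_iff[OF True g_continuous g0 \<Omega>(1)]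
    by (auto simp: stationary_solution_def elliptic_def True X_space_zero)
qed (simp add: stationary_solution_def elliptic_def)

text \<open>The omega-limit set consists of functions, while limits in the energy norm are unique
  only up to null sets. The Poincare inequality turns norm zero into equality almost everywhere, and
  the equation passes to the other representative.\<close>

lemma elliptic_cong_X_norm:
  assumes E: "elliptic \<phi> w" and \<psi>: "\<psi> \<in> X_space \<sigma> \<Omega>" and eq: "X_norm \<sigma> (\<lambda>x. \<phi> x - \<psi> x) = 0"
  shows "elliptic \<psi> w"
proof -
  have \<phi>: "\<phi> \<in> X_space \<sigma> \<Omega>" using E by (simp add: elliptic_def)
  note [measurable] = X_space_measurable[OF \<phi>] X_space_measurable[OF \<psi>]
  note d = X_space_diff[OF \<phi> \<psi>]
  obtain P where P: "P > 0" "\<And>v. v \<in> X_space \<sigma> \<Omega> \<Longrightarrow> (LBINT x. (v x)\<^sup>2) \<le> P * (X_norm \<sigma> v)\<^sup>2"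
    by (rule X_space_Poincare[OF \<sigma> \<Omega>(2)]) (rule that)
  have "(LBINT x. (\<phi> x - \<psi> x)\<^sup>2) \<le> 0" using P(2)[OF d] eq by simp
  then have "(LBINT x. (\<phi> x - \<psi> x)\<^sup>2) = 0" by (intro antisym) auto
  then have "AE x in lborel. (\<phi> x - \<psi> x)\<^sup>2 = 0"
    using X_space_sq_integrable[OF d] by (subst (asm) integral_nonneg_eq_0_iff_AE) (auto simp: sq_integrable_def)
  then have ae: "AE x in lborel. \<phi> x = \<psi> x" by eventually_elim simp
  have form: "frac_form \<sigma> \<psi> z = frac_form \<sigma> \<phi> z" if z: "z \<in> X_space \<sigma> \<Omega>" for z
    using frac_form_bound[OF \<sigma> d z] eq frac_form_diff_left[OF \<phi> \<psi> z] by simp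
  have int: "(LBINT x. g (\<psi> x) * z x) = (LBINT x. g (\<phi> x) * z x)" if z: "z \<in> X_space \<sigma> \<Omega>" for z
  proof (rule integral_cong_AE)
    note [measurable] = X_space_measurable[OF z]
    show "(\<lambda>x. g (\<psi> x) * z x) \<in> borel_measurable lborel" "(\<lambda>x. g (\<phi> x) * z x) \<in> borel_measurable lborel"
      by measurable
    show "AE x in lborel. g (\<psi> x) * z x = g (\<phi> x) * z x" using ae by eventually_elim simp
  qed
  have "sq_integrable lborel (\<lambda>x. g (\<psi> x))"
  proof (rule sq_integrable_bound)
    show "sq_integrable lborel (\<lambda>x. g (\<phi> x))" using E by (simp add: elliptic_def)
    show "AE x in lborel. \<bar>g (\<psi> x)\<bar> \<le> \<bar>g (\<phi> x)\<bar>" using ae by eventually_elim simp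
  qed measurable
  then show ?thesis using E \<psi> form int by (simp add: elliptic_def)
qed

end

section \<open>Convergence along the trajectory\<close>

context cahn_hilliard_solution
begin

text \<open>Each large time is paired with a nearby time at which the equation holds. Compactness is
  applied to the latter, and the limit is inherited because the two states approach each other. The
  energies are squeezed by two uses of \<open>elliptic_energy_inequality\<close>.\<close>

lemma trajectory_compactness:
  fixes t :: "nat \<Rightarrow> real"
  assumes t: "filterlim t at_top sequentially"
  obtains r :: "nat \<Rightarrow> nat" and \<phi> where "strict_mono r" "elliptic \<phi> (\<lambda>x. 0)"
    "\<And>n. 0 \<le> t (r n)" "\<And>n. finite_energy (u (t (r n)))"
    "(\<lambda>n. X_norm \<sigma> (\<lambda>x. u (t (r n)) x - \<phi> x)) \<longlonglongrightarrow> 0"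
    "(\<lambda>n. real_energy (u (t (r n)))) \<longlonglongrightarrow> real_energy \<phi>"
proof -
  obtain C where C: "C \<ge> 0" "\<And>t. t \<ge> 2 \<Longrightarrow> \<exists>\<tau>. t - 1 \<le> \<tau> \<and> elliptic (u \<tau>) (w \<tau>) \<and>
      (W \<tau>)\<^sup>2 \<le> 2 * (dissipation t - dissipation (t - 1)) \<and> finite_energy (u t) \<and>
      real_energy (u t) \<le> real_energy (u \<tau>) + C * (dissipation t - dissipation (t - 1)) \<and>
      (X_norm \<sigma> (\<lambda>x. u t x - u \<tau> x))\<^sup>2 \<le> C * (dissipation t - dissipation (t - 1))"
    by (rule elliptic_time_nearby) (rule that)
  obtain P where P: "P > 0" "\<And>v. v \<in> X_space \<sigma> \<Omega> \<Longrightarrow> (LBINT x. (v x)\<^sup>2) \<le> P * (X_norm \<sigma> v)\<^sup>2"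
    by (rule X_space_Poincare[OF \<sigma> \<Omega>(2)]) (rule that)
  obtain Q where Q: "Q > 0" "\<And>v. v \<in> X_space s \<Omega> \<Longrightarrow> (LBINT x. (v x)\<^sup>2) \<le> Q * (X_norm s v)\<^sup>2"
    by (rule X_space_Poincare[OF s \<Omega>(2)]) (rule that)
  have "\<forall>\<^sub>F n in sequentially. t n \<ge> 2" using t by (simp add: filterlim_at_top)
  \<comment> \<open>Drops the initial indices, for which the time may be below 2 and no nearby
    elliptic time is provided; the shift by \<open>N\<close> reappears in the final
    subsequence.\<close>
  then obtain N where N: "\<And>n. n \<ge> N \<Longrightarrow> t n \<ge> 2" by (auto simp: eventually_sequentially)
  define T where "T n = t (n + N)" for n
  have T2: "T n \<ge> 2" for n by (simp add: T_def N)
  have T: "filterlim T at_top sequentially"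
    unfolding T_def by (rule filterlim_compose[OF t]) (rule filterlim_add_const_nat_at_top)
  define D where "D n = dissipation (T n) - dissipation (T n - 1)" for n
  have D: "D \<longlonglongrightarrow> 0" unfolding D_def by (rule filterlim_compose[OF dissipation_vanishes T])
  obtain \<tau> where \<tau>: "\<And>n. T n - 1 \<le> \<tau> n" "\<And>n. elliptic (u (\<tau> n)) (w (\<tau> n))" "\<And>n. (W (\<tau> n))\<^sup>2 \<le> 2 * D n"
    "\<And>n. finite_energy (u (T n))" "\<And>n. real_energy (u (T n)) \<le> real_energy (u (\<tau> n)) + C * D n"
    "\<And>n. (X_norm \<sigma> (\<lambda>x. u (T n) x - u (\<tau> n) x))\<^sup>2 \<le> C * D n"
  proof -
    have "\<forall>n. \<exists>\<tau>. T n - 1 \<le> \<tau> \<and> elliptic (u \<tau>) (w \<tau>) \<and> (W \<tau>)\<^sup>2 \<le> 2 * D n \<and> finite_energy (u (T n)) \<and>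
        real_energy (u (T n)) \<le> real_energy (u \<tau>) + C * D n \<and>
        (X_norm \<sigma> (\<lambda>x. u (T n) x - u \<tau> x))\<^sup>2 \<le> C * D n"
      using C(2)[OF T2] unfolding D_def by blast
    from choice[OF this] show ?thesis using that by blast
  qed
  have uX: "u (T n) \<in> X_space \<sigma> \<Omega>" "u (\<tau> n) \<in> X_space \<sigma> \<Omega>" for n
    using T2[of n] \<tau>(1)[of n] by (auto intro: u_X_space)
  have W0: "(\<lambda>n. W (\<tau> n)) \<longlonglongrightarrow> 0"
  proof (rule tendsto_sandwich[OF _ _ tendsto_const])
    show "\<forall>\<^sub>F n in sequentially. W (\<tau> n) \<le> sqrt (2 * D n)"
      by (intro always_eventually allI real_le_rsqrt \<tau>(3))
    have "(\<lambda>n. sqrt (2 * D n)) \<longlonglongrightarrow> sqrt (2 * 0)" by (intro tendsto_intros D)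
    then show "(\<lambda>n. sqrt (2 * D n)) \<longlonglongrightarrow> 0" by simp
  qed (simp add: W_nonneg)
  obtain q \<phi> where q: "strict_mono (q :: nat \<Rightarrow> nat)" "elliptic \<phi> (\<lambda>x. 0)"
    "(\<lambda>n. X_norm \<sigma> (\<lambda>x. u (\<tau> (q n)) x - \<phi> x)) \<longlonglongrightarrow> 0"
    by (rule elliptic_compactness[of "\<lambda>n. u (\<tau> n)" "\<lambda>n. w (\<tau> n)", OF \<tau>(2) W0[unfolded W_def]]) (rule that)
  have \<phi>: "\<phi> \<in> X_space \<sigma> \<Omega>" using q(2) by (simp add: elliptic_def)
  have f\<phi>: "finite_energy \<phi>" by (rule elliptic_finite_energy[OF q(2)])
  have Dq: "(\<lambda>n. D (q n)) \<longlonglongrightarrow> 0" using LIMSEQ_subseq_LIMSEQ[OF D q(1)] by (simp add: o_def)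
  have Wq: "(\<lambda>n. W (\<tau> (q n))) \<longlonglongrightarrow> 0" using LIMSEQ_subseq_LIMSEQ[OF W0 q(1)] by (simp add: o_def)
  define x where "x n = X_norm \<sigma> (\<lambda>x. u (T (q n)) x - \<phi> x)" for n
  define y where "y n = X_norm \<sigma> (\<lambda>x. u (\<tau> (q n)) x - \<phi> x)" for n
  have y0: "y \<longlonglongrightarrow> 0" using q(3) by (simp add: y_def[abs_def])
  have x0: "x \<longlonglongrightarrow> 0"
  proof (rule tendsto_sandwich[OF _ _ tendsto_const])
    have "x n \<le> sqrt (C * D (q n)) + y n" for n
      using X_norm_triangle_diff[OF \<sigma> uX(1)[of "q n"] uX(2)[of "q n"] \<phi>] real_le_rsqrt[OF \<tau>(6)[of "q n"]]
      by (simp add: x_def y_def)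
    then show "\<forall>\<^sub>F n in sequentially. x n \<le> sqrt (C * D (q n)) + y n" by simp
    have "(\<lambda>n. sqrt (C * D (q n)) + y n) \<longlonglongrightarrow> sqrt (C * 0) + 0" by (intro tendsto_intros Dq y0)
    then show "(\<lambda>n. sqrt (C * D (q n)) + y n) \<longlonglongrightarrow> 0" by simp
  qed (simp add: x_def X_norm_nonneg[OF \<sigma>])
  \<comment> \<open>The inequality at the elliptic state, with \<open>\<phi>\<close> as competitor,
    followed by the energy bound from that state to \<open>u (T (q n))\<close>.\<close>
  have upper: "real_energy (u (T (q n))) \<le> real_energy \<phi> + sqrt Q * W (\<tau> (q n)) * (sqrt P * y n) +
      \<Lambda> / 2 * (P * (y n)\<^sup>2) + C * D (q n)" for n
  proof -
    let ?v = "u (\<tau> (q n))" and ?w = "w (\<tau> (q n))"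
    have w: "?w \<in> X_space s \<Omega>" using \<tau>(2)[of "q n"] by (simp add: elliptic_def)
    have d: "(\<lambda>x. \<phi> x - ?v x) \<in> X_space \<sigma> \<Omega>" by (rule X_space_diff[OF \<phi> uX(2)])
    have y: "y n = X_norm \<sigma> (\<lambda>x. \<phi> x - ?v x)" "0 \<le> y n"
      by (simp_all add: y_def X_norm_commute[OF \<sigma>, of \<phi>] X_norm_nonneg[OF \<sigma>])
    have d2: "(LBINT x. (\<phi> x - ?v x)\<^sup>2) \<le> P * (y n)\<^sup>2" using P(2)[OF d] by (simp add: y(1))
    have "\<bar>\<integral>x. ?w x * (\<phi> x - ?v x) \<partial>lborel\<bar> \<le> sqrt (LBINT x. (?w x)\<^sup>2) * sqrt (LBINT x. (\<phi> x - ?v x)\<^sup>2)"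
      by (rule sq_integrable_Cauchy_Schwarz_abs[OF X_space_sq_integrable[OF w] X_space_sq_integrable[OF d]])
    also have "\<dots> \<le> sqrt (Q * (W (\<tau> (q n)))\<^sup>2) * sqrt (P * (y n)\<^sup>2)"
      using Q(2)[OF w] d2 Q(1) by (intro mult_mono real_sqrt_le_mono) (auto simp: W_def)
    also have "\<dots> = sqrt Q * W (\<tau> (q n)) * (sqrt P * y n)"
      using y(2) by (simp add: real_sqrt_mult W_nonneg)
    finally have "\<bar>\<integral>x. ?w x * (\<phi> x - ?v x) \<partial>lborel\<bar> \<le> sqrt Q * W (\<tau> (q n)) * (sqrt P * y n)" .
    moreover have "\<Lambda> / 2 * (LBINT x. (\<phi> x - ?v x)\<^sup>2) \<le> \<Lambda> / 2 * (P * (y n)\<^sup>2)"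
      using d2 \<Lambda> by (intro mult_left_mono) auto
    moreover have "0 \<le> (X_norm \<sigma> (\<lambda>x. \<phi> x - ?v x))\<^sup>2 / 2" by simp
    ultimately show ?thesis
      using elliptic_energy_inequality[OF \<tau>(2)[of "q n"] \<phi> f\<phi>] \<tau>(5)[of "q n"] by linarith
  qed
  \<comment> \<open>The inequality at \<open>\<phi>\<close>, whose right-hand side is 0, with
    \<open>u (T (q n))\<close> as competitor.\<close>
  have lower: "real_energy \<phi> - \<Lambda> / 2 * (P * (x n)\<^sup>2) \<le> real_energy (u (T (q n)))" for n
  proof -
    have "\<Lambda> / 2 * (LBINT x. (u (T (q n)) x - \<phi> x)\<^sup>2) \<le> \<Lambda> / 2 * (P * (x n)\<^sup>2)"
      using P(2)[OF X_space_diff[OF uX(1) \<phi>], of "q n"] \<Lambda> by (intro mult_left_mono) (auto simp: x_def)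
    moreover have "0 \<le> (X_norm \<sigma> (\<lambda>x. u (T (q n)) x - \<phi> x))\<^sup>2 / 2" by simp
    ultimately show ?thesis
      using elliptic_energy_inequality[OF q(2) uX(1) \<tau>(4), of "q n"]
      unfolding mult_zero_left Bochner_Integration.integral_zero by linarith
  qed
  have "(\<lambda>n. real_energy (u (T (q n)))) \<longlonglongrightarrow> real_energy \<phi>"
  proof (rule tendsto_sandwich)
    show "\<forall>\<^sub>F n in sequentially. real_energy \<phi> - \<Lambda> / 2 * (P * (x n)\<^sup>2) \<le> real_energy (u (T (q n)))"
      using lower by simp
    show "\<forall>\<^sub>F n in sequentially. real_energy (u (T (q n))) \<le> real_energy \<phi> + sqrt Q * W (\<tau> (q n)) * (sqrt P * y n) +
      \<Lambda> / 2 * (P * (y n)\<^sup>2) + C * D (q n)"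
      using upper by simp
    have "(\<lambda>n. real_energy \<phi> - \<Lambda> / 2 * (P * (x n)\<^sup>2)) \<longlonglongrightarrow> real_energy \<phi> - \<Lambda> / 2 * (P * 0\<^sup>2)"
      by (intro tendsto_intros x0)
    then show "(\<lambda>n. real_energy \<phi> - \<Lambda> / 2 * (P * (x n)\<^sup>2)) \<longlonglongrightarrow> real_energy \<phi>" by simp
    have "(\<lambda>n. real_energy \<phi> + sqrt Q * W (\<tau> (q n)) * (sqrt P * y n) + \<Lambda> / 2 * (P * (y n)\<^sup>2) + C * D (q n))
       \<longlonglongrightarrow> real_energy \<phi> + sqrt Q * 0 * (sqrt P * 0) + \<Lambda> / 2 * (P * 0\<^sup>2) + C * 0"
      by (intro tendsto_intros Wq y0 Dq)
    then show "(\<lambda>n. real_energy \<phi> + sqrt Q * W (\<tau> (q n)) * (sqrt P * y n) + \<Lambda> / 2 * (P * (y n)\<^sup>2) + C * D (q n))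
       \<longlonglongrightarrow> real_energy \<phi>" by simp
  qed
  moreover have "strict_mono (\<lambda>n. q n + N)" using q(1) by (simp add: strict_mono_def)
  moreover have "0 \<le> t (q n + N)" for n using N[of "q n + N"] by simp
  ultimately show ?thesis
    using that[of "\<lambda>n. q n + N" \<phi>] q(2) \<tau>(4) x0 by (simp add: T_def x_def[abs_def])
qed

lemma convergence_to_stationary_solutions:
  "(\<forall>t::nat \<Rightarrow> real. filterlim t at_top sequentially \<longrightarrow>
      (\<exists>(r::nat \<Rightarrow> nat) \<phi>. strict_mono r \<and>
         (\<forall>n. u (t (r n)) \<in> energy_domain \<sigma> \<Omega> G) \<and> \<phi> \<in> energy_domain \<sigma> \<Omega> G \<and>
         (\<lambda>n. X_norm \<sigma> (u (t (r n)) - \<phi>)) \<longlonglongrightarrow> 0 \<and>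
         (\<lambda>n. energy \<sigma> \<Omega> G (u (t (r n)))) \<longlonglongrightarrow> energy \<sigma> \<Omega> G \<phi> \<and>
         stationary_solution \<sigma> \<Omega> g \<phi>)) \<and>
   omega_limit \<sigma> \<Omega> u \<noteq> {} \<and>
   omega_limit \<sigma> \<Omega> u \<subseteq> {\<phi>. stationary_solution \<sigma> \<Omega> g \<phi>}"
proof (intro conjI allI impI)
  fix t :: "nat \<Rightarrow> real" assume t: "filterlim t at_top sequentially"
  obtain r :: "nat \<Rightarrow> nat" and \<phi> where r: "strict_mono r" "elliptic \<phi> (\<lambda>x. 0)"
    "\<And>n. 0 \<le> t (r n)" "\<And>n. finite_energy (u (t (r n)))"
    "(\<lambda>n. X_norm \<sigma> (\<lambda>x. u (t (r n)) x - \<phi> x)) \<longlonglongrightarrow> 0"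
    "(\<lambda>n. real_energy (u (t (r n)))) \<longlonglongrightarrow> real_energy \<phi>"
    by (rule trajectory_compactness[OF t]) (rule that)
  have \<phi>: "\<phi> \<in> X_space \<sigma> \<Omega>" using r(2) by (simp add: elliptic_def)
  note f\<phi> = elliptic_finite_energy[OF r(2)]
  have uX: "u (t (r n)) \<in> X_space \<sigma> \<Omega>" for n by (rule u_X_space[OF r(3)])
  have "(\<lambda>n. energy \<sigma> \<Omega> G (u (t (r n)))) \<longlonglongrightarrow> energy \<sigma> \<Omega> G \<phi>"
    using r(6) by (simp add: energy_eq_real_energy[OF uX r(4)] energy_eq_real_energy[OF \<phi> f\<phi>])
  then show "\<exists>(r::nat \<Rightarrow> nat) \<phi>. strict_mono r \<and>
         (\<forall>n. u (t (r n)) \<in> energy_domain \<sigma> \<Omega> G) \<and> \<phi> \<in> energy_domain \<sigma> \<Omega> G \<and>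
         (\<lambda>n. X_norm \<sigma> (u (t (r n)) - \<phi>)) \<longlonglongrightarrow> 0 \<and>
         (\<lambda>n. energy \<sigma> \<Omega> G (u (t (r n)))) \<longlonglongrightarrow> energy \<sigma> \<Omega> G \<phi> \<and>
         stationary_solution \<sigma> \<Omega> g \<phi>"
    using r(1,5) r(2)[folded stationary_solution_iff_elliptic] finite_energy_energy_domain[OF uX r(4)]
      finite_energy_energy_domain[OF \<phi> f\<phi>]
    by (intro exI[of _ r] exI[of _ \<phi>]) (simp add: fun_diff_def)
next
  \<comment> \<open>Any sequence of times tending to infinity yields an element; the integers are
    taken.\<close>
  obtain r :: "nat \<Rightarrow> nat" and \<phi> where r: "strict_mono r" "elliptic \<phi> (\<lambda>x. 0)"
    "\<And>n. 0 \<le> real (r n)" "\<And>n. finite_energy (u (real (r n)))"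
    "(\<lambda>n. X_norm \<sigma> (\<lambda>x. u (real (r n)) x - \<phi> x)) \<longlonglongrightarrow> 0"
    "(\<lambda>n. real_energy (u (real (r n)))) \<longlonglongrightarrow> real_energy \<phi>"
    by (rule trajectory_compactness[OF filterlim_real_sequentially]) (rule that)
  have "filterlim (\<lambda>n. real (r n)) at_top sequentially"
    by (rule filterlim_compose[OF filterlim_real_sequentially filterlim_subseq[OF r(1)]])
  then have "\<phi> \<in> omega_limit \<sigma> \<Omega> u"
    using r(2,5) by (auto simp: omega_limit_def elliptic_def fun_diff_def intro!: exI[of _ "\<lambda>n. real (r n)"])
  then show "omega_limit \<sigma> \<Omega> u \<noteq> {}" by blast
next
  show "omega_limit \<sigma> \<Omega> u \<subseteq> {\<phi>. stationary_solution \<sigma> \<Omega> g \<phi>}"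
  proof
    fix \<psi> assume "\<psi> \<in> omega_limit \<sigma> \<Omega> u"
    then obtain t :: "nat \<Rightarrow> real" where \<psi>: "\<psi> \<in> X_space \<sigma> \<Omega>" and t: "filterlim t at_top sequentially"
      and lim: "(\<lambda>n. X_norm \<sigma> (\<lambda>x. u (t n) x - \<psi> x)) \<longlonglongrightarrow> 0"
      by (auto simp: omega_limit_def fun_diff_def)
    obtain r :: "nat \<Rightarrow> nat" and \<phi> where r: "strict_mono r" "elliptic \<phi> (\<lambda>x. 0)"
      "\<And>n. 0 \<le> t (r n)" "\<And>n. finite_energy (u (t (r n)))"
      "(\<lambda>n. X_norm \<sigma> (\<lambda>x. u (t (r n)) x - \<phi> x)) \<longlonglongrightarrow> 0"
      "(\<lambda>n. real_energy (u (t (r n)))) \<longlonglongrightarrow> real_energy \<phi>"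
      by (rule trajectory_compactness[OF t]) (rule that)
    have \<phi>: "\<phi> \<in> X_space \<sigma> \<Omega>" using r(2) by (simp add: elliptic_def)
    have uX: "u (t (r n)) \<in> X_space \<sigma> \<Omega>" for n by (rule u_X_space[OF r(3)])
    \<comment> \<open>\<open>\<phi>\<close> and \<open>\<psi>\<close> are limits of the same
      sequence, so their difference has norm 0.\<close>
    have "(\<lambda>n. X_norm \<sigma> (\<lambda>x. u (t (r n)) x - \<psi> x)) \<longlonglongrightarrow> 0"
      using LIMSEQ_subseq_LIMSEQ[OF lim r(1)] by (simp add: o_def)
    from tendsto_add[OF r(5) this]
    have "(\<lambda>n. X_norm \<sigma> (\<lambda>x. u (t (r n)) x - \<phi> x) + X_norm \<sigma> (\<lambda>x. u (t (r n)) x - \<psi> x)) \<longlonglongrightarrow> 0" by simp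
    moreover have "X_norm \<sigma> (\<lambda>x. \<phi> x - \<psi> x) \<le> X_norm \<sigma> (\<lambda>x. u (t (r n)) x - \<phi> x) + X_norm \<sigma> (\<lambda>x. u (t (r n)) x - \<psi> x)" for n
      using X_norm_triangle_diff[OF \<sigma> \<phi> uX \<psi>, of n] X_norm_commute[OF \<sigma>, of \<phi>] by simp
    ultimately have "X_norm \<sigma> (\<lambda>x. \<phi> x - \<psi> x) \<le> 0"
      by (rule LIMSEQ_le_const[OF _ exI[of _ 0], rule_format])
    then have "X_norm \<sigma> (\<lambda>x. \<phi> x - \<psi> x) = 0" by (rule antisym) (rule X_norm_nonneg[OF \<sigma>])
    from elliptic_cong_X_norm[OF r(2) \<psi> this]
    show "\<psi> \<in> {\<phi>. stationary_solution \<sigma> \<Omega> g \<phi>}" by (simp add: stationary_solution_iff_elliptic)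
  qed
qed

end

theorem lemma3p1:
  fixes \<Omega> :: "(real ^ 'n) set"
    and s \<sigma> \<Lambda> :: real
    and g \<beta>hat ghat :: "real \<Rightarrow> real"
    and u0 :: "real ^ 'n \<Rightarrow> real"
    and u w :: "real \<Rightarrow> real ^ 'n \<Rightarrow> real"
  assumes "smooth_bounded_domain \<Omega>"
    and "0 < s" "s < 1" "0 < \<sigma>" "\<sigma> < 1"
    and "g C1_differentiable_on UNIV" "g 0 = 0"
    and "\<Lambda> \<ge> 0" "\<And>r. deriv g r \<ge> - \<Lambda>"
    and "\<exists>\<kappa>>0. Liminf at_infinity (\<lambda>r. ereal (g r * r + (lambda1 \<sigma> \<Omega> - \<kappa>) * r\<^sup>2)) > 0"
    and "\<And>r. (\<beta>hat has_real_derivative (g r + \<Lambda> * r)) (at r)"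
    and "\<And>r. (ghat has_real_derivative g r) (at r)"
    and "u0 \<in> X_space \<sigma> \<Omega>"
    and "set_integrable lborel \<Omega> (\<lambda>x. \<beta>hat (u0 x))"
    and "weak_solution \<Omega> s \<sigma> g 0 \<infinity> u w"
    and "AE x in lborel. u 0 x = u0 x"
  shows "(\<forall>t::nat \<Rightarrow> real. filterlim t at_top sequentially \<longrightarrow>
            (\<exists>(r::nat \<Rightarrow> nat) \<phi>. strict_mono r \<and>
               (\<forall>n. u (t (r n)) \<in> energy_domain \<sigma> \<Omega> ghat) \<and> \<phi> \<in> energy_domain \<sigma> \<Omega> ghat \<and>
               (\<lambda>n. X_norm \<sigma> (u (t (r n)) - \<phi>)) \<longlonglongrightarrow> 0 \<and>
               (\<lambda>n. energy \<sigma> \<Omega> ghat (u (t (r n)))) \<longlonglongrightarrow> energy \<sigma> \<Omega> ghat \<phi> \<and>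
               stationary_solution \<sigma> \<Omega> g \<phi>)) \<and>
         omega_limit \<sigma> \<Omega> u \<noteq> {} \<and>
         omega_limit \<sigma> \<Omega> u \<subseteq> {\<phi>. stationary_solution \<sigma> \<Omega> g \<phi>}"
proof -
  interpret cahn_hilliard_solution \<Omega> s \<sigma> \<Lambda> g ghat u w
    using assms by unfold_locales (auto simp: smooth_bounded_domain_def)
  show ?thesis by (rule convergence_to_stationary_solutions)
qed

end
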